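(* Let $r \ge 1$ be an integer and let $\psi : \mathbb{N} \to (0,\infty)$ be an arbitrary positive function such that $\min_{m\ge n}\psi(m)$ exists for every $n\in\mathbb{N}$. Let \[ F(r,\psi) = \Big\{ x \in [0,1) : \text{for infinitely many } n\in\mathbb{N} \text{ there exist } 1 \le k_1 < \cdots < k_r \le n \text{ with } a_{k_i}(x) \ge \psi(n) \text{ for } i=1,\ldots,r \Big\}, \] and define $B$ and $b$ (possibly $+\infty$) by \[ \log B = \liminf_{n \to \infty} \frac{\log \big(\min_{m\geq n}\psi(m)\big) }{n}, \qquad \log b = \liminf_{n \to \infty} \frac{\log \log \big(\min_{m\geq n}\psi(m)\big)}{n}. \] Then the Hausdorff dimension of $F(r,\psi)$ is \[ \dim_{\mathrm{H}} F(r, \psi)=\begin{cases} 1, &\text{if } B=1,\\ \inf \Big\{ s \geq 0: P\Big(T, -s \log |T'|-\big(s+(2s-1)(r-1)\big) \log B \Big) \leq 0 \Big\}, & \text{if } 1 < B < \infty, \\ \dfrac{1}{1+b}, &\text{if } B= \infty. \end{cases} \]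
   Context: $\mathbb{N}=\{1,2,3,\ldots\}$. The Gauss map $T:[0,1)\to[0,1)$ is $T(0)=0$ and $T(x)=1/x-\lfloor 1/x\rfloor$ for $x\in(0,1)$; $T'$ is its derivative, so $|T'(x)|=x^{-2}$. The partial quotients of $x$ are $a_1(x)=\lfloor 1/x\rfloor$ and $a_{n+1}(x)=a_1(T^n(x))$ for $n\ge1$. For rational $x$ only finitely many partial quotients are defined (those with $T^{k-1}(x)\neq 0$), and a condition $a_k(x)\ge c$ is understood to require that $a_k(x)$ is defined. For positive integers $a_1,\dots,a_n$ and $x\in[0,1)$, $[a_1,\ldots,a_n+x]$ denotes the continued fraction $\cfrac{1}{a_1+\cfrac{1}{\ddots+\cfrac{1}{a_n+x}}}$. For $\varphi:[0,1)\to\mathbb{R}$ the pressure function is \[ P(T,\varphi)=\lim_{n\to\infty}\frac1n\log\sum_{a_1,\ldots,a_n\in\mathbb{N}}\ \sup_{x\in[0,1)} e^{S_n\varphi([a_1,\ldots,a_n+x])},\qquad S_n\varphi(y)=\varphi(y)+\varphi(Ty)+\cdots+\varphi(T^{n-1}y), \] with value in $[-\infty,+\infty]$. For the potential in the claim this is, explicitly, \[ P\Big(T, -s \log |T'|-\big(s+(2s-1)(r-1)\big) \log B \Big)=\lim_{n\to\infty}\frac1n\log\sum_{(a_1,\ldots,a_n)\in\mathbb{N}^n}\frac{1}{q_n(a_1,\ldots,a_n)^{2s}\,B^{n(s+(2s-1)(r-1))}}, \] where $q_n(a_1,\ldots,a_n)$ is the denominator of the convergent $[a_1,\ldots,a_n]$,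 given by $q_{-1}=0$, $q_0=1$, $q_{k+1}=a_{k+1}q_k+q_{k-1}$. Conventions: $B=\infty$ (resp. $b=\infty$) when the corresponding liminf is $+\infty$, and $\frac{1}{1+b}=0$ when $b=\infty$. The quantity $b$ is only used when $B=\infty$, in which case $\log\log(\min_{m\ge n}\psi(m))$ is defined for all large $n$. $\dim_{\mathrm{H}}$ is Hausdorff dimension. *)

theory Defs
  imports "HOL-Analysis.Analysis"
begin

text \<open>The \<open>s\<close>-th power of the diameter of a bounded set, with the convention that a nonempty set
  contributes \<open>1\<close> when \<open>s = 0\<close> (note that \<open>0 powr 0 = 0\<close> in the library).\<close>

definition diam_pow :: "real \<Rightarrow> 'a::metric_space set \<Rightarrow> ennreal" where
  "diam_pow s U =
     (if U = {} then 0 else if s = 0 then 1 else ennreal (diameter U powr s))"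

text \<open>Boundedness is required in covers because \<^const>\<open>diameter\<close> is meaningful only for bounded sets.\<close>

definition hausdorff_premeasure :: "real \<Rightarrow> real \<Rightarrow> 'a::metric_space set \<Rightarrow> ennreal" where
  "hausdorff_premeasure s \<delta> A =
     Inf {(\<Sum>i. diam_pow s (U i)) | U :: nat \<Rightarrow> 'a set.
            A \<subseteq> (\<Union>i. U i) \<and> (\<forall>i. bounded (U i) \<and> diameter (U i) \<le> \<delta>)}"

definition hausdorff_outer_measure :: "real \<Rightarrow> 'a::metric_space set \<Rightarrow> ennreal" where
  "hausdorff_outer_measure s A = (SUP \<delta>\<in>{0<..}. hausdorff_premeasure s \<delta> A)"

definition hausdorff_dim :: "'a::metric_space set \<Rightarrow> ennreal" where
  "hausdorff_dim A = Inf (ennreal ` {s. 0 \<le> s \<and> hausdorff_outer_measure s A = 0})"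

definition ln_ennreal :: "ennreal \<Rightarrow> ereal" where
  "ln_ennreal x = (if x = 0 then -\<infinity> else if x = \<infinity> then \<infinity> else ereal (ln (enn2real x)))"

text \<open>An equation \<open>ln_ennreal B = l\<close> determines \<open>B\<close>, for every \<open>l\<close>.\<close>

lemma bij_ln_ennreal: "bij ln_ennreal"
proof (rule bijI)
  show "inj ln_ennreal"
  proof (rule injI)
    fix x y :: ennreal
    assume "ln_ennreal x = ln_ennreal y"
    then show "x = y"
      by (cases x; cases y) (auto simp: ln_ennreal_def ennreal_eq_0_iff split: if_splits)
  qed
  have "\<exists>x. y = ln_ennreal x" for y
  proof (cases y)
    case (real r)
    then show ?thesis
      by (intro exI[of _ "ennreal (exp r)"]) (auto simp: ln_ennreal_def ennreal_eq_0_iff not_le)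
  next
    case PInf
    then show ?thesis by (intro exI[of _ \<infinity>]) (auto simp: ln_ennreal_def)
  next
    case MInf
    then show ?thesis by (intro exI[of _ 0]) (auto simp: ln_ennreal_def)
  qed
  then show "surj ln_ennreal" by (simp add: surj_def)
qed

definition gauss_map :: "real \<Rightarrow> real" where
  "gauss_map x = (if x = 0 then 0 else 1 / x - of_int \<lfloor>1 / x\<rfloor>)"

text \<open>The derivative \<open>T'\<close>, extended by the same formula to the points \<open>1 / k\<close>, where the Gauss map
  jumps and only the left derivative exists. At \<open>0\<close> it takes the value \<open>0\<close>, so that
  \<open>ln \<bar>gauss_deriv 0\<bar> = 0\<close>.\<close>

definition gauss_deriv :: "real \<Rightarrow> real" where
  "gauss_deriv x = - 1 / x\<^sup>2"

lemma has_derivative_gauss_map: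
  assumes "0 < x" "1 / x \<notin> \<int>"
  shows "(gauss_map has_real_derivative gauss_deriv x) (at x)"
proof -
  define m where "m = \<lfloor>1 / x\<rfloor>"
  have m: "of_int m < 1 / x" "1 / x < of_int m + 1"
    using assms(2) unfolding m_def
    by (metis Ints_of_int of_int_floor_le order_le_less, linarith)
  have tend: "((\<lambda>y. 1 / y) \<longlongrightarrow> 1 / x) (at x)"
    using assms(1) by (auto intro!: tendsto_intros)
  have "eventually (\<lambda>y. 0 < y) (at x)"
    using assms(1) by (intro order_tendstoD(1)[OF tendsto_ident_at]) auto
  moreover have "eventually (\<lambda>y. of_int m < 1 / y) (at x)" "eventually (\<lambda>y. 1 / y < of_int m + 1) (at x)"
    using order_tendstoD[OF tend] m by auto
  ultimately have ev: "eventually (\<lambda>y. 1 / y - of_int m = gauss_map y) (at x)"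
  proof eventually_elim
    case (elim y)
    then have "\<lfloor>1 / y\<rfloor> = m" by (intro floor_unique) auto
    with elim show ?case by (simp add: gauss_map_def)
  qed
  have "((\<lambda>y. 1 / y - of_int m) has_real_derivative gauss_deriv x) (at x)"
    using assms(1) by (auto intro!: derivative_eq_intros simp: gauss_deriv_def power2_eq_square)
  moreover have "1 / x - of_int m = gauss_map x"
    using assms(1) by (simp add: gauss_map_def m_def)
  ultimately show ?thesis
    using ev by (simp add: has_field_derivative_cong_eventually)
qed

definition pq_defined :: "nat \<Rightarrow> real \<Rightarrow> bool" where
  "pq_defined k x \<longleftrightarrow> (gauss_map ^^ (k - 1)) x \<noteq> 0"

text \<open>\<open>partial_quotient k x\<close> is \<open>a\<^sub>k(x)\<close> for \<open>k \<ge> 1\<close>; meaningful only if \<open>pq_defined k x\<close>.\<close>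

definition partial_quotient :: "nat \<Rightarrow> real \<Rightarrow> int" where
  "partial_quotient k x = \<lfloor>1 / (gauss_map ^^ (k - 1)) x\<rfloor>"

text \<open>\<open>cf_eval [a\<^sub>1, \<dots>, a\<^sub>n] x\<close> is \<open>[a\<^sub>1, \<dots>, a\<^sub>n + x]\<close>.\<close>

definition cf_eval :: "nat list \<Rightarrow> real \<Rightarrow> real" where
  "cf_eval as x = foldr (\<lambda>a t. 1 / (real a + t)) as x"

definition birkhoff_sum :: "nat \<Rightarrow> (real \<Rightarrow> real) \<Rightarrow> real \<Rightarrow> real" where
  "birkhoff_sum n \<phi> y = (\<Sum>k<n. \<phi> ((gauss_map ^^ k) y))"

text \<open>The point \<open>[1 + 0] = 1\<close>, occurring for \<open>n = 1\<close>, is the only argument outside \<open>[0,1)\<close> at which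
  \<open>\<phi>\<close> is evaluated. For \<open>n > 1\<close>, \<open>a\<^sub>n = 1\<close> and \<open>x = 0\<close> the last point of the orbit is \<open>0\<close> instead
  of \<open>1\<close>; the potential \<open>-s log |T'|\<close> takes the same value there, since
  \<open>ln \<bar>gauss_deriv 0\<bar> = 0 = ln \<bar>gauss_deriv 1\<bar>\<close>. Hence for \<open>\<phi> = -s log |T'| - c\<close> with \<open>s \<ge> 0\<close>
  each supremum equals \<open>q\<^sub>n(a\<^sub>1, \<dots>, a\<^sub>n) powr (-2s) * exp (-n c)\<close>. The value \<open>\<infinity>\<close> of the sum is allowed.\<close>

definition pressure :: "(real \<Rightarrow> real) \<Rightarrow> ereal" where
  "pressure \<phi> =
     lim (\<lambda>n. ereal (1 / real n) *
       ln_ennreal (\<Sum>\<^sub>\<infinity>as\<in>{as. length as = n \<and> (\<forall>a\<in>set as. 1 \<le> a)}.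
         SUP x\<in>{0..<1}. ennreal (exp (birkhoff_sum n \<phi> (cf_eval as x)))))"

text \<open>Functions on the positive integers are functions on \<^typ>\<open>nat\<close> whose value at \<open>0\<close> is
  irrelevant.\<close>

definition F_set :: "nat \<Rightarrow> (nat \<Rightarrow> real) \<Rightarrow> real set" where
  "F_set r \<psi> = {x. 0 \<le> x \<and> x < 1 \<and>
     infinite {n. 1 \<le> n \<and>
       (\<exists>k :: nat \<Rightarrow> nat. strict_mono_on {1..r} k \<and>
          (\<forall>i\<in>{1..r}. 1 \<le> k i \<and> k i \<le> n \<and>
             pq_defined (k i) x \<and> \<psi> n \<le> of_int (partial_quotient (k i) x)))}}"

definition has_tail_minima :: "(nat \<Rightarrow> real) \<Rightarrow> bool" where
  "has_tail_minima \<psi> \<longleftrightarrow> (\<forall>n\<ge>1. \<exists>m\<ge>n. \<forall>k\<ge>n. \<psi> m \<le> \<psi> k)"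

definition tail_min :: "(nat \<Rightarrow> real) \<Rightarrow> nat \<Rightarrow> real" where
  "tail_min \<psi> n = (LEAST y. y \<in> \<psi> ` {n..})"

lemma tail_min_eq:
  assumes "m \<ge> n" "\<And>k. k \<ge> n \<Longrightarrow> \<psi> m \<le> \<psi> k"
  shows "tail_min \<psi> n = \<psi> m"
  unfolding tail_min_def using assms by (intro Least_equality) auto

text \<open>The base \<open>B\<close> defined by \<open>log B = liminf (log (min\<^bsub>m\<ge>n\<^esub> \<psi>(m))) / n\<close> is never smaller than \<open>1\<close>, so the
  cases \<open>B = 1\<close>, \<open>1 < B < \<infinity>\<close> and \<open>B = \<infinity>\<close> are exhaustive.\<close>

lemma growth_base_ge_1:
  assumes pos: "\<And>n. 1 \<le> n \<Longrightarrow> 0 < \<psi> n" and min: "has_tail_minima \<psi>"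
    and B: "ln_ennreal B = liminf (\<lambda>n. ereal (ln (tail_min \<psi> n) / real n))"
  shows "1 \<le> B"
proof -
  have tm: "\<exists>m\<ge>n. tail_min \<psi> n = \<psi> m" if n: "1 \<le> n" for n
  proof -
    obtain m where "m \<ge> n" "\<And>k. k \<ge> n \<Longrightarrow> \<psi> m \<le> \<psi> k"
      using min n unfolding has_tail_minima_def by blast
    then show ?thesis using tail_min_eq[of n m \<psi>] by blast
  qed
  obtain m where m: "m \<ge> 1" "\<And>k. k \<ge> 1 \<Longrightarrow> \<psi> m \<le> \<psi> k"
    using min unfolding has_tail_minima_def by blast
  have "ln (\<psi> m) / real n \<le> ln (tail_min \<psi> n) / real n" if n: "1 \<le> n" for n
  proof -
    obtain k where "k \<ge> n" "tail_min \<psi> n = \<psi> k" using tm n by blast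
    then show ?thesis
      using m pos n by (intro divide_right_mono) auto
  qed
  then have "liminf (\<lambda>n. ereal (ln (\<psi> m) / real n)) \<le> ln_ennreal B"
    unfolding B by (intro Liminf_mono eventually_sequentiallyI[of 1]) simp
  moreover have "(\<lambda>n. ereal (ln (\<psi> m) / real n)) \<longlonglongrightarrow> ereal 0"
    by (intro tendsto_ereal lim_const_over_n)
  ultimately have "0 \<le> ln_ennreal B"
    by (simp add: lim_imp_Liminf zero_ereal_def)
  then show ?thesis
    by (cases B) (auto simp: ln_ennreal_def ennreal_eq_0_iff split: if_splits)
qed

end

theory Submission
  imports Defs
begin

text \<open>Write \<open>q(w)\<close> for the denominator of a word \<open>w\<close> of partial quotients. Replacing \<open>\<psi>\<close> by its increasing
  tail minimum does not change \<open>F(r,\<psi>)\<close>, and when \<open>\<psi>\<close> is unbounded the position of the last of the \<open>r\<close>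
  large digits may be taken as \<open>n\<close>.

  For the upper bound with \<open>1 < B < \<infinity>\<close> and exponent \<open>s > 1/2\<close>, each of the other \<open>r - 1\<close> digits \<open>a \<ge> B^n\<close>
  can be deleted from the word at the cost of a factor \<open>(a/2)^(-2s)\<close>, whose sum over \<open>a\<close> is about
  \<open>B^(n(1-2s))\<close>, and the last one restricts the cylinder to relative size \<open>B^(-n)\<close>; the covering sum is thus
  governed by the pressure. For \<open>B = \<infinity>\<close>, digits of doubly exponential rate \<open>b\<close> force, for every \<open>c < b\<close>,
  infinitely many digits exceeding the power \<open>c - 1\<close> of the product of all previous ones, and the set where this
  happens has dimension at most \<open>1/(1+c)\<close>.

  For the lower bounds one distributes a mass on a tree of words: free blocks weighted by \<open>q^(-2s)\<close>, interrupted
  at sparse times \<open>n\<close> by \<open>r\<close> consecutive digits chosen uniformly in \<open>[A,2A)\<close> with \<open>A\<close> about \<open>B^n\<close>; or, for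
  \<open>B = \<infinity>\<close>, only uniformly chosen digits of size about \<open>exp(c^n)\<close>. The inverse of the distribution function of
  this mass parametrizes points of \<open>F(r,\<psi>)\<close> by \<open>[0,1)\<close>, and the distribution function is \<open>s\<close>-Hoelder on them. The
  condition binding \<open>s\<close> comes from the last of the \<open>r\<close> large digits, where the mass of a word must be at most
  \<open>q^(-2s) A^(-s)\<close> up to a constant.\<close>
section \<open>Sums of extended nonnegative reals\<close>

text \<open>The exponent \<open>s + (2 * s - 1) * (r - 1)\<close> is an account of mass times
  \<open>q powr (2 * s)\<close>. A digit chosen uniformly among about A values divides the mass by A
  and multiplies q by about A, so each of the first r - 1 large digits multiplies this product by
  about \<open>A powr (2 * s - 1)\<close>. Before the last one it must be below
  \<open>A powr (- s)\<close>, because the A neighbouring cylinders that follow fill one interval of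
  relative length about 1 / A. The free blocks have to supply this decay, at a rate per digit just
  below the pressure.

  The value 1/2 separates two regimes: for s \<le> 1/2 the sums over words diverge and the pressure
  is infinite, so the block construction is available only above 1/2. That the dimension is at least
  1/2 for finite B comes instead from the rapidly growing digits that also serve B = \<infinity>.
  Conversely, the doubly exponential covering needs a rate above 1, so b = 1 is settled by the
  pressure bound with an arbitrarily large base.\<close>

lemma has_sum_infsum_ennreal:
  fixes f :: "'a \<Rightarrow> ennreal"
  shows "(f has_sum infsum f A) A"
  by (intro has_sum_infsum nonneg_summable_on_complete) simp

lemma infsum_ennreal_eq_SUP:
  fixes f :: "'a \<Rightarrow> ennreal"
  shows "infsum f A = (SUP F\<in>{F. finite F \<and> F \<subseteq> A}. sum f F)"
  by (rule nonneg_infsum_complete) simp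

lemma sum_le_infsum_ennreal:
  fixes f :: "'a \<Rightarrow> ennreal"
  assumes "finite F" "F \<subseteq> A"
  shows "sum f F \<le> infsum f A"
  unfolding infsum_ennreal_eq_SUP using assms by (intro SUP_upper) auto

lemma infsum_ennreal_leI:
  fixes f :: "'a \<Rightarrow> ennreal"
  assumes "\<And>F. finite F \<Longrightarrow> F \<subseteq> A \<Longrightarrow> sum f F \<le> c"
  shows "infsum f A \<le> c"
  unfolding infsum_ennreal_eq_SUP using assms by (intro SUP_least) auto

lemma infsum_ennreal_mono_set:
  fixes f :: "'a \<Rightarrow> ennreal"
  assumes "A \<subseteq> B"
  shows "infsum f A \<le> infsum f B"
  using assms by (intro infsum_ennreal_leI sum_le_infsum_ennreal) auto

lemma infsum_ennreal_mono:
  fixes f g :: "'a \<Rightarrow> ennreal"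
  assumes "\<And>x. x \<in> A \<Longrightarrow> f x \<le> g x"
  shows "infsum f A \<le> infsum g A"
  using assms by (intro infsum_mono nonneg_summable_on_complete) auto

lemma infsum_ennreal_cmult:
  fixes f :: "'a \<Rightarrow> ennreal"
  shows "infsum (\<lambda>x. c * f x) A = c * infsum f A"
  unfolding infsum_ennreal_eq_SUP sum_distrib_left[symmetric]
  by (rule SUP_mult_left_ennreal[symmetric])

lemma infsum_ennreal_Sigma:
  fixes f :: "'a \<times> 'b \<Rightarrow> ennreal"
  shows "infsum f (Sigma A B) = infsum (\<lambda>x. infsum (\<lambda>y. f (x, y)) (B x)) A"
proof (rule antisym)
  show "infsum f (Sigma A B) \<le> infsum (\<lambda>x. infsum (\<lambda>y. f (x, y)) (B x)) A"
  proof (rule infsum_ennreal_leI)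
    fix F assume F: "finite F" "F \<subseteq> Sigma A B"
    have eq: "F = (SIGMA x:fst ` F. {y. (x, y) \<in> F})" by force
    have fin: "finite {y. (x, y) \<in> F}" for x
      using F(1) by (rule finite_surj[of _ _ snd]) force
    have "sum f F = (\<Sum>x\<in>fst ` F. \<Sum>y\<in>{y. (x, y) \<in> F}. f (x, y))"
      using F(1) fin by (subst eq, subst sum.Sigma) auto
    also have "\<dots> \<le> (\<Sum>x\<in>fst ` F. infsum (\<lambda>y. f (x, y)) (B x))"
      using F fin by (intro sum_mono sum_le_infsum_ennreal) auto
    also have "\<dots> \<le> infsum (\<lambda>x. infsum (\<lambda>y. f (x, y)) (B x)) A"
      using F by (intro sum_le_infsum_ennreal) auto
    finally show "sum f F \<le> infsum (\<lambda>x. infsum (\<lambda>y. f (x, y)) (B x)) A" .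
  qed
  show "infsum (\<lambda>x. infsum (\<lambda>y. f (x, y)) (B x)) A \<le> infsum f (Sigma A B)"
  proof (rule infsum_ennreal_leI)
    fix X assume X: "finite X" "X \<subseteq> A"
    have "(\<Sum>x\<in>X. infsum (\<lambda>y. f (x, y)) (B x)) = infsum f (Sigma X B)"
      using X(1)
    proof (induction X)
      case (insert x X)
      have eq: "Sigma (insert x X) B = Pair x ` B x \<union> Sigma X B" by auto
      have "infsum f (Sigma (insert x X) B) = infsum f (Pair x ` B x) + infsum f (Sigma X B)"
        unfolding eq using insert.hyps
        by (intro infsum_Un_disjoint nonneg_summable_on_complete) auto
      also have "infsum f (Pair x ` B x) = infsum (\<lambda>y. f (x, y)) (B x)"
        by (subst infsum_reindex) (auto simp: inj_on_def comp_def)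
      finally show ?case using insert by simp
    qed simp
    also have "\<dots> \<le> infsum f (Sigma A B)"
      using X by (intro infsum_ennreal_mono_set) auto
    finally show "(\<Sum>x\<in>X. infsum (\<lambda>y. f (x, y)) (B x)) \<le> infsum f (Sigma A B)" .
  qed
qed

lemma infsum_ennreal_nat:
  fixes f :: "nat \<Rightarrow> ennreal"
  shows "infsum f UNIV = (\<Sum>i. f i)"
proof -
  have "(f has_sum infsum f UNIV) UNIV" by (rule has_sum_infsum_ennreal)
  then have "f sums infsum f UNIV" by (rule has_sum_imp_sums)
  then show ?thesis by (simp add: sums_iff)
qed

text \<open>Choosing one preimage for each point of the image replaces injectivity, so families of
  words may be parametrized with repetitions.\<close>

lemma infsum_ennreal_image_le:
  fixes f :: "'b \<Rightarrow> ennreal"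
  shows "infsum f (g ` A) \<le> infsum (\<lambda>x. f (g x)) A"
proof -
  obtain B where B: "B \<subseteq> A" "g ` B = g ` A" "inj_on g B"
    by (metis subset_image_inj subset_refl)
  have "infsum f (g ` A) = infsum (f \<circ> g) B"
    using infsum_reindex[OF B(3), of f] B(2) by simp
  also have "\<dots> \<le> infsum (\<lambda>x. f (g x)) A"
    unfolding comp_def by (rule infsum_ennreal_mono_set[OF B(1)])
  finally show ?thesis .
qed

lemma infsum_ennreal_finite_UN_le:
  fixes f :: "'b \<Rightarrow> ennreal"
  assumes "finite I"
  shows "infsum f (\<Union>i\<in>I. A i) \<le> (\<Sum>i\<in>I. infsum f (A i))"
proof -
  have "(\<Union>i\<in>I. A i) = snd ` Sigma I A" by force
  then have "infsum f (\<Union>i\<in>I. A i) \<le> infsum (\<lambda>x. f (snd x)) (Sigma I A)"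
    using infsum_ennreal_image_le[of f snd] by simp
  also have "\<dots> = (\<Sum>i\<in>I. infsum f (A i))"
    using assms by (simp add: infsum_ennreal_Sigma)
  finally show ?thesis .
qed

section \<open>Hausdorff dimension\<close>

lemma diam_pow_le:
  assumes "diameter U \<le> e" "0 \<le> s" "s \<noteq> 0" "bounded U"
  shows "diam_pow s U \<le> ennreal (e powr s)"
  using assms diameter_ge_0[of U] unfolding diam_pow_def
  by (auto intro!: ennreal_leI powr_mono2)

text \<open>The convergence half of Borel-Cantelli: \<open>A\<close> lies in the limsup of the
  families, so for every \<open>N\<close> the families from \<open>N\<close> on cover it, at a cost
  bounded by a tail of a convergent series.\<close>

lemma hausdorff_outer_measure_eq_0I:
  fixes A :: "'a::metric_space set" and U :: "nat \<Rightarrow> 'i::countable \<Rightarrow> 'a set"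
  assumes s: "0 < s"
    and cover: "\<And>x. x \<in> A \<Longrightarrow> \<exists>\<^sub>F n in sequentially. \<exists>i\<in>J n. x \<in> U n i"
    and U: "\<And>n i. i \<in> J n \<Longrightarrow> bounded (U n i) \<and> diameter (U n i) \<le> e n i \<and> 0 \<le> e n i"
    and sum: "\<And>n. infsum (\<lambda>i. ennreal (e n i powr s)) (J n) \<le> ennreal (c n)"
    and c: "summable c" "\<And>n. 0 \<le> c n"
  shows "hausdorff_outer_measure s A = 0"
proof -
  have "hausdorff_premeasure s \<delta> A \<le> ennreal \<epsilon>" if \<delta>: "0 < \<delta>" and \<epsilon>: "0 < \<epsilon>" for \<delta> \<epsilon>
  proof -
    \<comment> \<open>A single summand is at most the whole tail, so a tail below
      \<open>\<delta> powr s\<close> also forces every covering set to have diameter at most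
      \<open>\<delta>\<close>.\<close>
    define \<eta> where "\<eta> = min \<epsilon> (\<delta> powr s)"
    have \<eta>: "0 < \<eta>" "\<eta> \<le> \<epsilon>" "\<eta> \<le> \<delta> powr s" using \<delta> \<epsilon> by (auto simp: \<eta>_def)
    obtain N where N: "norm (suminf (\<lambda>i. c (i + N))) < \<eta>"
      using suminf_exist_split[OF \<eta>(1) c(1)] by auto
    have sc: "summable (\<lambda>i. c (i + N))" using c(1) by simp
    have tail: "(\<Sum>n. ennreal (c (n + N))) \<le> ennreal \<eta>"
      using N c(2) sc by (subst suminf_ennreal2) (auto intro!: ennreal_leI)
    define S where "S = (SIGMA n:UNIV. J (n + N))"
    \<comment> \<open>A cover has to be a sequence, so pairs of level and index are coded as
      naturals; numbers that code nothing give the empty set, which costs 0.\<close>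
    define V where "V k = (if k \<in> to_nat ` S then case from_nat k of (n, i) \<Rightarrow> U (n + N) i else {})" for k
    have le: "ennreal (e (n + N) i powr s) \<le> ennreal \<eta>" if "i \<in> J (n + N)" for n i
    proof -
      have "ennreal (e (n + N) i powr s) \<le> infsum (\<lambda>i. ennreal (e (n + N) i powr s)) (J (n + N))"
        using sum_le_infsum_ennreal[of "{i}" "J (n + N)" "\<lambda>i. ennreal (e (n + N) i powr s)"] that by simp
      also have "\<dots> \<le> (\<Sum>n. ennreal (c (n + N)))"
        by (rule order_trans[OF sum])
           (use sum_le_suminf[of "\<lambda>n. ennreal (c (n + N))" "{n}"] in simp)
      finally show ?thesis using tail by (rule order_trans)
    qed
    have V: "bounded (V k) \<and> diameter (V k) \<le> \<delta>" for k
    proof (cases "k \<in> to_nat ` S")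
      case True
      then obtain n i where ni: "k = to_nat (n, i)" and i: "i \<in> J (n + N)" by (auto simp: S_def)
      have "e (n + N) i powr s \<le> \<delta> powr s"
        using le[OF i] \<eta> by (simp add: ennreal_le_iff)
      then have "e (n + N) i \<le> \<delta>"
        using s \<delta> U[OF i] by (meson not_le powr_less_mono2 order_less_imp_le)
      then show ?thesis using U[OF i] ni True by (auto simp: V_def intro: order_trans)
    next
      case False
      then show ?thesis using \<delta> by (auto simp: V_def)
    qed
    have sub: "A \<subseteq> (\<Union>k. V k)"
    proof
      fix x assume "x \<in> A"
      then obtain n i where n: "n \<ge> N" "i \<in> J n" "x \<in> U n i"
        using cover[of x] unfolding frequently_sequentially by blast
      then have "x \<in> V (to_nat (n - N, i))" by (simp add: V_def S_def)
      then show "x \<in> (\<Union>k. V k)" by blast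
    qed
    have "hausdorff_premeasure s \<delta> A \<le> (\<Sum>k. diam_pow s (V k))"
      unfolding hausdorff_premeasure_def using sub V by (intro Inf_lower) blast
    also have "\<dots> = infsum (\<lambda>k. diam_pow s (V k)) UNIV" by (simp add: infsum_ennreal_nat)
    also have "\<dots> = infsum (\<lambda>k. diam_pow s (V k)) (to_nat ` S)"
      by (rule infsum_cong_neutral) (auto simp: V_def diam_pow_def)
    also have "\<dots> \<le> infsum (\<lambda>x. diam_pow s (V (to_nat x))) S"
      by (rule infsum_ennreal_image_le)
    also have "\<dots> \<le> infsum (\<lambda>(n, i). ennreal (e (n + N) i powr s)) S"
      using U s by (intro infsum_ennreal_mono) (auto simp: V_def S_def intro!: diam_pow_le)
    also have "\<dots> = infsum (\<lambda>n. infsum (\<lambda>i. ennreal (e (n + N) i powr s)) (J (n + N))) UNIV"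
      unfolding S_def by (simp add: infsum_ennreal_Sigma)
    also have "\<dots> \<le> infsum (\<lambda>n. ennreal (c (n + N))) UNIV"
      by (intro infsum_ennreal_mono sum)
    also have "\<dots> \<le> ennreal \<eta>" using tail by (simp add: infsum_ennreal_nat)
    also have "\<dots> \<le> ennreal \<epsilon>" using \<eta> by (intro ennreal_leI) auto
    finally show ?thesis .
  qed
  then have "hausdorff_premeasure s \<delta> A = 0" if "0 < \<delta>" for \<delta>
    using that ennreal_le_epsilon[of 0 "hausdorff_premeasure s \<delta> A"] by simp
  then show ?thesis
    unfolding hausdorff_outer_measure_def by (auto simp: bot_ennreal[symmetric])
qed

lemma hausdorff_dim_le:
  assumes "0 \<le> s" "hausdorff_outer_measure s A = 0"
  shows "hausdorff_dim A \<le> ennreal s"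
  unfolding hausdorff_dim_def using assms by (intro Inf_lower) auto

lemma hausdorff_dim_leI:
  assumes "0 \<le> s" "\<And>t. s < t \<Longrightarrow> hausdorff_outer_measure t A = 0"
  shows "hausdorff_dim A \<le> ennreal s"
proof (rule ennreal_le_epsilon)
  fix e :: real assume "0 < e"
  then have "hausdorff_dim A \<le> ennreal (s + e)"
    using assms by (intro hausdorff_dim_le) auto
  then show "hausdorff_dim A \<le> ennreal s + ennreal e"
    using assms \<open>0 < e\<close> by (simp add: ennreal_plus)
qed

lemma hausdorff_dim_unit_interval_le:
  assumes "A \<subseteq> {0..<1::real}"
  shows "hausdorff_dim A \<le> 1"
proof -
  have "hausdorff_outer_measure t A = 0" if t: "1 < t" for t
  proof (rule hausdorff_outer_measure_eq_0I)
    let ?U = "\<lambda>n i. {real i / 2 ^ n .. (real i + 1) / 2 ^ n}"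
    show "0 < t" using t by simp
    show "\<exists>\<^sub>F n in sequentially. \<exists>i\<in>{..<2 ^ n}. x \<in> ?U n i" if "x \<in> A" for x
    proof -
      have x: "0 \<le> x" "x < 1" using that assms by auto
      have "\<exists>i\<in>{..<2 ^ n}. x \<in> ?U n i" for n :: nat
      proof
        define i where "i = nat \<lfloor>x * 2 ^ n\<rfloor>"
        have i: "real i \<le> x * 2 ^ n" "x * 2 ^ n < real i + 1"
          using x unfolding i_def by (auto simp: of_nat_nat)
        have "x * 2 ^ n < 1 * 2 ^ n" using x by (intro mult_strict_right_mono) auto
        then have "real i < 2 ^ n" using i by linarith
        then show "i \<in> {..<2 ^ n}" by simp
        show "x \<in> ?U n i" using i by (simp add: field_simps)
      qed
      then show ?thesis by (metis (no_types, lifting) frequently_sequentially order_refl)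
    qed
    show "bounded (?U n i) \<and> diameter (?U n i) \<le> 1 / 2 ^ n \<and> 0 \<le> 1 / (2 ^ n :: real)" for n i :: nat
      by (subst diameter_closed_interval) (auto simp: field_simps)
    have "(2::real) ^ n * (1 / 2 ^ n) powr t = (2 powr (1 - t)) ^ n" for n
      by (simp add: powr_divide powr_diff powr_realpow[symmetric] powr_powr mult.commute)
    then show "infsum (\<lambda>i. ennreal ((1 / 2 ^ n) powr t)) {..<2 ^ n :: nat} \<le> ennreal ((2 powr (1 - t)) ^ n)" for n :: nat
      by (simp add: ennreal_mult[symmetric] ennreal_of_nat_eq_real_of_nat del: ennreal_numeral)
    show "summable (\<lambda>n. (2 powr (1 - t)) ^ n)"
      using t by (intro summable_geometric) (auto simp: powr_less_one)
    show "0 \<le> (2 powr (1 - t)) ^ n" for n by simp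
  qed
  then show ?thesis using hausdorff_dim_leI[of 1 A] by simp
qed

text \<open>A parametrization \<open>g\<close> of points of \<open>A\<close> whose inverse is Hoelder continuous of exponent \<open>s\<close> transports
  Lebesgue measure on \<open>[0,1)\<close> to \<open>A\<close>, which replaces the mass distribution principle.\<close>

lemma hausdorff_dim_ge_of_expanding:
  fixes g :: "real \<Rightarrow> 'a::metric_space"
  assumes s: "0 < s" and K: "0 < K"
    and g: "\<And>t. t \<in> {0..<1} \<Longrightarrow> g t \<in> A"
    and exp: "\<And>t t'. t \<in> {0..<1} \<Longrightarrow> t' \<in> {0..<1} \<Longrightarrow> \<bar>t - t'\<bar> \<le> K * dist (g t) (g t') powr s"
  shows "ennreal s \<le> hausdorff_dim A"
  unfolding hausdorff_dim_def
proof (rule Inf_greatest, safe)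
  fix s' :: real assume s': "0 \<le> s'" "hausdorff_outer_measure s' A = 0"
  show "ennreal s \<le> ennreal s'"
  proof (rule ccontr)
    assume "\<not> ?thesis"
    then have lt: "s' < s" using s' by (auto simp: not_le)
    \<comment> \<open>The scale 1 is fine enough: for diameters at most 1 the power with the larger
      exponent \<open>s\<close> is the smaller one.\<close>
    have "hausdorff_premeasure s' 1 A \<le> 0"
      using s'(2) unfolding hausdorff_outer_measure_def by (metis SUP_upper greaterThan_iff zero_less_one)
    then have "hausdorff_premeasure s' 1 A < ennreal (1 / (2 * K))" using K by (simp add: le_zero_eq)
    then obtain U :: "nat \<Rightarrow> 'a set" where U: "A \<subseteq> (\<Union>i. U i)" "\<And>i. bounded (U i) \<and> diameter (U i) \<le> 1"
      and lt2: "(\<Sum>i. diam_pow s' (U i)) < ennreal (1 / (2 * K))"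
      unfolding hausdorff_premeasure_def Inf_less_iff by blast
    define V where "V i = {t\<in>{0..<1}. g t \<in> U i}" for i
    define d where "d i = K * diameter (U i) powr s" for i
    have dV: "\<bar>t - t'\<bar> \<le> d i" if "t \<in> V i" "t' \<in> V i" for t t' i
    proof -
      have "dist (g t) (g t') \<le> diameter (U i)"
        using that U(2) by (intro diameter_bounded_bound) (auto simp: V_def)
      then have "dist (g t) (g t') powr s \<le> diameter (U i) powr s" using s by (intro powr_mono2) auto
      then have "K * dist (g t) (g t') powr s \<le> d i" unfolding d_def using K by (intro mult_left_mono) auto
      then show ?thesis using exp[of t t'] that by (auto simp: V_def)
    qed
    \<comment> \<open>The set \<open>V i\<close> need not be measurable; an interval starting at its
      infimum, as long as the bound \<open>d i\<close> on its spread, contains it and has a known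
      Lebesgue measure.\<close>
    define W where "W i = (if V i = {} then {} else {Inf (V i) .. Inf (V i) + d i})" for i
    have W: "V i \<subseteq> W i" for i
    proof
      fix t assume t: "t \<in> V i"
      have bdd: "bdd_below (V i)" by (rule bdd_belowI[of _ 0]) (auto simp: V_def)
      have "t - d i \<le> Inf (V i)" using t dV[OF t] by (intro cInf_greatest) (force simp: abs_le_iff)+
      then show "t \<in> W i" using t cInf_lower[OF t bdd] by (auto simp: W_def)
    qed
    have eW: "emeasure lborel (W i) \<le> ennreal K * diam_pow s' (U i)" for i
    proof (cases "V i = {}")
      case False
      then have ne: "U i \<noteq> {}" by (auto simp: V_def)
      have d0: "0 \<le> d i" using K by (simp add: d_def)
      have "diameter (U i) powr s \<le> (if s' = 0 then 1 else diameter (U i) powr s')"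
        using U(2)[of i] diameter_ge_0[of "U i"] lt s
        by (cases "diameter (U i) = 0") (auto intro!: powr_mono' powr_le1)
      then have "ennreal (d i) \<le> ennreal K * diam_pow s' (U i)"
        using ne K unfolding d_def diam_pow_def
        by (auto simp: ennreal_mult'[symmetric] mult_left_mono intro!: ennreal_leI
            simp flip: ennreal_1 split: if_splits)
      then show ?thesis using False d0 by (simp add: W_def)
    qed (simp add: W_def)
    have "{0..<1} \<subseteq> (\<Union>i. W i)"
    proof
      fix t :: real assume t: "t \<in> {0..<1}"
      then obtain i where "g t \<in> U i" using g U(1) by blast
      then show "t \<in> (\<Union>i. W i)" using t W[of i] by (auto simp: V_def)
    qed
    then have "emeasure lborel {0..<1::real} \<le> emeasure lborel (\<Union>i. W i)"
      by (intro emeasure_mono) (auto simp: W_def)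
    also have "\<dots> \<le> (\<Sum>i. emeasure lborel (W i))"
      by (intro emeasure_subadditive_countably) (auto simp: W_def)
    also have "\<dots> \<le> (\<Sum>i. ennreal K * diam_pow s' (U i))" by (intro suminf_le eW) auto
    also have "\<dots> = ennreal K * (\<Sum>i. diam_pow s' (U i))" by simp
    also have "\<dots> \<le> ennreal K * ennreal (1 / (2 * K))" using lt2 by (intro mult_left_mono) auto
    also have "\<dots> = ennreal (1 / 2)" using K by (simp add: ennreal_mult[symmetric])
    finally have "ennreal 1 \<le> ennreal (1 / 2)" by simp
    then show False unfolding ennreal_le_iff2 by simp
  qed
qed

section \<open>Finite continued fractions and the Gauss map\<close>

text \<open>The denominator \<open>q\<^sub>n + y q\<^sub>n\<^sub>-\<^sub>1\<close> of the Moebius map \<open>y \<mapsto> [a\<^sub>1, \<dots>, a\<^sub>n + y]\<close>, written as the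
  product of the inverse orbit points; in particular \<open>q\<^sub>n\<close> is its value at \<open>y = 0\<close>.\<close>

fun cf_denom :: "nat list \<Rightarrow> real \<Rightarrow> real" where
  "cf_denom [] y = 1"
| "cf_denom (a # w) y = (real a + cf_eval w y) * cf_denom w y"

abbreviation cf_den :: "nat list \<Rightarrow> real" where
  "cf_den w \<equiv> cf_denom w 0"

abbreviation pos_word :: "nat list \<Rightarrow> bool" where
  "pos_word w \<equiv> \<forall>a\<in>set w. 1 \<le> a"

lemma cf_eval_Nil [simp]: "cf_eval [] y = y"
  and cf_eval_Cons [simp]: "cf_eval (a # w) y = 1 / (real a + cf_eval w y)"
  and cf_eval_append: "cf_eval (u @ v) y = cf_eval u (cf_eval v y)"
  by (simp_all add: cf_eval_def)

lemma cf_eval_nonneg: "0 \<le> y \<Longrightarrow> 0 \<le> cf_eval w y"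
  by (induction w) auto

lemma cf_eval_le_1: "pos_word w \<Longrightarrow> 0 \<le> y \<Longrightarrow> y \<le> 1 \<Longrightarrow> cf_eval w y \<le> 1"
proof (induction w)
  case (Cons a w)
  then show ?case using cf_eval_nonneg[of y w] by (auto simp: divide_le_eq)
qed auto

lemma cf_denom_append: "cf_denom (u @ v) y = cf_denom u (cf_eval v y) * cf_denom v y"
  by (induction u) (simp_all add: cf_eval_append)

lemma cf_denom_ge_1: "pos_word w \<Longrightarrow> 0 \<le> y \<Longrightarrow> 1 \<le> cf_denom w y"
proof (induction w)
  case (Cons a w)
  then have "1 * 1 \<le> (real a + cf_eval w y) * cf_denom w y"
    using cf_eval_nonneg[of y w] by (intro mult_mono) auto
  then show ?case by simp
qed auto

lemma cf_denom_pos: "pos_word w \<Longrightarrow> 0 \<le> y \<Longrightarrow> 0 < cf_denom w y"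
  using cf_denom_ge_1[of w y] by linarith

text \<open>The continuant recursion, peeled from the front of the word, where
  \<open>cf_denom\<close> unfolds. Its coefficients are nonnegative and free of \<open>y\<close>, so
  inequalities in \<open>y\<close> propagate through it.\<close>

lemma cf_denom_Cons2:
  assumes "pos_word (b # w)" "0 \<le> y"
  shows "cf_denom (a # b # w) y = real a * cf_denom (b # w) y + cf_denom w y"
proof -
  have "0 < real b + cf_eval w y" using assms cf_eval_nonneg[of y w] by auto
  then show ?thesis by (simp add: field_simps)
qed

text \<open>Bounded distortion: on the unit interval the denominator varies by a factor of at most
  2, which is what makes denominators multiplicative up to a constant.\<close>

lemma cf_denom_bounds:
  assumes "pos_word w" "0 \<le> y"
  shows "cf_den w \<le> cf_denom w y" "cf_denom w y \<le> (1 + y) * cf_den w"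
  using assms
proof (induction w rule: induct_list012)
  case (2 a)
  { case 1 then show ?case by simp }
  { case 2 then show ?case using mult_left_mono[of 1 "real a" y] by (simp add: algebra_simps) }
next
  case (3 a b w)
  { case 1
    then have "real a * cf_den (b # w) + cf_den w \<le> real a * cf_denom (b # w) y + cf_denom w y"
      using 3 by (intro add_mono mult_left_mono) (auto simp del: cf_denom.simps)
    then show ?case
      using 1 cf_denom_Cons2[of b w 0 a] cf_denom_Cons2[of b w y a] by (auto simp del: cf_denom.simps) }
  { case 2
    then have "cf_denom (a # b # w) y \<le> real a * ((1 + y) * cf_den (b # w)) + (1 + y) * cf_den w"
      using 3 by (subst cf_denom_Cons2) (auto intro!: add_mono mult_left_mono simp del: cf_denom.simps)
    also have "\<dots> = (1 + y) * cf_den (a # b # w)"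
      using 2 by (subst cf_denom_Cons2) (auto simp: algebra_simps simp del: cf_denom.simps)
    finally show ?case . }
qed auto

lemma cf_den_append_ge:
  assumes "pos_word u" "pos_word v"
  shows "cf_den u * cf_den v \<le> cf_den (u @ v)"
  using assms cf_denom_bounds(1)[of u "cf_eval v 0"] cf_denom_pos[of v 0]
  by (auto simp: cf_denom_append cf_eval_nonneg)

lemma cf_den_append_le:
  assumes "pos_word u" "pos_word v"
  shows "cf_den (u @ v) \<le> 2 * (cf_den u * cf_den v)"
proof -
  have "cf_denom u (cf_eval v 0) \<le> (1 + cf_eval v 0) * cf_den u"
    using assms by (intro cf_denom_bounds) (auto simp: cf_eval_nonneg)
  also have "\<dots> \<le> 2 * cf_den u"
    using assms cf_eval_le_1[of v 0] cf_denom_pos[of u 0] by (intro mult_right_mono) auto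
  finally have "cf_denom u (cf_eval v 0) * cf_den v \<le> 2 * cf_den u * cf_den v"
    using cf_denom_pos[of v 0] assms by (intro mult_right_mono) auto
  then show ?thesis by (simp add: cf_denom_append mult_ac)
qed

text \<open>By the recursion, prefixing two digits at least doubles the denominator: both summands
  are at least the denominator of the inner word.\<close>

lemma two_power_le_cf_den: "pos_word w \<Longrightarrow> 2 ^ (length w div 2) \<le> cf_den w"
proof (induction w rule: induct_list012)
  case (3 a b w)
  have pos: "pos_word w" "pos_word (b # w)" using 3 by auto
  have "1 * cf_den w \<le> (real b + cf_eval w 0) * cf_den w"
    using pos cf_denom_pos[of w 0] cf_eval_nonneg[of 0 w] by (intro mult_right_mono) auto
  then have 1: "cf_den w \<le> cf_den (b # w)" by simp
  have "2 ^ (length (a # b # w) div 2) \<le> 2 * cf_den w" using 3(1) pos by simp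
  also have "\<dots> \<le> 1 * cf_den (b # w) + cf_den w" using 1 by simp
  also have "\<dots> \<le> real a * cf_den (b # w) + cf_den w"
    using pos cf_denom_pos[of "b # w" 0] 3 by (intro add_mono mult_right_mono) (auto simp del: cf_denom.simps)
  finally show ?case using pos cf_denom_Cons2[of b w 0 a] by simp
qed auto

lemma prod_list_le_cf_den: "pos_word w \<Longrightarrow> (\<Prod>a\<leftarrow>w. real a) \<le> cf_den w"
proof (induction w)
  case (Cons a w)
  then show ?case using cf_eval_nonneg[of 0 w] cf_denom_pos[of w 0]
    by (auto intro!: mult_mono prod_list_nonneg)
qed auto

lemma cf_den_le_prod_list: "pos_word w \<Longrightarrow> cf_den w \<le> (\<Prod>a\<leftarrow>w. real a + 1)"
proof (induction w)
  case (Cons a w)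
  then show ?case using cf_eval_nonneg[of 0 w] cf_eval_le_1[of w 0] cf_denom_pos[of w 0]
    by (auto intro!: mult_mono)
qed auto

text \<open>Each inversion reverses the orientation. The sign is recorded because the sum of the
  cylinder lengths has to telescope.\<close>

lemma cf_eval_diff:
  assumes "pos_word w" "0 \<le> y" "0 \<le> y'"
  shows "(- 1) ^ length w * (cf_eval w y - cf_eval w y') = (y - y') / (cf_denom w y * cf_denom w y')"
  using assms(1)
proof (induction w)
  case (Cons a w)
  have p: "0 < real a + cf_eval w y" "0 < real a + cf_eval w y'"
    using Cons assms cf_eval_nonneg[of y w] cf_eval_nonneg[of y' w] by auto
  then have "real a + cf_eval w y \<noteq> 0" "real a + cf_eval w y' \<noteq> 0" by auto
  then have "(- 1) ^ length (a # w) * (cf_eval (a # w) y - cf_eval (a # w) y') =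
      ((- 1) ^ length w * (cf_eval w y - cf_eval w y')) / ((real a + cf_eval w y) * (real a + cf_eval w y'))"
    by (simp add: field_simps)
  also have "\<dots> = (y - y') / (cf_denom (a # w) y * cf_denom (a # w) y')"
    using Cons by (simp add: mult_ac)
  finally show ?case .
qed simp

lemma abs_cf_eval_diff:
  assumes "pos_word w" "0 \<le> y" "0 \<le> y'"
  shows "\<bar>cf_eval w y - cf_eval w y'\<bar> = \<bar>y - y'\<bar> / (cf_denom w y * cf_denom w y')"
proof -
  have "\<bar>cf_eval w y - cf_eval w y'\<bar> = \<bar>(- 1) ^ length w * (cf_eval w y - cf_eval w y')\<bar>"
    by (simp add: abs_mult power_abs)
  also have "\<dots> = \<bar>(y - y') / (cf_denom w y * cf_denom w y')\<bar>"
    using assms by (simp only: cf_eval_diff)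
  also have "\<dots> = \<bar>y - y'\<bar> / (cf_denom w y * cf_denom w y')"
    using assms cf_denom_pos[of w y] cf_denom_pos[of w y'] by (simp add: abs_divide abs_mult)
  finally show ?thesis .
qed

lemma abs_cf_eval_diff_ge:
  assumes "pos_word w" "0 \<le> y" "0 \<le> y'" "y \<le> 1" "y' \<le> 1"
  shows "\<bar>y - y'\<bar> / (4 * (cf_den w)\<^sup>2) \<le> \<bar>cf_eval w y - cf_eval w y'\<bar>"
proof -
  have "cf_denom w z \<le> 2 * cf_den w" if "0 \<le> z" "z \<le> 1" for z
  proof -
    have "(1 + z) * cf_den w \<le> 2 * cf_den w"
      using that cf_denom_pos[of w 0] assms by (intro mult_right_mono) auto
    then show ?thesis using cf_denom_bounds(2)[of w z] assms that by linarith
  qed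
  then have "cf_denom w y * cf_denom w y' \<le> (2 * cf_den w) * (2 * cf_den w)"
    using assms cf_denom_pos[of w] by (intro mult_mono) (auto intro: less_imp_le)
  then show ?thesis
    using assms cf_denom_pos[of w] by (subst abs_cf_eval_diff) (auto intro!: divide_left_mono simp: power2_eq_square)
qed

lemma abs_cf_eval_diff_le:
  assumes "pos_word w" "0 \<le> y" "0 \<le> y'"
  shows "\<bar>cf_eval w y - cf_eval w y'\<bar> \<le> \<bar>y - y'\<bar> / (cf_den w)\<^sup>2"
proof -
  have "cf_den w * cf_den w \<le> cf_denom w y * cf_denom w y'"
    using assms cf_denom_bounds(1)[of w] cf_denom_pos[of w] by (intro mult_mono) (auto intro: less_imp_le)
  then show ?thesis
    using assms cf_denom_pos[of w]
    by (subst abs_cf_eval_diff) (auto intro!: divide_left_mono simp: power2_eq_square)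
qed

lemma gauss_map_inverse:
  assumes "1 \<le> a" "0 \<le> y" "y < 1"
  shows "gauss_map (1 / (real a + y)) = y" "\<lfloor>1 / (1 / (real a + y))\<rfloor> = int a"
proof -
  show 1: "\<lfloor>1 / (1 / (real a + y))\<rfloor> = int a" using assms by (simp add: floor_unique)
  have "real a + y \<noteq> 0" using assms by auto
  then show "gauss_map (1 / (real a + y)) = y"
    unfolding gauss_map_def 1 using assms by simp
qed

lemma gauss_map_range: "0 \<le> gauss_map x" "gauss_map x < 1"
  unfolding gauss_map_def by (auto simp: of_int_floor_le) linarith

lemma gauss_map_funpow_range:
  assumes "0 \<le> x" "x < 1"
  shows "0 \<le> (gauss_map ^^ n) x" "(gauss_map ^^ n) x < 1"
  using assms gauss_map_range by (cases n; simp)+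

lemma pq_defined_mono:
  assumes "pq_defined m x" "1 \<le> k" "k \<le> m"
  shows "pq_defined k x"
proof (rule ccontr)
  assume "\<not> ?thesis"
  then have 0: "(gauss_map ^^ (k - 1)) x = 0" by (simp add: pq_defined_def)
  have z: "(gauss_map ^^ j) 0 = 0" for j by (induction j) (auto simp: gauss_map_def)
  have "m - 1 = (m - k) + (k - 1)" using assms by auto
  then have "(gauss_map ^^ (m - 1)) x = (gauss_map ^^ (m - k)) ((gauss_map ^^ (k - 1)) x)"
    by (simp add: funpow_add)
  then show False using assms(1) 0 z by (simp add: pq_defined_def)
qed

text \<open>Indices shift by one: entry \<open>k\<close> is the partial quotient of index
  \<open>Suc k\<close>. Where the expansion has ended the entry is 0, since division by 0 yields 0,
  and the word is no longer positive.\<close>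

definition cf_word :: "nat \<Rightarrow> real \<Rightarrow> nat list" where
  "cf_word n x = map (\<lambda>k. nat (partial_quotient (Suc k) x)) [0..<n]"

lemma partial_quotient_ge_1:
  assumes "0 \<le> x" "x < 1" "pq_defined k x"
  shows "1 \<le> partial_quotient k x"
proof -
  have "0 < (gauss_map ^^ (k - 1)) x" "(gauss_map ^^ (k - 1)) x < 1"
    using assms gauss_map_funpow_range[of x "k - 1"] by (auto simp: pq_defined_def less_le)
  then show ?thesis unfolding partial_quotient_def by (simp add: le_floor_iff)
qed

lemma gauss_map_step:
  assumes "0 \<le> x" "x < 1" "pq_defined (Suc k) x"
  shows "(gauss_map ^^ k) x = 1 / (real (nat (partial_quotient (Suc k) x)) + (gauss_map ^^ Suc k) x)"
proof -
  let ?z = "(gauss_map ^^ k) x"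
  have z: "?z \<noteq> 0" using assms by (simp add: pq_defined_def)
  have "real (nat (partial_quotient (Suc k) x)) = real_of_int \<lfloor>1 / ?z\<rfloor>"
    proof -
    have "0 \<le> partial_quotient (Suc k) x" using partial_quotient_ge_1[OF assms] by linarith
    then have "real (nat (partial_quotient (Suc k) x)) = real_of_int (partial_quotient (Suc k) x)" by simp
    then show ?thesis by (simp only: partial_quotient_def diff_Suc_1)
  qed
  moreover have "(gauss_map ^^ Suc k) x = 1 / ?z - of_int \<lfloor>1 / ?z\<rfloor>"
    using z by (simp add: gauss_map_def)
  ultimately have "real (nat (partial_quotient (Suc k) x)) + (gauss_map ^^ Suc k) x = 1 / ?z" by simp
  then show ?thesis using z by simp
qed

lemma cf_word_props:
  assumes "0 \<le> x" "x < 1" "n = 0 \<or> pq_defined n x"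
  shows "x = cf_eval (cf_word n x) ((gauss_map ^^ n) x)" "pos_word (cf_word n x)" "length (cf_word n x) = n"
proof -
  have d: "pq_defined (Suc k) x" if "k < n" for k
    using assms that pq_defined_mono[of n x "Suc k"] by auto
  show "length (cf_word n x) = n" by (simp add: cf_word_def)
  show "pos_word (cf_word n x)"
    using partial_quotient_ge_1[OF assms(1,2) d] by (force simp: cf_word_def)
  have "m \<le> n \<Longrightarrow> x = cf_eval (cf_word m x) ((gauss_map ^^ m) x)" for m
  proof (induction m)
    case (Suc m)
    have "(gauss_map ^^ m) x = cf_eval [nat (partial_quotient (Suc m) x)] ((gauss_map ^^ Suc m) x)"
      using gauss_map_step[OF assms(1,2) d[of m]] Suc by simp
    moreover have "cf_word (Suc m) x = cf_word m x @ [nat (partial_quotient (Suc m) x)]"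
      by (simp add: cf_word_def)
    ultimately show ?case using Suc by (simp only: cf_eval_append)
  qed (simp add: cf_word_def)
  then show "x = cf_eval (cf_word n x) ((gauss_map ^^ n) x)" by simp
qed

subsection \<open>Infinite continued fractions\<close>

abbreviation seq_word :: "(nat \<Rightarrow> nat) \<Rightarrow> nat \<Rightarrow> nat list" where
  "seq_word d n \<equiv> map d [0..<n]"

definition cf_inf :: "(nat \<Rightarrow> nat) \<Rightarrow> real" where
  "cf_inf d = lim (\<lambda>n. cf_eval (seq_word d n) 0)"

lemma seq_word_add: "seq_word d (m + n) = seq_word d m @ seq_word (\<lambda>i. d (i + m)) n"
  by (rule nth_equalityI) (auto simp: nth_append add.commute)

lemma cf_inf_tendsto:
  assumes "\<And>i. 1 \<le> d i"
  shows "(\<lambda>n. cf_eval (seq_word d n) 0) \<longlonglongrightarrow> cf_inf d"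
proof -
  have pos: "pos_word (seq_word d' n)" if "\<And>i. 1 \<le> d' i" for d' :: "nat \<Rightarrow> nat" and n
    using that by auto
  have bound: "\<bar>cf_eval (seq_word d (m + n)) 0 - cf_eval (seq_word d m) 0\<bar> \<le> 1 / 2 ^ (m div 2)" for m n
  proof -
    let ?y = "cf_eval (seq_word (\<lambda>i. d (i + m)) n) 0"
    have y: "0 \<le> ?y" "?y \<le> 1" using assms by (intro cf_eval_nonneg cf_eval_le_1; auto)+
    have "\<bar>cf_eval (seq_word d m) ?y - cf_eval (seq_word d m) 0\<bar> \<le> \<bar>?y - 0\<bar> / (cf_den (seq_word d m))\<^sup>2"
      using assms y by (intro abs_cf_eval_diff_le) auto
    also have "\<dots> \<le> 1 / (2 ^ (m div 2))"
    proof (rule frac_le)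
      have "2 ^ (m div 2) \<le> cf_den (seq_word d m)"
        using two_power_le_cf_den[of "seq_word d m"] assms by simp
      also have "\<dots> \<le> (cf_den (seq_word d m))\<^sup>2"
        using cf_denom_ge_1[of "seq_word d m" 0] assms by (intro self_le_power) auto
      finally show "2 ^ (m div 2) \<le> (cf_den (seq_word d m))\<^sup>2" .
    qed (use y in auto)
    finally show ?thesis by (simp only: seq_word_add cf_eval_append)
  qed
  have "Cauchy (\<lambda>n. cf_eval (seq_word d n) 0)"
  proof (rule CauchyI')
    fix e :: real assume e: "0 < e"
    obtain k where k: "1 / 2 ^ k < e"
      using e one_less_numeral_iff reals_power_lt_ex[of e 2] by (auto simp: power_one_over)
    show "\<exists>M. \<forall>m\<ge>M. \<forall>n>m. dist (cf_eval (seq_word d m) 0) (cf_eval (seq_word d n) 0) < e"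
    proof (intro exI allI impI)
      fix m n assume mn: "2 * k \<le> m" "m < n"
      have "dist (cf_eval (seq_word d m) 0) (cf_eval (seq_word d n) 0) \<le> 1 / 2 ^ (m div 2)"
        using bound[of m "n - m"] mn by (simp add: dist_real_def abs_minus_commute)
      also have "\<dots> \<le> 1 / 2 ^ k" using mn by (intro divide_left_mono power_increasing) auto
      finally show "dist (cf_eval (seq_word d m) 0) (cf_eval (seq_word d n) 0) < e" using k by simp
    qed
  qed
  then have "convergent (\<lambda>n. cf_eval (seq_word d n) 0)" by (rule Cauchy_convergent)
  then show ?thesis by (simp add: cf_inf_def convergent_LIMSEQ_iff)
qed

lemma cf_inf_bounds01:
  assumes "\<And>i. 1 \<le> d i"
  shows "0 \<le> cf_inf d" "cf_inf d \<le> 1"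
proof -
  show "0 \<le> cf_inf d"
    by (rule LIMSEQ_le_const[OF cf_inf_tendsto]) (use assms cf_eval_nonneg in auto)
  show "cf_inf d \<le> 1"
    by (rule LIMSEQ_le_const2[OF cf_inf_tendsto]) (use assms in \<open>auto intro!: cf_eval_le_1 exI[of _ 0]\<close>)
qed

lemma cf_inf_Suc:
  assumes "\<And>i. 1 \<le> d i"
  shows "cf_inf d = 1 / (real (d 0) + cf_inf (\<lambda>i. d (Suc i)))"
proof (rule LIMSEQ_unique)
  show "(\<lambda>n. cf_eval (seq_word d (Suc n)) 0) \<longlonglongrightarrow> cf_inf d"
    by (rule LIMSEQ_Suc[OF cf_inf_tendsto[OF assms]])
  have "seq_word d (Suc n) = d 0 # seq_word (\<lambda>i. d (Suc i)) n" for n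
    using seq_word_add[of d 1 n] by simp
  then have eq: "cf_eval (seq_word d (Suc n)) 0 = 1 / (real (d 0) + cf_eval (seq_word (\<lambda>i. d (Suc i)) n) 0)" for n
    by (simp only: cf_eval_Cons)
  show "(\<lambda>n. cf_eval (seq_word d (Suc n)) 0) \<longlonglongrightarrow> 1 / (real (d 0) + cf_inf (\<lambda>i. d (Suc i)))"
    unfolding eq
  proof (intro tendsto_intros cf_inf_tendsto)
    show "real (d 0) + cf_inf (\<lambda>i. d (Suc i)) \<noteq> 0"
      using cf_inf_bounds01(1)[of "\<lambda>i. d (Suc i)", OF assms] assms[of 0] by linarith
  qed (rule assms)
qed

lemma cf_inf_pos:
  assumes "\<And>i. 1 \<le> d i"
  shows "0 < cf_inf d"
proof -
  have "0 < real (d 0) + cf_inf (\<lambda>i. d (Suc i))"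
    using cf_inf_bounds01(1)[of "\<lambda>i. d (Suc i)", OF assms] assms[of 0] by linarith
  then show ?thesis using cf_inf_Suc[of d] assms by simp
qed

lemma cf_inf_less_1:
  assumes "\<And>i. 1 \<le> d i"
  shows "cf_inf d < 1"
proof -
  have "0 < cf_inf (\<lambda>i. d (Suc i))" "1 \<le> real (d 0)"
    using cf_inf_pos[of "\<lambda>i. d (Suc i)", OF assms] assms[of 0] by linarith+
  then have "1 < real (d 0) + cf_inf (\<lambda>i. d (Suc i))" by linarith
  then show ?thesis using cf_inf_Suc[of d] assms by simp
qed

lemma cf_inf_append:
  assumes "\<And>i. 1 \<le> d i"
  shows "cf_inf d = cf_eval (seq_word d n) (cf_inf (\<lambda>i. d (i + n)))"
proof (induction n)
  case (Suc n)
  have "cf_inf (\<lambda>i. d (i + n)) = cf_eval [d n] (cf_inf (\<lambda>i. d (i + Suc n)))"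
    using cf_inf_Suc[of "\<lambda>i. d (i + n)"] assms by simp
  then show ?case using Suc by (simp only: upt_Suc cf_eval_append map_append) (simp add: cf_eval_append)
qed simp

lemma gauss_map_funpow_cf_inf:
  assumes "\<And>i. 1 \<le> d i"
  shows "(gauss_map ^^ n) (cf_inf d) = cf_inf (\<lambda>i. d (i + n))"
proof (induction n)
  case (Suc n)
  have "cf_inf (\<lambda>i. d (i + n)) = 1 / (real (d n) + cf_inf (\<lambda>i. d (i + Suc n)))"
    using cf_inf_Suc[of "\<lambda>i. d (i + n)"] assms by simp
  moreover have "gauss_map (1 / (real (d n) + cf_inf (\<lambda>i. d (i + Suc n)))) = cf_inf (\<lambda>i. d (i + Suc n))"
    using assms by (intro gauss_map_inverse cf_inf_bounds01 cf_inf_less_1)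
  ultimately show ?case using Suc by simp
qed simp

lemma partial_quotient_cf_inf:
  assumes "\<And>i. 1 \<le> d i"
  shows "pq_defined (Suc n) (cf_inf d)" "partial_quotient (Suc n) (cf_inf d) = int (d n)"
proof -
  show "pq_defined (Suc n) (cf_inf d)"
    unfolding pq_defined_def using gauss_map_funpow_cf_inf[of d n] cf_inf_pos[of "\<lambda>i. d (i + n)"] assms
    by simp
  have "cf_inf (\<lambda>i. d (i + n)) = 1 / (real (d n) + cf_inf (\<lambda>i. d (i + Suc n)))"
    using cf_inf_Suc[of "\<lambda>i. d (i + n)"] assms by simp
  moreover have "\<lfloor>1 / (1 / (real (d n) + cf_inf (\<lambda>i. d (i + Suc n))))\<rfloor> = int (d n)"
    using assms by (intro gauss_map_inverse cf_inf_bounds01 cf_inf_less_1)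
  ultimately show "partial_quotient (Suc n) (cf_inf d) = int (d n)"
    unfolding partial_quotient_def using gauss_map_funpow_cf_inf[of d n, OF assms] by simp
qed

section \<open>Pressure\<close>

abbreviation cf_words :: "nat \<Rightarrow> nat list set" where
  "cf_words n \<equiv> {w. length w = n \<and> pos_word w}"

text \<open>The partition function whose exponential growth rate is the pressure. It takes the value
  \<infinity> when \<open>s \<le> 1 / 2\<close> and \<open>n > 0\<close>, hence the type.\<close>

definition cf_sum :: "real \<Rightarrow> nat \<Rightarrow> ennreal" where
  "cf_sum s n = infsum (\<lambda>w. ennreal (cf_den w powr (- 2 * s))) (cf_words n)"

lemma infsum_cf_words_add:
  fixes f :: "nat list \<Rightarrow> ennreal"
  shows "infsum f (cf_words (m + n)) = infsum (\<lambda>u. infsum (\<lambda>v. f (u @ v)) (cf_words n)) (cf_words m)"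
proof -
  have "cf_words (m + n) = (\<lambda>(u, v). u @ v) ` (cf_words m \<times> cf_words n)"
  proof
    show "cf_words (m + n) \<subseteq> (\<lambda>(u, v). u @ v) ` (cf_words m \<times> cf_words n)"
    proof
      fix w assume w: "w \<in> cf_words (m + n)"
      then have "(take m w, drop m w) \<in> cf_words m \<times> cf_words n"
        by (auto dest: in_set_takeD in_set_dropD)
      then show "w \<in> (\<lambda>(u, v). u @ v) ` (cf_words m \<times> cf_words n)"
        by (intro image_eqI[of _ _ "(take m w, drop m w)"]) auto
    qed
  qed auto
  moreover have "inj_on (\<lambda>(u, v). u @ v) (cf_words m \<times> cf_words n)"
    by (auto simp: inj_on_def)
  ultimately have "infsum f (cf_words (m + n)) = infsum (\<lambda>(u, v). f (u @ v)) (cf_words m \<times> cf_words n)"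
    by (simp add: infsum_reindex comp_def case_prod_unfold)
  then show ?thesis by (simp add: infsum_ennreal_Sigma)
qed

lemma cf_words_0: "cf_words 0 = {[]}"
  by auto

lemma cf_words_1: "cf_words (Suc 0) = range (\<lambda>k. [Suc k])"
proof -
  have "w \<in> range (\<lambda>k. [Suc k])" if "w \<in> cf_words (Suc 0)" for w
  proof -
    from that obtain a where "w = [a]" "1 \<le> a" by (auto simp: length_Suc_conv)
    then have "w = (\<lambda>k. [Suc k]) (a - 1)" by simp
    then show ?thesis by blast
  qed
  then show ?thesis by auto
qed

lemma infsum_cf_words_1:
  fixes f :: "nat list \<Rightarrow> ennreal"
  shows "infsum f (cf_words (Suc 0)) = (\<Sum>k. f [Suc k])"
  unfolding cf_words_1 by (subst infsum_reindex) (auto simp: inj_on_def comp_def infsum_ennreal_nat)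

lemma cf_den_powr_append_le:
  assumes "pos_word u" "pos_word v" "0 \<le> s"
  shows "cf_den (u @ v) powr (- 2 * s) \<le> cf_den u powr (- 2 * s) * cf_den v powr (- 2 * s)"
proof -
  have "cf_den (u @ v) powr (- 2 * s) \<le> (cf_den u * cf_den v) powr (- 2 * s)"
    using assms cf_den_append_ge[of u v] cf_denom_pos[of u 0] cf_denom_pos[of v 0]
    by (intro powr_mono2') auto
  then show ?thesis
    using assms cf_denom_pos[of u 0] cf_denom_pos[of v 0] by (simp add: powr_mult)
qed

lemma cf_sum_add_le:
  assumes "0 \<le> s"
  shows "cf_sum s (m + n) \<le> cf_sum s m * cf_sum s n"
proof -
  have "cf_sum s (m + n) \<le> infsum (\<lambda>u. infsum (\<lambda>v. ennreal (cf_den u powr (- 2 * s)) *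
      ennreal (cf_den v powr (- 2 * s))) (cf_words n)) (cf_words m)"
    unfolding cf_sum_def infsum_cf_words_add
    using cf_den_powr_append_le[OF _ _ assms]
    by (intro infsum_ennreal_mono) (simp add: ennreal_mult[symmetric] ennreal_leI)
  also have "\<dots> = cf_sum s m * cf_sum s n"
    unfolding infsum_ennreal_cmult cf_sum_def[of s n, symmetric]
    unfolding mult.commute[of _ "cf_sum s n"] infsum_ennreal_cmult cf_sum_def[of s m] ..
  finally show ?thesis .
qed

lemma cf_sum_0 [simp]: "cf_sum s 0 = 1"
  unfolding cf_sum_def cf_words_0 by simp

lemma cf_sum_1: "cf_sum s (Suc 0) = (\<Sum>k. ennreal (real (Suc k) powr (- 2 * s)))"
  unfolding cf_sum_def infsum_cf_words_1 by simp

lemma cf_sum_1_less_top: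
  assumes "1 / 2 < s"
  shows "cf_sum s (Suc 0) < \<infinity>"
proof -
  have "summable (\<lambda>k. real (Suc k) powr (- 2 * s))"
    using summable_Suc_iff[of "\<lambda>k. real k powr (- 2 * s)"] summable_real_powr_iff[of "- 2 * s"] assms by auto
  then show ?thesis unfolding cf_sum_1 by (simp add: suminf_ennreal2)
qed

lemma cf_sum_le_power:
  assumes "0 \<le> s"
  shows "cf_sum s n \<le> cf_sum s (Suc 0) ^ n"
proof (induction n)
  case (Suc n)
  have "cf_sum s (Suc n) \<le> cf_sum s (Suc 0) * cf_sum s n"
    using cf_sum_add_le[OF assms, of "Suc 0" n] by simp
  also have "\<dots> \<le> cf_sum s (Suc 0) * cf_sum s (Suc 0) ^ n" by (intro mult_left_mono Suc) simp
  finally show ?case by simp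
qed simp

lemma cf_sum_less_top:
  assumes "1 / 2 < s"
  shows "cf_sum s n < \<infinity>"
proof -
  have "cf_sum s n \<le> cf_sum s (Suc 0) ^ n" using assms by (intro cf_sum_le_power) auto
  also have "\<dots> < \<infinity>" using cf_sum_1_less_top[OF assms] by (simp add: power_less_top_ennreal)
  finally show ?thesis .
qed

lemma prod_list_replicate_1: "(\<Prod>a\<leftarrow>replicate n (Suc 0). real a + 1) = 2 ^ n"
  by (induction n) auto

lemma cf_sum_ge:
  assumes "0 \<le> s"
  shows "ennreal ((2 ^ n) powr (- 2 * s)) \<le> cf_sum s n"
proof -
  let ?w = "replicate n (Suc 0)"
  have "ennreal ((2 ^ n) powr (- 2 * s)) \<le> ennreal (cf_den ?w powr (- 2 * s))"
    using cf_den_le_prod_list[of ?w] cf_denom_pos[of ?w 0] assms prod_list_replicate_1[of n]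
    by (intro ennreal_leI powr_mono2') auto
  also have "\<dots> \<le> cf_sum s n"
    unfolding cf_sum_def using sum_le_infsum_ennreal[of "{?w}" "cf_words n" "\<lambda>w. ennreal (cf_den w powr (- 2 * s))"]
    by simp
  finally show ?thesis .
qed

text \<open>Words with an arbitrary first digit followed by ones already suffice: they contribute a
  constant multiple of a divergent series of powers.\<close>

lemma cf_sum_eq_top:
  assumes s: "0 \<le> s" "s \<le> 1 / 2"
  shows "cf_sum s (Suc n) = \<infinity>"
proof -
  let ?r = "replicate n (Suc 0)"
  define c where "c = (2 ^ n) powr (- 2 * s) * 2 powr (- 2 * s)"
  have "\<not> summable (\<lambda>k. real k powr (- 2 * s))"
    unfolding summable_real_powr_iff using s by simp
  then have ns: "\<not> summable (\<lambda>k. real (Suc k) powr (- 2 * s))"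
    using summable_Suc_iff[of "\<lambda>k. real k powr (- 2 * s)"] by simp
  have "(\<Sum>k. ennreal (real (Suc k) powr (- 2 * s))) = \<infinity>"
  proof (rule ccontr)
    assume "\<not> ?thesis"
    then have "summable (\<lambda>k. real (Suc k) powr (- 2 * s))"
      by (intro summable_suminf_not_top powr_ge_zero) (simp only: infinity_ennreal_def not_False_eq_True)
    with ns show False by (rule notE)
  qed
  moreover have "0 < c" by (simp add: c_def)
  ultimately have "\<infinity> = ennreal c * (\<Sum>k. ennreal (real (Suc k) powr (- 2 * s)))"
    by (simp only: infinity_ennreal_def) (subst ennreal_mult_top, simp_all add: ennreal_eq_0_iff)
  also have "\<dots> = (\<Sum>k. ennreal (c * real (Suc k) powr (- 2 * s)))"
    by (subst ennreal_suminf_cmult[symmetric]) (simp add: ennreal_mult c_def)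
  also have "\<dots> \<le> (\<Sum>k. ennreal (cf_den ([Suc k] @ ?r) powr (- 2 * s)))"
  proof (intro suminf_le ennreal_leI)
    fix k
    have "cf_den ([Suc k] @ ?r) \<le> (\<Prod>a\<leftarrow>[Suc k] @ ?r. real a + 1)"
      by (rule cf_den_le_prod_list) auto
    also have "\<dots> \<le> 2 ^ n * (2 * real (Suc k))"
      using mult_right_mono[of "real (Suc k) + 1" "2 * real (Suc k)" "2 ^ n"]
      by (simp only: map_append prod_list.append prod_list_replicate_1) (simp add: mult_ac)
    finally have "(2 ^ n * (2 * real (Suc k))) powr (- 2 * s) \<le> cf_den ([Suc k] @ ?r) powr (- 2 * s)"
      using s cf_denom_pos[of "[Suc k] @ ?r" 0] by (intro powr_mono2') auto
    then show "c * real (Suc k) powr (- 2 * s) \<le> cf_den ([Suc k] @ ?r) powr (- 2 * s)"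
      by (simp only: c_def powr_mult mult.assoc)
  qed auto
  also have "\<dots> \<le> (\<Sum>k. infsum (\<lambda>v. ennreal (cf_den ([Suc k] @ v) powr (- 2 * s))) (cf_words n))"
  proof (rule suminf_le)
    fix k
    show "ennreal (cf_den ([Suc k] @ ?r) powr (- 2 * s)) \<le>
        infsum (\<lambda>v. ennreal (cf_den ([Suc k] @ v) powr (- 2 * s))) (cf_words n)"
      using sum_le_infsum_ennreal[of "{?r}" "cf_words n" "\<lambda>v. ennreal (cf_den ([Suc k] @ v) powr (- 2 * s))"]
      by simp
  qed auto
  also have "\<dots> = cf_sum s (Suc n)"
    using infsum_cf_words_add[of "\<lambda>w. ennreal (cf_den w powr (- 2 * s))" "Suc 0" n]
    by (simp only: cf_sum_def infsum_cf_words_1 add_Suc add_0)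
  finally show ?thesis by (simp add: top.extremum_uniqueI)
qed

text \<open>The summand is the length of the cylinder of \<open>w\<close>, the image of the unit
  interval, and the cylinders of order \<open>n\<close> tile the unit interval up to a null set. The
  induction splits a cylinder at the points \<open>1 / k\<close> and telescopes.\<close>

lemma infsum_cf_length: "infsum (\<lambda>w. ennreal (1 / (cf_den w * cf_denom w 1))) (cf_words n) = 1"
proof (induction n)
  case 0
  then show ?case unfolding cf_words_0 by simp
next
  case (Suc n)
  have "infsum (\<lambda>v. ennreal (1 / (cf_den (u @ v) * cf_denom (u @ v) 1))) (cf_words (Suc 0)) =
      ennreal (1 / (cf_den u * cf_denom u 1))" if u: "u \<in> cf_words n" for u
  proof -
    \<comment> \<open>The sign makes this function increasing in \<open>y\<close> whatever the
      parity of the length.\<close>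
    define f where "f y = (- 1) ^ length u * cf_eval u y" for y
    have fd: "f y - f y' = (y - y') / (cf_denom u y * cf_denom u y')" if "0 \<le> y" "0 \<le> y'" for y y'
      using cf_eval_diff[of u y y'] u that by (simp add: f_def algebra_simps)
    have eq: "1 / (cf_den (u @ [Suc k]) * cf_denom (u @ [Suc k]) 1) = f (1 / real (Suc k)) - f (1 / real (Suc (Suc k)))" for k
    proof -
      let ?x = "real (Suc k)"
      have "1 / ?x - 1 / real (Suc (Suc k)) = 1 / (?x * real (Suc (Suc k)))"
        by (simp add: divide_simps)
      then have "f (1 / ?x) - f (1 / real (Suc (Suc k))) =
          (1 / (?x * real (Suc (Suc k)))) / (cf_denom u (1 / ?x) * cf_denom u (1 / real (Suc (Suc k))))"
        by (subst fd) auto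
      moreover have "cf_den (u @ [Suc k]) = cf_denom u (1 / ?x) * ?x"
        "cf_denom (u @ [Suc k]) 1 = cf_denom u (1 / real (Suc (Suc k))) * real (Suc (Suc k))"
        by (simp_all add: cf_denom_append add.commute)
      ultimately show ?thesis by (simp only: divide_divide_eq_left mult_ac)
    qed
    have "(\<lambda>k. f (1 / real (Suc k))) \<longlonglongrightarrow> f 0"
    proof (rule LIM_zero_cancel, rule Lim_null_comparison)
      show "\<forall>\<^sub>F k in sequentially. norm (f (1 / real (Suc k)) - f 0) \<le> (1 / real (Suc k)) / (cf_den u)\<^sup>2"
      proof (intro always_eventually allI)
        fix k
        have "norm (f (1 / real (Suc k)) - f 0) = \<bar>cf_eval u (1 / real (Suc k)) - cf_eval u 0\<bar>"
          by (simp add: f_def right_diff_distrib[symmetric] abs_mult power_abs)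
        also have "\<dots> \<le> \<bar>1 / real (Suc k) - 0\<bar> / (cf_den u)\<^sup>2"
          using u by (intro abs_cf_eval_diff_le) auto
        finally show "norm (f (1 / real (Suc k)) - f 0) \<le> (1 / real (Suc k)) / (cf_den u)\<^sup>2" by simp
      qed
      show "(\<lambda>k. (1 / real (Suc k)) / (cf_den u)\<^sup>2) \<longlonglongrightarrow> 0"
        using tendsto_divide_zero[OF LIMSEQ_inverse_real_of_nat] by (simp add: inverse_eq_divide)
    qed
    then have sums: "(\<lambda>k. f (1 / real (Suc k)) - f (1 / real (Suc (Suc k)))) sums (f 1 - f 0)"
      using telescope_sums'[of "\<lambda>k. f (1 / real (Suc k))" "f 0"] by simp
    have nonneg: "0 \<le> f (1 / real (Suc k)) - f (1 / real (Suc (Suc k)))" for k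
    proof -
      have "pos_word (u @ [Suc k])" using u by auto
      then have "0 \<le> 1 / (cf_den (u @ [Suc k]) * cf_denom (u @ [Suc k]) 1)"
        using cf_denom_pos[of "u @ [Suc k]"] by (simp add: less_imp_le)
      then show ?thesis unfolding eq .
    qed
    have "infsum (\<lambda>v. ennreal (1 / (cf_den (u @ v) * cf_denom (u @ v) 1))) (cf_words (Suc 0)) =
        ennreal (\<Sum>k. f (1 / real (Suc k)) - f (1 / real (Suc (Suc k))))"
      unfolding infsum_cf_words_1 eq using sums nonneg by (intro suminf_ennreal2) (auto simp: sums_iff)
    also have "\<dots> = ennreal (f 1 - f 0)" using sums by (simp add: sums_iff)
    also have "f 1 - f 0 = 1 / (cf_den u * cf_denom u 1)" by (subst fd) (auto simp: mult.commute)
    finally show ?thesis .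
  qed
  then have "infsum (\<lambda>u. infsum (\<lambda>v. ennreal (1 / (cf_den (u @ v) * cf_denom (u @ v) 1))) (cf_words (Suc 0)))
      (cf_words n) = 1"
    unfolding Suc[symmetric] by (intro infsum_cong)
  then show ?case
    using infsum_cf_words_add[of "\<lambda>w. ennreal (1 / (cf_den w * cf_denom w 1))" n "Suc 0"]
    by (simp only: add_Suc_right add_0_right)
qed

text \<open>At exponent 1 the summand is the cylinder length up to a factor between 1 and 2, so the
  partition function stays bounded in both directions and the pressure vanishes.\<close>

lemma cf_sum_at_1: "1 \<le> cf_sum 1 n" "cf_sum 1 n \<le> 2"
proof -
  have p: "cf_den w powr (- 2 * 1) = 1 / (cf_den w)\<^sup>2" if "pos_word w" for w
    using cf_denom_pos[of w 0] that by (simp add: powr_minus divide_simps)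
  show "1 \<le> cf_sum 1 n"
    unfolding infsum_cf_length[of n, symmetric] cf_sum_def
  proof (intro infsum_ennreal_mono ennreal_leI)
    fix w assume w: "w \<in> cf_words n"
    then show "1 / (cf_den w * cf_denom w 1) \<le> cf_den w powr (- 2 * 1)"
      using cf_denom_bounds(1)[of w 1] cf_denom_pos[of w 0] cf_denom_pos[of w 1]
      by (subst p) (auto intro!: divide_left_mono mult_left_mono simp: power2_eq_square)
  qed
  have "cf_sum 1 n \<le> infsum (\<lambda>w. 2 * ennreal (1 / (cf_den w * cf_denom w 1))) (cf_words n)"
    unfolding cf_sum_def
  proof (intro infsum_ennreal_mono)
    fix w assume w: "w \<in> cf_words n"
    have "cf_den w * cf_denom w 1 \<le> 2 * (cf_den w)\<^sup>2"
      using w cf_denom_bounds(2)[of w 1] cf_denom_pos[of w 0] by (simp add: power2_eq_square)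
    then have "1 / (cf_den w)\<^sup>2 \<le> 2 * (1 / (cf_den w * cf_denom w 1))"
      using w cf_denom_pos[of w 0] cf_denom_pos[of w 1] by (simp add: divide_simps)
    then have "ennreal (cf_den w powr (- 2 * 1)) \<le> ennreal (2 * (1 / (cf_den w * cf_denom w 1)))"
      using w by (subst p) (auto intro!: ennreal_leI)
    then show "ennreal (cf_den w powr (- 2 * 1)) \<le> 2 * ennreal (1 / (cf_den w * cf_denom w 1))"
      by (subst (asm) ennreal_mult') auto
  qed
  also have "\<dots> = 2" unfolding infsum_ennreal_cmult infsum_cf_length by simp
  finally show "cf_sum 1 n \<le> 2" .
qed

lemma cf_sum_mono_exponent:
  assumes "s \<le> s'"
  shows "cf_sum s' n \<le> ennreal ((2 ^ (n div 2)) powr (- 2 * (s' - s))) * cf_sum s n"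
  unfolding cf_sum_def infsum_ennreal_cmult[symmetric]
proof (intro infsum_ennreal_mono)
  fix w assume w: "w \<in> cf_words n"
  have "cf_den w powr (- 2 * s') = cf_den w powr (- 2 * (s' - s)) * cf_den w powr (- 2 * s)"
    by (simp add: powr_add[symmetric] algebra_simps)
  also have "\<dots> \<le> (2 ^ (n div 2)) powr (- 2 * (s' - s)) * cf_den w powr (- 2 * s)"
    using assms w two_power_le_cf_den[of w] by (intro mult_right_mono powr_mono2') auto
  finally show "ennreal (cf_den w powr (- 2 * s')) \<le>
      ennreal ((2 ^ (n div 2)) powr (- 2 * (s' - s))) * ennreal (cf_den w powr (- 2 * s))"
    by (simp add: ennreal_mult[symmetric] ennreal_leI)
qed


section \<open>Subadditivity and the existence of the growth rate\<close>

lemma fekete_lemma: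
  fixes a :: "nat \<Rightarrow> real"
  assumes sub: "\<And>m n. a (m + n) \<le> a m + a n" and lower: "\<And>n. - c * real n \<le> a n" and a0: "a 0 = 0"
  shows "convergent (\<lambda>n. a n / real n)"
proof -
  define L where "L = (INF n\<in>{1..}. a n / real n)"
  have bdd: "bdd_below ((\<lambda>n. a n / real n) ` {1..})"
  proof (rule bdd_belowI2)
    fix n :: nat assume "n \<in> {1..}"
    then show "- c \<le> a n / real n" using lower[of n] by (auto simp: field_simps)
  qed
  have "(\<lambda>n. a n / real n) \<longlonglongrightarrow> L"
  proof (rule LIMSEQ_I)
    fix e :: real assume e: "0 < e"
    have "\<exists>x\<in>(\<lambda>n. a n / real n) ` {1..}. x < L + e / 2"
      using e bdd by (intro cInf_lessD) (auto simp: L_def)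
    then obtain m :: nat where m: "1 \<le> m" "a m / real m < L + e / 2" by auto
    define M where "M = Max ((\<lambda>r. \<bar>a r\<bar>) ` {..<m})"
    have M: "a r \<le> M" if "r < m" for r
    proof -
      have "\<bar>a r\<bar> \<le> M" unfolding M_def using that by (intro Max_ge) auto
      then show ?thesis by linarith
    qed
    have mult: "a (q * m) \<le> real q * a m" for q
    proof (induction q)
      case (Suc q)
      then show ?case using sub[of m "q * m"] by (simp add: algebra_simps)
    qed (use a0 in simp)
    \<comment> \<open>Division with remainder by a nearly optimal length \<open>m\<close>: the error
      is a constant and disappears after division by \<open>n\<close>.\<close>
    have upper: "a n \<le> real n * (a m / real m) + (\<bar>a m\<bar> + M)" for n
    proof -
      let ?q = "n div m" and ?r = "n mod m"
      have n: "n = ?q * m + ?r" by simp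
      have r: "?r < m" using m by simp
      have "a n \<le> real ?q * a m + M"
        using sub[of "?q * m" ?r] mult[of ?q] M[OF r] n by simp
      moreover have "real n = real ?q * real m + real ?r" using n by (metis of_nat_add of_nat_mult)
      then have "real ?q * a m = real n * (a m / real m) - (real ?r / real m) * a m"
        using m by (simp add: field_simps)
      moreover have "\<bar>(real ?r / real m) * a m\<bar> \<le> 1 * \<bar>a m\<bar>"
        unfolding abs_mult using r m by (intro mult_right_mono) auto
      ultimately show ?thesis by linarith
    qed
    obtain N where N: "2 * (\<bar>a m\<bar> + M) / e < real N" using reals_Archimedean2 by blast
    show "\<exists>no. \<forall>n\<ge>no. norm (a n / real n - L) < e"
    proof (intro exI allI impI)
      fix n assume n: "Suc N \<le> n"
      have "L \<le> a n / real n" unfolding L_def using n by (intro cINF_lower bdd) auto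
      moreover have "a n / real n < L + e"
      proof -
        have "2 * (\<bar>a m\<bar> + M) / e < real n" using N n by linarith
        then have "\<bar>a m\<bar> + M < real n * (e / 2)" using e by (simp add: field_simps)
        moreover have "real n * (a m / real m) < real n * (L + e / 2)"
          using m n by (intro mult_strict_left_mono) auto
        ultimately have "a n < real n * (L + e)" using upper[of n] by (simp add: algebra_simps)
        then show ?thesis using n by (simp add: field_simps)
      qed
      ultimately show "norm (a n / real n - L) < e" by simp
    qed
  qed
  then show ?thesis by (rule convergentI)
qed

definition log_cf_sum :: "real \<Rightarrow> nat \<Rightarrow> real" where
  "log_cf_sum s n = ln (enn2real (cf_sum s n))"

lemma exp_log_cf_sum:
  assumes "1 / 2 < s"
  shows "cf_sum s n = ennreal (exp (log_cf_sum s n))"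
proof -
  have "0 < ennreal ((2 ^ n) powr (- 2 * s))" by simp
  also have "\<dots> \<le> cf_sum s n" using assms by (intro cf_sum_ge) auto
  finally have "0 < cf_sum s n" .
  then have "0 < enn2real (cf_sum s n)" using cf_sum_less_top[OF assms, of n] by (simp add: enn2real_positive_iff)
  then show ?thesis using cf_sum_less_top[OF assms, of n] by (simp add: log_cf_sum_def)
qed

lemma log_cf_sum_leI: "1 / 2 < s \<Longrightarrow> cf_sum s n \<le> ennreal (exp x) \<Longrightarrow> log_cf_sum s n \<le> x"
  and log_cf_sum_geI: "1 / 2 < s \<Longrightarrow> ennreal (exp x) \<le> cf_sum s n \<Longrightarrow> x \<le> log_cf_sum s n"
  by (simp_all add: exp_log_cf_sum ennreal_le_iff)

definition cf_pressure :: "real \<Rightarrow> real" where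
  "cf_pressure s = lim (\<lambda>n. log_cf_sum s n / real n)"

lemma cf_pressure_tendsto:
  assumes s: "1 / 2 < s"
  shows "(\<lambda>n. log_cf_sum s n / real n) \<longlonglongrightarrow> cf_pressure s"
proof -
  have "convergent (\<lambda>n. log_cf_sum s n / real n)"
  proof (rule fekete_lemma)
    show "log_cf_sum s (m + n) \<le> log_cf_sum s m + log_cf_sum s n" for m n
      using cf_sum_add_le[of s m n] s
      by (intro log_cf_sum_leI) (auto simp: exp_add ennreal_mult exp_log_cf_sum[symmetric])
    show "- (2 * s * ln 2) * real n \<le> log_cf_sum s n" for n
    proof (rule log_cf_sum_geI[OF s])
      have "exp (- (2 * s * ln 2) * real n) = (2 ^ n) powr (- 2 * s)"
        by (simp add: powr_def ln_realpow mult_ac)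
      then show "ennreal (exp (- (2 * s * ln 2) * real n)) \<le> cf_sum s n" using cf_sum_ge[of s n] s by simp
    qed
    show "log_cf_sum s 0 = 0" by (simp add: log_cf_sum_def)
  qed
  then show ?thesis by (simp add: cf_pressure_def convergent_LIMSEQ_iff)
qed

section \<open>Birkhoff sums of the logarithm of the derivative, and values of the pressure\<close>

lemma birkhoff_sum_Suc: "birkhoff_sum (Suc n) \<phi> y = \<phi> y + birkhoff_sum n \<phi> (gauss_map y)"
  unfolding birkhoff_sum_def by (simp add: sum.lessThan_Suc_shift funpow_swap1 del: sum.lessThan_Suc)

text \<open>The chain rule along the orbit: every step contributes twice the logarithm of one factor
  of the product \<open>cf_denom\<close>.\<close>

lemma birkhoff_sum_log_deriv:
  assumes "pos_word w" "0 \<le> x" "x < 1"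
  shows "birkhoff_sum (length w) (\<lambda>y. ln \<bar>gauss_deriv y\<bar>) (cf_eval w x) = 2 * ln (cf_denom w x)"
  using assms(1)
proof (induction w)
  case (Cons a w)
  let ?G = "\<lambda>y. ln \<bar>gauss_deriv y\<bar>" and ?z = "cf_eval w x"
  have z: "0 \<le> ?z" "?z \<le> 1" "1 \<le> a" "pos_word w"
    using Cons assms by (auto intro: cf_eval_nonneg cf_eval_le_1)
  \<comment> \<open>The inverse branch at the endpoint 1 is not undone by the Gauss map, whose orbit
    continues at 0 instead. Both orbits contribute only zeros, because the logarithm of 0 is 0
    here.\<close>
  have "gauss_map 1 = 0" "gauss_map 0 = 0" by (auto simp: gauss_map_def)
  then have step: "birkhoff_sum n ?G 0 = birkhoff_sum n ?G 1" for n
    by (cases n) (simp add: birkhoff_sum_def, simp add: birkhoff_sum_Suc gauss_deriv_def)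
  have "birkhoff_sum (length w) ?G (gauss_map (1 / (real a + ?z))) = birkhoff_sum (length w) ?G ?z"
  proof (cases "?z = 1")
    case True
    have "1 / (1 / (real a + 1)) = of_int (int a + 1)" by simp
    then have "gauss_map (1 / (real a + 1)) = 0" unfolding gauss_map_def by (simp only: floor_of_int) simp
    then show ?thesis unfolding True using step by simp
  next
    case False
    then show ?thesis using z by (simp add: gauss_map_inverse)
  qed
  moreover have "?G (1 / (real a + ?z)) = 2 * ln (real a + ?z)"
  proof -
    have "\<bar>gauss_deriv (1 / (real a + ?z))\<bar> = (real a + ?z)\<^sup>2"
      by (simp add: gauss_deriv_def power_one_over)
    then show ?thesis using z by (simp add: ln_realpow)
  qed
  ultimately show ?case
    using Cons z cf_denom_pos[of w x] assms by (simp add: birkhoff_sum_Suc ln_mult)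
qed (simp add: birkhoff_sum_def)

text \<open>The denominator is smallest at \<open>x = 0\<close>, a point of the half-open interval,
  so each supremum is attained there and is a power of the denominator itself.\<close>

lemma pressure_sum_eq:
  assumes "0 \<le> s"
  shows "(\<Sum>\<^sub>\<infinity>w\<in>{w. length w = n \<and> (\<forall>a\<in>set w. 1 \<le> a)}.
      SUP x\<in>{0..<1}. ennreal (exp (birkhoff_sum n (\<lambda>x. - s * ln \<bar>gauss_deriv x\<bar> - c) (cf_eval w x))))
    = ennreal (exp (- c * real n)) * cf_sum s n"
  unfolding cf_sum_def infsum_ennreal_cmult[symmetric]
proof (rule infsum_cong)
  fix w assume w: "w \<in> cf_words n"
  have eq: "exp (birkhoff_sum n (\<lambda>x. - s * ln \<bar>gauss_deriv x\<bar> - c) (cf_eval w x)) =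
      exp (- c * real n) * cf_denom w x powr (- 2 * s)" if "0 \<le> x" "x < 1" for x
  proof -
    have "birkhoff_sum n (\<lambda>x. - s * ln \<bar>gauss_deriv x\<bar> - c) (cf_eval w x) =
        - s * birkhoff_sum n (\<lambda>y. ln \<bar>gauss_deriv y\<bar>) (cf_eval w x) - c * real n"
      unfolding birkhoff_sum_def by (simp add: sum_subtractf sum_distrib_left)
    also have "\<dots> = - c * real n + (- 2 * s) * ln (cf_denom w x)"
      using birkhoff_sum_log_deriv[of w x] w that by simp
    finally show ?thesis using cf_denom_pos[of w x] w that by (simp only: exp_add) (simp add: powr_def)
  qed
  show "(SUP x\<in>{0..<1}. ennreal (exp (birkhoff_sum n (\<lambda>x. - s * ln \<bar>gauss_deriv x\<bar> - c) (cf_eval w x)))) =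
      ennreal (exp (- c * real n)) * ennreal (cf_den w powr (- 2 * s))"
    unfolding ennreal_mult[OF exp_ge_zero powr_ge_zero, symmetric]
  proof (rule antisym)
    show "(SUP x\<in>{0..<1}. ennreal (exp (birkhoff_sum n (\<lambda>x. - s * ln \<bar>gauss_deriv x\<bar> - c) (cf_eval w x)))) \<le>
        ennreal (exp (- c * real n) * cf_den w powr (- 2 * s))"
    proof (intro SUP_least ennreal_leI)
      fix x :: real assume x: "x \<in> {0..<1}"
      have "cf_denom w x powr (- 2 * s) \<le> cf_den w powr (- 2 * s)"
        using w x assms cf_denom_bounds(1)[of w x] cf_denom_pos[of w 0] by (intro powr_mono2') auto
      then show "exp (birkhoff_sum n (\<lambda>x. - s * ln \<bar>gauss_deriv x\<bar> - c) (cf_eval w x)) \<le>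
          exp (- c * real n) * cf_den w powr (- 2 * s)"
        using x by (subst eq) auto
    qed
    show "ennreal (exp (- c * real n) * cf_den w powr (- 2 * s)) \<le>
        (SUP x\<in>{0..<1}. ennreal (exp (birkhoff_sum n (\<lambda>x. - s * ln \<bar>gauss_deriv x\<bar> - c) (cf_eval w x))))"
      using eq[of 0] by (intro SUP_upper2[of 0]) auto
  qed
qed

lemma pressure_eq_cf_pressure:
  assumes s: "1 / 2 < s"
  shows "pressure (\<lambda>x. - s * ln \<bar>gauss_deriv x\<bar> - c) = ereal (cf_pressure s - c)"
  unfolding pressure_def pressure_sum_eq[OF less_imp_le[OF order.strict_trans[OF half_gt_zero[OF zero_less_one] s]]]
proof (rule limI)
  have "ereal (log_cf_sum s n / real n - c) =
      ereal (1 / real n) * ln_ennreal (ennreal (exp (- c * real n)) * cf_sum s n)" if "1 \<le> n" for n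
    using that unfolding exp_log_cf_sum[OF s]
    by (simp add: ennreal_mult[symmetric] exp_add[symmetric] ln_ennreal_def ennreal_eq_0_iff not_le diff_divide_distrib
        right_diff_distrib)
  then have "\<forall>\<^sub>F n in sequentially. ereal (log_cf_sum s n / real n - c) =
      ereal (1 / real n) * ln_ennreal (ennreal (exp (- c * real n)) * cf_sum s n)"
    by (intro eventually_sequentiallyI) auto
  moreover have "(\<lambda>n. ereal (log_cf_sum s n / real n - c)) \<longlonglongrightarrow> ereal (cf_pressure s - c)"
    by (intro tendsto_ereal tendsto_diff cf_pressure_tendsto s tendsto_const)
  ultimately show "(\<lambda>n. ereal (1 / real n) * ln_ennreal (ennreal (exp (- c * real n)) * cf_sum s n))
      \<longlonglongrightarrow> ereal (cf_pressure s - c)"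
    by (rule Lim_transform_eventually[rotated])
qed

lemma pressure_eq_infinity:
  assumes s: "0 \<le> s" "s \<le> 1 / 2"
  shows "pressure (\<lambda>x. - s * ln \<bar>gauss_deriv x\<bar> - c) = \<infinity>"
  unfolding pressure_def pressure_sum_eq[OF s(1)]
proof (rule limI)
  have "ereal (1 / real n) * ln_ennreal (ennreal (exp (- c * real n)) * cf_sum s n) = \<infinity>" if "1 \<le> n" for n
    using that cf_sum_eq_top[OF s, of "n - 1"]
    by (simp add: ln_ennreal_def ennreal_mult_top ennreal_eq_0_iff not_le)
  then have "\<forall>\<^sub>F n in sequentially. \<infinity> = ereal (1 / real n) * ln_ennreal (ennreal (exp (- c * real n)) * cf_sum s n)"
    by (intro eventually_sequentiallyI[of 1]) auto
  then show "(\<lambda>n. ereal (1 / real n) * ln_ennreal (ennreal (exp (- c * real n)) * cf_sum s n)) \<longlonglongrightarrow> \<infinity>"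
    by (rule Lim_transform_eventually[rotated]) simp
qed

text \<open>A word of length \<open>n\<close> has denominator at least about
  \<open>2 powr (n / 2)\<close>, so raising the exponent by \<open>s' - s\<close> gains the factor
  \<open>2 powr (s' - s)\<close> per digit. The quantitative form turns weak inequalities for the
  pressure into strict ones and makes it positive below exponent 1.\<close>

lemma cf_pressure_mono:
  assumes "1 / 2 < s" "s \<le> s'"
  shows "cf_pressure s' \<le> cf_pressure s - (s' - s) * ln 2"
proof (rule LIMSEQ_le[OF cf_pressure_tendsto])
  show "1 / 2 < s'" using assms by simp
  have tend: "(\<lambda>n. (real (n div 2) / real n)) \<longlonglongrightarrow> 1 / 2"
  proof (rule tendsto_sandwich)
    have "real n \<le> 2 * real (n div 2) + 2" "2 * real (n div 2) \<le> real n" for n by linarith+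
    then show "\<forall>\<^sub>F n in sequentially. 1 / 2 - 1 / real n \<le> real (n div 2) / real n"
      "\<forall>\<^sub>F n in sequentially. real (n div 2) / real n \<le> 1 / 2"
      by (auto intro!: eventually_sequentiallyI[of 1] simp: divide_simps)
    show "(\<lambda>n. 1 / 2 - 1 / real n) \<longlonglongrightarrow> 1 / 2"
      using tendsto_diff[OF tendsto_const[of "1 / 2 :: real"] lim_const_over_n[of 1]] by simp
  qed simp
  have "(\<lambda>n. log_cf_sum s n / real n - 2 * (s' - s) * ln 2 * (real (n div 2) / real n)) \<longlonglongrightarrow>
      cf_pressure s - 2 * (s' - s) * ln 2 * (1 / 2)"
    by (intro tendsto_intros cf_pressure_tendsto tend assms)
  moreover have "2 * (s' - s) * ln 2 * (1 / 2) = (s' - s) * ln 2" by simp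
  ultimately show "(\<lambda>n. log_cf_sum s n / real n - 2 * (s' - s) * ln 2 * (real (n div 2) / real n)) \<longlonglongrightarrow>
      cf_pressure s - (s' - s) * ln 2" by (simp only:)
  have "log_cf_sum s' n / real n \<le> log_cf_sum s n / real n - 2 * (s' - s) * ln 2 * (real (n div 2) / real n)" for n
  proof -
    have "log_cf_sum s' n \<le> - 2 * (s' - s) * ln 2 * real (n div 2) + log_cf_sum s n"
    proof (rule log_cf_sum_leI)
      have "(2 ^ (n div 2)) powr (- 2 * (s' - s)) = exp (- 2 * (s' - s) * ln 2 * real (n div 2))"
        by (simp add: powr_def ln_realpow mult_ac)
      then show "cf_sum s' n \<le> ennreal (exp (- 2 * (s' - s) * ln 2 * real (n div 2) + log_cf_sum s n))"
        using cf_sum_mono_exponent[OF assms(2), of n] assms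
        by (simp add: exp_add ennreal_mult exp_log_cf_sum[symmetric])
    qed (use assms in auto)
    then have "log_cf_sum s' n / real n \<le> (- 2 * (s' - s) * ln 2 * real (n div 2) + log_cf_sum s n) / real n"
      by (intro divide_right_mono) auto
    then show ?thesis by (simp add: add_divide_distrib diff_divide_distrib algebra_simps)
  qed
  then show "\<exists>N. \<forall>n\<ge>N. log_cf_sum s' n / real n \<le>
      log_cf_sum s n / real n - 2 * (s' - s) * ln 2 * (real (n div 2) / real n)" by blast
qed

lemma cf_pressure_1: "cf_pressure 1 = 0"
proof (rule LIMSEQ_unique[OF cf_pressure_tendsto])
  show "(\<lambda>n. log_cf_sum 1 n / real n) \<longlonglongrightarrow> 0"
  proof (rule tendsto_sandwich)
    have "0 \<le> log_cf_sum 1 n" "log_cf_sum 1 n \<le> ln 2" for n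
      using cf_sum_at_1[of n] by (auto intro!: log_cf_sum_leI log_cf_sum_geI)
    then show "\<forall>\<^sub>F n in sequentially. 0 \<le> log_cf_sum 1 n / real n"
      "\<forall>\<^sub>F n in sequentially. log_cf_sum 1 n / real n \<le> ln 2 / real n"
      by (auto intro!: always_eventually divide_right_mono)
  qed (auto intro: lim_const_over_n)
qed simp

section \<open>Lower bounds from trees of words\<close>

text \<open>Bounding the digit after a \<open>1\<close> keeps the tails of a continued fraction away from \<open>1\<close>, so that points in
  adjacent cylinders are separated by a fixed fraction of the cylinder size.\<close>

definition buffered :: "nat \<Rightarrow> nat list \<Rightarrow> bool" where
  "buffered M w \<longleftrightarrow> pos_word w \<and> (w \<noteq> [] \<longrightarrow> 2 \<le> last w) \<and> successively (\<lambda>a b. a = 1 \<longrightarrow> b \<le> M) w"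

definition buffered_seq :: "nat \<Rightarrow> (nat \<Rightarrow> nat) \<Rightarrow> bool" where
  "buffered_seq M d \<longleftrightarrow> (\<forall>n. 1 \<le> d n \<and> (d n = 1 \<longrightarrow> d (Suc n) \<le> M))"

text \<open>A nonempty buffered word ends in a digit at least 2, so no condition crosses the
  junction.\<close>

lemma buffered_append: "buffered M u \<Longrightarrow> buffered M v \<Longrightarrow> buffered M (u @ v)"
  by (cases "v = []") (auto simp: buffered_def successively_append_iff)

lemma buffered_seq_ge_1: "buffered_seq M d \<Longrightarrow> 1 \<le> d n"
  by (simp add: buffered_seq_def)

lemma buffered_seq_shift: "buffered_seq M d \<Longrightarrow> buffered_seq M (\<lambda>i. d (i + n))"
  by (simp add: buffered_seq_def)

text \<open>A first digit at least 2 gives a value at most 1/2. A first digit 1 is followed by a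
  digit at most \<open>M\<close>, hence by a tail at least \<open>1 / (M + 1)\<close>, which gives
  exactly the stated bound.\<close>

lemma cf_inf_le_of_buffered:
  assumes d: "buffered_seq M d"
  shows "cf_inf d \<le> 1 - 1 / (real M + 2)"
proof -
  have pos: "1 \<le> d i" for i using d by (rule buffered_seq_ge_1)
  define z where "z = cf_inf (\<lambda>i. d (Suc i))"
  have z0: "0 \<le> z" unfolding z_def using pos by (intro cf_inf_bounds01)
  have eq: "cf_inf d = 1 / (real (d 0) + z)" unfolding z_def by (rule cf_inf_Suc[OF pos])
  show ?thesis
  proof (cases "d 0 = 1")
    case True
    have z: "z = 1 / (real (d 1) + cf_inf (\<lambda>i. d (Suc (Suc i))))"
      unfolding z_def using cf_inf_Suc[of "\<lambda>i. d (Suc i)", OF pos] by simp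
    have "d 1 \<le> M" using d True by (simp add: buffered_seq_def)
    then have "1 / (real M + 1) \<le> z" unfolding z
      using cf_inf_bounds01[of "\<lambda>i. d (Suc (Suc i))", OF pos] pos[of 1]
      by (intro divide_left_mono) (auto intro!: mult_pos_pos add_pos_nonneg)
    then have "1 / (1 + z) \<le> 1 / (1 + 1 / (real M + 1))" using z0
      by (intro divide_left_mono) (auto intro!: mult_pos_pos add_pos_nonneg)
    also have "\<dots> = 1 - 1 / (real M + 2)" by (simp add: field_simps)
    finally show ?thesis using eq True by simp
  next
    case False
    then have "2 \<le> d 0" using pos[of 0] by linarith
    then have "cf_inf d \<le> 1 / 2" unfolding eq using z0 by (intro divide_left_mono) auto
    also have "\<dots> \<le> 1 - 1 / (real M + 2)" by (simp add: divide_simps)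
    finally show ?thesis .
  qed
qed

text \<open>The tails differ by at most \<open>1 - 1 / (M + 2)\<close>, so they cannot cancel a
  digit difference of at least 1; the fraction \<open>1 / (M + 2)\<close> of that difference
  survives.\<close>

lemma cf_inf_gap_digit:
  assumes d: "buffered_seq M d" and d': "buffered_seq M d'"
    and ne: "d 0 \<noteq> d' 0" and N: "d 0 \<le> N" "d' 0 \<le> N"
  shows "\<bar>real (d 0) - real (d' 0)\<bar> / ((real M + 2) * (real N + 1)\<^sup>2) \<le> \<bar>cf_inf d - cf_inf d'\<bar>"
proof -
  define z z' where "z = cf_inf (\<lambda>i. d (Suc i))" and "z' = cf_inf (\<lambda>i. d' (Suc i))"
  have pos: "1 \<le> d i" "1 \<le> d' i" for i by (rule buffered_seq_ge_1[OF d], rule buffered_seq_ge_1[OF d'])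
  have b: "buffered_seq M (\<lambda>i. d (Suc i))" "buffered_seq M (\<lambda>i. d' (Suc i))"
    using buffered_seq_shift[OF d, of 1] buffered_seq_shift[OF d', of 1] by simp_all
  have z: "0 \<le> z" "z \<le> 1 - 1 / (real M + 2)" "0 \<le> z'" "z' \<le> 1 - 1 / (real M + 2)"
    unfolding z_def z'_def using pos b by (intro cf_inf_bounds01 cf_inf_le_of_buffered; simp)+
  have eq: "cf_inf d = 1 / (real (d 0) + z)" "cf_inf d' = 1 / (real (d' 0) + z')"
    unfolding z_def z'_def using pos by (intro cf_inf_Suc; simp)+
  have p: "0 < real (d 0) + z" "0 < real (d' 0) + z'" using pos(1)[of 0] pos(2)[of 0] z by linarith+
  define x where "x = real (d 0) - real (d' 0)"
  have x1: "1 \<le> \<bar>x\<bar>" using ne unfolding x_def by linarith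
  have "\<bar>x\<bar> / (real M + 2) = \<bar>x\<bar> - (1 - 1 / (real M + 2)) * \<bar>x\<bar>" by (simp add: algebra_simps)
  also have "\<dots> \<le> \<bar>x\<bar> - (1 - 1 / (real M + 2)) * 1"
    using x1 by (intro diff_left_mono mult_left_mono) (auto simp: divide_simps)
  also have "\<dots> \<le> \<bar>x + (z - z')\<bar>"
  proof -
    have "\<bar>x\<bar> \<le> \<bar>x + (z - z')\<bar> + \<bar>z - z'\<bar>" by linarith
    moreover have "\<bar>z - z'\<bar> \<le> 1 - 1 / (real M + 2)" using z unfolding abs_le_iff by linarith
    ultimately show ?thesis unfolding mult_1_right by linarith
  qed
  finally have num: "\<bar>x\<bar> / (real M + 2) \<le> \<bar>x + (z - z')\<bar>" .
  have "1 / (real M + 2) > 0" by simp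
  then have "z \<le> 1" "z' \<le> 1" using z by linarith+
  then have "(real (d 0) + z) * (real (d' 0) + z') \<le> (real N + 1) * (real N + 1)"
    using N p by (intro mult_mono) auto
  then have den: "(real (d 0) + z) * (real (d' 0) + z') \<le> (real N + 1)\<^sup>2" by (simp add: power2_eq_square)
  have "\<bar>cf_inf d - cf_inf d'\<bar> = \<bar>x + (z - z')\<bar> / ((real (d 0) + z) * (real (d' 0) + z'))"
  proof -
    have "cf_inf d - cf_inf d' = - (x + (z - z')) / ((real (d 0) + z) * (real (d' 0) + z'))"
      unfolding eq x_def using p by (simp add: divide_simps)
    then show ?thesis using p by (simp only: abs_divide abs_minus_cancel abs_mult)
  qed
  also have "\<dots> \<ge> (\<bar>x\<bar> / (real M + 2)) / (real N + 1)\<^sup>2"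
    using num den p by (intro frac_le) auto
  finally show ?thesis by (simp add: x_def)
qed

text \<open>Common leading digits contract distances by at most \<open>(N + 1)\<^sup>2\<close> each;
  at the first differing digit the preceding bound applies.\<close>

lemma cf_inf_gap_word:
  assumes "buffered_seq M d" "buffered_seq M d'" "seq_word d L \<noteq> seq_word d' L"
    and "\<And>i. i < L \<Longrightarrow> d i \<le> N \<and> d' i \<le> N"
  shows "1 / ((real M + 2) * ((real N + 1)\<^sup>2) ^ L) \<le> \<bar>cf_inf d - cf_inf d'\<bar>"
  using assms
proof (induction L arbitrary: d d')
  case (Suc L)
  have pos: "1 \<le> d i" "1 \<le> d' i" for i
    by (rule buffered_seq_ge_1[OF Suc.prems(1)], rule buffered_seq_ge_1[OF Suc.prems(2)])
  have N1: "1 \<le> (real N + 1)\<^sup>2" by (simp add: one_le_power)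
  show ?case
  proof (cases "d 0 = d' 0")
    case False
    have "1 \<le> ((real N + 1)\<^sup>2) ^ L" using N1 by (rule one_le_power)
    then have "(real M + 2) * (real N + 1)\<^sup>2 * 1 \<le> (real M + 2) * (real N + 1)\<^sup>2 * ((real N + 1)\<^sup>2) ^ L"
      by (intro mult_left_mono) auto
    then have "1 / ((real M + 2) * ((real N + 1)\<^sup>2) ^ Suc L) \<le> 1 / ((real M + 2) * (real N + 1)\<^sup>2)"
      by (intro divide_left_mono) (auto simp: mult_ac intro!: mult_pos_pos)
    also have "\<dots> \<le> \<bar>real (d 0) - real (d' 0)\<bar> / ((real M + 2) * (real N + 1)\<^sup>2)"
      using False by (intro divide_right_mono) auto
    also have "\<dots> \<le> \<bar>cf_inf d - cf_inf d'\<bar>"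
      using Suc.prems False by (intro cf_inf_gap_digit) auto
    finally show ?thesis .
  next
    case True
    define z z' where "z = cf_inf (\<lambda>i. d (Suc i))" and "z' = cf_inf (\<lambda>i. d' (Suc i))"
    have b: "buffered_seq M (\<lambda>i. d (Suc i))" "buffered_seq M (\<lambda>i. d' (Suc i))"
      using Suc.prems(1,2) by (simp_all add: buffered_seq_def)
    have z: "0 \<le> z" "z \<le> 1" "0 \<le> z'" "z' \<le> 1"
      unfolding z_def z'_def using pos by (intro cf_inf_bounds01; simp)+
    have w: "seq_word e (Suc L) = e 0 # seq_word (\<lambda>i. e (Suc i)) L" for e :: "nat \<Rightarrow> nat"
      using seq_word_add[of e 1 L] by simp
    have IH: "1 / ((real M + 2) * ((real N + 1)\<^sup>2) ^ L) \<le> \<bar>z - z'\<bar>"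
      unfolding z_def z'_def
    proof (rule Suc.IH[OF b])
      show "seq_word (\<lambda>i. d (Suc i)) L \<noteq> seq_word (\<lambda>i. d' (Suc i)) L"
        using Suc.prems(3) True unfolding w by simp
    qed (use Suc.prems(4) in auto)
    have eq: "cf_inf d = cf_eval [d 0] z" "cf_inf d' = cf_eval [d 0] z'"
      unfolding z_def z'_def cf_eval_Cons cf_eval_Nil using pos True
      by (simp_all only: cf_inf_Suc[of d] cf_inf_Suc[of d'])
    have dN: "real (d 0) \<le> real N" using Suc.prems(4)[of 0] by simp
    have "cf_denom [d 0] z * cf_denom [d 0] z' \<le> (real N + 1) * (real N + 1)"
      using z dN by (intro mult_mono) auto
    moreover have "0 < cf_denom [d 0] z * cf_denom [d 0] z'"
      using z pos by (intro mult_pos_pos cf_denom_pos) auto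
    ultimately have "\<bar>z - z'\<bar> / (real N + 1)\<^sup>2 \<le> \<bar>z - z'\<bar> / (cf_denom [d 0] z * cf_denom [d 0] z')"
      by (intro divide_left_mono) (auto simp: power2_eq_square)
    also have "\<dots> = \<bar>cf_inf d - cf_inf d'\<bar>"
      unfolding eq using z pos by (intro abs_cf_eval_diff[symmetric]) auto
    finally have "\<bar>z - z'\<bar> / (real N + 1)\<^sup>2 \<le> \<bar>cf_inf d - cf_inf d'\<bar>" .
    moreover have "1 / ((real M + 2) * ((real N + 1)\<^sup>2) ^ L) / (real N + 1)\<^sup>2 \<le> \<bar>z - z'\<bar> / (real N + 1)\<^sup>2"
      using IH by (intro divide_right_mono) auto
    ultimately show ?thesis by (simp add: mult_ac)
  qed
qed simp

text \<open>The list \<open>opts w\<close> holds the words that may follow \<open>w\<close>,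
  \<open>p w\<close> their probabilities, and \<open>Inv w \<mu>\<close> says that \<open>w\<close>
  can be reached with mass \<open>\<mu>\<close>. A parameter in the unit interval selects an option
  by its position among the cumulative weights, is rescaled, and selects again. Two parameters are
  compared at the node where they separate: \<open>gap\<close> bounds the weight of all options from
  one choice to the other by a power of the distance of the resulting points. Keeping the mass as a
  second argument of \<open>Inv\<close> avoids recovering the division of a word into
  options.\<close>

lemma hausdorff_dim_ge_of_tree:
  fixes opts :: "nat list \<Rightarrow> nat list list" and p :: "nat list \<Rightarrow> nat \<Rightarrow> real"
    and Inv :: "nat list \<Rightarrow> real \<Rightarrow> bool"
  assumes s: "0 < s" and K: "0 < K"
    and init: "Inv [] 1"
    and weights: "\<And>w \<mu>. Inv w \<mu> \<Longrightarrow> (\<Sum>i<length (opts w). p w i) = 1"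
    and step: "\<And>w \<mu> i. Inv w \<mu> \<Longrightarrow> i < length (opts w) \<Longrightarrow>
      0 < p w i \<and> opts w ! i \<noteq> [] \<and> buffered M (opts w ! i) \<and> Inv (w @ opts w ! i) (\<mu> * p w i)"
    and mass: "\<And>w \<mu>. Inv w \<mu> \<Longrightarrow> 0 \<le> \<mu> \<and> \<mu> \<le> K * cf_den w powr (- 2 * s)"
    and gap: "\<And>w \<mu> i j d d'. Inv w \<mu> \<Longrightarrow> i < j \<Longrightarrow> j < length (opts w) \<Longrightarrow>
      buffered_seq M d \<Longrightarrow> buffered_seq M d' \<Longrightarrow>
      seq_word d (length (opts w ! i)) = opts w ! i \<Longrightarrow> seq_word d' (length (opts w ! j)) = opts w ! j \<Longrightarrow>
      \<mu> * (\<Sum>k=i..j. p w k) \<le> K * (\<bar>cf_inf d - cf_inf d'\<bar> / (cf_den w)\<^sup>2) powr s"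
    and A: "\<And>d. buffered_seq M d \<Longrightarrow> (\<forall>N. \<exists>n\<ge>N. \<exists>\<mu>. Inv (seq_word d n) \<mu>) \<Longrightarrow> cf_inf d \<in> A"
  shows "ennreal s \<le> hausdorff_dim A"
proof -
  define c where "c w j = (\<Sum>k<j. p w k)" for w and j :: nat
  define idx where "idx w \<tau> = (LEAST i. \<tau> < c w (Suc i))" for w \<tau>
  \<comment> \<open>The state is the word so far, its mass, and the residual parameter: the relative
    position inside the chosen subinterval, again in the unit interval.\<close>
  define nxt where "nxt = (\<lambda>(w, \<mu>, \<tau>). (w @ opts w ! idx w \<tau>, \<mu> * p w (idx w \<tau>), (\<tau> - c w (idx w \<tau>)) / p w (idx w \<tau>)))"
  define st where "st t n = (nxt ^^ n) ([], 1, t)" for t :: real and n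
  define W U T where "W t n = fst (st t n)" and "U t n = fst (snd (st t n))" and "T t n = snd (snd (st t n))" for t n
  have st_eq: "st t n = (W t n, U t n, T t n)" for t n by (simp add: W_def U_def T_def)
  have idx: "idx w \<tau> < length (opts w)" "c w (idx w \<tau>) \<le> \<tau>" "\<tau> < c w (Suc (idx w \<tau>))"
    if I: "Inv w \<mu>" and \<tau>: "0 \<le> \<tau>" "\<tau> < 1" for w \<mu> \<tau>
  proof -
    have total: "\<tau> < c w (length (opts w))" using weights[OF I] \<tau> by (simp add: c_def)
    then have ne: "length (opts w) \<noteq> 0" using \<tau> by (auto simp: c_def)
    then have ex: "\<tau> < c w (Suc (length (opts w) - 1))" using total by simp
    show "\<tau> < c w (Suc (idx w \<tau>))" unfolding idx_def using ex by (rule LeastI)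
    have "idx w \<tau> \<le> length (opts w) - 1" unfolding idx_def using ex by (rule Least_le)
    then show "idx w \<tau> < length (opts w)" using ne by linarith
    show "c w (idx w \<tau>) \<le> \<tau>"
    proof (cases "idx w \<tau>")
      case 0
      then show ?thesis using \<tau> by (simp add: c_def)
    next
      case (Suc j)
      then have "\<not> \<tau> < c w (Suc j)" unfolding idx_def using not_less_Least[of j] by (metis lessI)
      then show ?thesis using Suc by simp
    qed
  qed
  have W0: "W t 0 = []" "U t 0 = 1" "T t 0 = t" for t by (simp_all add: W_def U_def T_def st_def)
  have WS: "W t (Suc n) = W t n @ opts (W t n) ! idx (W t n) (T t n)"
    "U t (Suc n) = U t n * p (W t n) (idx (W t n) (T t n))"
    "T t (Suc n) = (T t n - c (W t n) (idx (W t n) (T t n))) / p (W t n) (idx (W t n) (T t n))" for t n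
    using st_eq[of t n] by (simp_all add: W_def U_def T_def st_def nxt_def split: prod.splits)
  have inv: "Inv (W t n) (U t n) \<and> 0 \<le> T t n \<and> T t n < 1 \<and> n \<le> length (W t n) \<and> buffered M (W t n)"
    if t: "t \<in> {0..<1}" for t n
  proof (induction n)
    case 0
    then show ?case using t init by (simp add: W0 buffered_def)
  next
    case (Suc n)
    let ?i = "idx (W t n) (T t n)"
    have i: "?i < length (opts (W t n))" "c (W t n) ?i \<le> T t n" "T t n < c (W t n) (Suc ?i)"
      using idx[of "W t n" "U t n" "T t n"] Suc by auto
    have st: "0 < p (W t n) ?i" "opts (W t n) ! ?i \<noteq> []" "buffered M (opts (W t n) ! ?i)"
      "Inv (W t (Suc n)) (U t (Suc n))"
      using step[of "W t n" "U t n" ?i] i Suc by (auto simp: WS)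
    have "length (W t (Suc n)) \<ge> Suc n" using Suc st(2)
      by (cases "opts (W t n) ! ?i") (auto simp: WS)
    moreover have "buffered M (W t (Suc n))" using Suc st(3) by (simp add: WS buffered_append)
    moreover have "0 \<le> T t (Suc n)" "T t (Suc n) < 1"
      using i st(1) by (simp_all add: WS c_def)
    ultimately show ?case using st(4) by simp
  qed
  have pre: "\<exists>v. W t (n + k) = W t n @ v" for t n k
  proof (induction k)
    case (Suc k)
    then show ?case by (auto simp: WS)
  qed simp
  \<comment> \<open>Every option is nonempty, so after \<open>Suc n\<close> choices the digit at
    position \<open>n\<close> is settled.\<close>
  define D where "D t n = W t (Suc n) ! n" for t n
  have DW: "seq_word (D t) (length (W t n)) = W t n" if t: "t \<in> {0..<1}" for t n
  proof (rule nth_equalityI)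
    fix i assume "i < length (seq_word (D t) (length (W t n)))"
    then have i: "i < length (W t n)" by simp
    have i2: "i < length (W t (Suc i))" using inv[OF t, of "Suc i"] by simp
    obtain v v' where "W t (n + Suc i) = W t n @ v" "W t (Suc i + n) = W t (Suc i) @ v'"
      using pre[of t n "Suc i"] pre[of t "Suc i" n] by auto
    then have "W t n @ v = W t (Suc i) @ v'" by (simp add: add.commute)
    then have "(W t n @ v) ! i = (W t (Suc i) @ v') ! i" by simp
    then have "W t n ! i = W t (Suc i) ! i" using i i2 by (simp add: nth_append)
    then show "seq_word (D t) (length (W t n)) ! i = W t n ! i" using i by (simp add: D_def)
  qed simp
  have DB: "buffered_seq M (D t)" if t: "t \<in> {0..<1}" for t
    unfolding buffered_seq_def
  proof (intro allI)
    fix n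
    let ?w = "W t (Suc (Suc n))"
    have len: "Suc (Suc n) \<le> length ?w" and b: "buffered M ?w" using inv[OF t, of "Suc (Suc n)"] by auto
    have nth: "?w ! i = D t i" if "i < length ?w" for i
      using arg_cong[OF DW[OF t, of "Suc (Suc n)"], of "\<lambda>w. w ! i"] that by simp
    have "?w ! n \<in> set ?w" using len by (intro nth_mem) auto
    then have "1 \<le> ?w ! n" using b by (auto simp: buffered_def)
    moreover have "?w ! n = 1 \<longrightarrow> ?w ! Suc n \<le> M"
      using b len by (auto simp: buffered_def successively_conv_nth)
    ultimately show "1 \<le> D t n \<and> (D t n = 1 \<longrightarrow> D t (Suc n) \<le> M)" using nth[of n] nth[of "Suc n"] len by simp
  qed
  have Dpos: "1 \<le> D t n" if "t \<in> {0..<1}" for t n using DB[OF that] by (rule buffered_seq_ge_1)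
  define g where "g t = cf_inf (D t)" for t
  have gA: "g t \<in> A" if t: "t \<in> {0..<1}" for t
    unfolding g_def using DB[OF t]
  proof (rule A, intro allI)
    fix N
    show "\<exists>n\<ge>N. \<exists>\<mu>. Inv (seq_word (D t) n) \<mu>"
      using inv[OF t, of N] by (intro exI[of _ "length (W t N)"]) (auto simp: DW[OF t])
  qed
  define K' where "K' = K * 4 powr s"
  have K': "0 < K'" using K by (simp add: K'_def)
  \<comment> \<open>The residual parameters lie in the subintervals of the two chosen options, so
    their distance is at most the total weight from \<open>i\<close> to \<open>j\<close>. The factor
    \<open>4 powr s\<close> in \<open>K'\<close> is the distortion of the common word.\<close>
  have split: "\<bar>t - t'\<bar> \<le> K' * \<bar>g t - g t'\<bar> powr s"
    if t: "t \<in> {0..<1}" "t' \<in> {0..<1}" and W: "W t n = W t' n" and U: "U t n = U t' n"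
      and diff: "t - t' = U t n * (T t n - T t' n)"
      and lt: "idx (W t n) (T t n) < idx (W t n) (T t' n)" for t t' n
  proof -
    define w \<mu> i j where "w = W t n" and "\<mu> = U t n" and "i = idx w (T t n)" and "j = idx w (T t' n)"
    have I: "Inv w \<mu>" using inv[OF t(1)] by (simp add: w_def \<mu>_def)
    have posw: "pos_word w" using inv[OF t(1), of n] by (simp add: w_def buffered_def)
    have i: "i < length (opts w)" "c w i \<le> T t n" "T t n < c w (Suc i)"
      using idx[OF I, of "T t n"] inv[OF t(1), of n] by (auto simp: i_def)
    have j: "j < length (opts w)" "c w j \<le> T t' n" "T t' n < c w (Suc j)"
      using idx[OF I, of "T t' n"] inv[OF t(2), of n] by (auto simp: j_def)
    have ij: "i < j" using lt by (simp add: i_def j_def w_def)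
    define e e' where "e = (\<lambda>k. D t (k + length w))" and "e' = (\<lambda>k. D t' (k + length w))"
    have be: "buffered_seq M e" "buffered_seq M e'"
      unfolding e_def e'_def using DB t by (auto intro: buffered_seq_shift)
    have pe: "1 \<le> e k" "1 \<le> e' k" for k
      using buffered_seq_ge_1[OF be(1)] buffered_seq_ge_1[OF be(2)] by blast+
    have "seq_word (D t) (length w + length (opts w ! i)) = w @ opts w ! i"
      using DW[OF t(1), of "Suc n"] by (simp add: WS w_def[symmetric] i_def)
    then have we: "seq_word (D t) (length w) = w" "seq_word e (length (opts w ! i)) = opts w ! i"
      unfolding seq_word_add e_def by (auto simp: append_eq_append_conv)
    have "seq_word (D t') (length w + length (opts w ! j)) = w @ opts w ! j"
      using DW[OF t(2), of "Suc n"] by (simp add: WS W[symmetric] w_def[symmetric] j_def)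
    then have we': "seq_word (D t') (length w) = w" "seq_word e' (length (opts w ! j)) = opts w ! j"
      unfolding seq_word_add e'_def by (auto simp: append_eq_append_conv)
    have geq: "g t = cf_eval w (cf_inf e)" "g t' = cf_eval w (cf_inf e')"
      using cf_inf_append[of "D t" "length w"] cf_inf_append[of "D t'" "length w"] Dpos t
      unfolding we we' by (simp_all add: g_def e_def e'_def)
    have \<mu>0: "0 \<le> \<mu>" using mass[OF I] by simp
    have "(\<Sum>k=i..j. p w k) = c w (Suc j) - c w i"
    proof -
      have "{..<Suc j} = {..<i} \<union> {i..j}" "{..<i} \<inter> {i..j} = {}" using ij by auto
      then show ?thesis by (simp only: c_def sum.union_disjoint finite_lessThan finite_atLeastAtMost add_diff_cancel_left')
    qed
    moreover have "c w (Suc i) \<le> c w j"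
      unfolding c_def using ij j step[OF I] by (intro sum_mono2) (auto intro: less_imp_le)
    ultimately have "\<bar>T t n - T t' n\<bar> \<le> (\<Sum>k=i..j. p w k)" using i j by linarith
    then have "\<bar>t - t'\<bar> \<le> \<mu> * (\<Sum>k=i..j. p w k)"
      unfolding diff \<mu>_def[symmetric] abs_mult using \<mu>0 by (simp add: mult_left_mono)
    also have "\<dots> \<le> K * (\<bar>cf_inf e - cf_inf e'\<bar> / (cf_den w)\<^sup>2) powr s"
      by (rule gap[OF I ij j(1) be we(2) we'(2)])
    also have "\<dots> \<le> K * (4 * \<bar>g t - g t'\<bar>) powr s"
    proof (intro mult_left_mono powr_mono2)
      have "\<bar>cf_inf e - cf_inf e'\<bar> / (4 * (cf_den w)\<^sup>2) \<le> \<bar>g t - g t'\<bar>"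
        unfolding geq using posw pe by (intro abs_cf_eval_diff_ge cf_inf_bounds01) auto
      then show "\<bar>cf_inf e - cf_inf e'\<bar> / (cf_den w)\<^sup>2 \<le> 4 * \<bar>g t - g t'\<bar>" by simp
    qed (use s K in auto)
    also have "\<dots> = K' * \<bar>g t - g t'\<bar> powr s" by (simp add: K'_def powr_mult)
    finally show ?thesis .
  qed
  have exp: "\<bar>t - t'\<bar> \<le> K' * \<bar>g t - g t'\<bar> powr s" if t: "t \<in> {0..<1}" "t' \<in> {0..<1}" for t t'
  proof (rule ccontr)
    assume neg: "\<not> ?thesis"
    \<comment> \<open>If the bound fails, the two parameters never separate. Their distance is then
      at most the mass of arbitrarily long words, which tends to 0.\<close>
    have same: "W t n = W t' n \<and> U t n = U t' n \<and> t - t' = U t n * (T t n - T t' n)" for n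
    proof (induction n)
      case 0
      then show ?case by (simp add: W0)
    next
      case (Suc n)
      let ?i = "idx (W t n) (T t n)" and ?j = "idx (W t n) (T t' n)"
      have "\<not> ?i < ?j" using split[of t t' n] t Suc neg by blast
      moreover have "\<not> ?j < ?i"
      proof
        assume a: "?j < ?i"
        have "t' - t = U t n * (T t' n - T t n)" by (metis Suc minus_diff_eq mult_minus_right)
        then have "\<bar>t' - t\<bar> \<le> K' * \<bar>g t' - g t\<bar> powr s"
          using split[of t' t n] t Suc a by simp
        then show False using neg by (simp add: abs_minus_commute)
      qed
      ultimately have eq: "?i = ?j" by linarith
      have "?i < length (opts (W t n))" using idx(1)[of "W t n" "U t n" "T t n"] inv[OF t(1), of n] by auto
      then have "0 < p (W t n) ?i" using step inv[OF t(1), of n] by blast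
      moreover have "T t (Suc n) - T t' (Suc n) = (T t n - T t' n) / p (W t n) ?i"
        using Suc eq by (simp add: WS diff_divide_distrib)
      ultimately show ?case using Suc eq by (simp add: WS)
    qed
    \<comment> \<open>After \<open>2 * n\<close> choices there are at least \<open>2 * n\<close>
      digits, so the denominator is at least \<open>2 ^ n\<close>.\<close>
    have bound: "\<bar>t - t'\<bar> \<le> K * (2 powr (- 2 * s)) ^ n" for n
    proof -
      let ?w = "W t (2 * n)"
      have w: "2 * n \<le> length ?w" "pos_word ?w" "Inv ?w (U t (2 * n))"
        using inv[OF t(1), of "2 * n"] by (auto simp: buffered_def)
      have T: "\<bar>T t (2 * n) - T t' (2 * n)\<bar> \<le> 1"
        using inv[OF t(1), of "2 * n"] inv[OF t(2), of "2 * n"] by (simp add: abs_le_iff)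
      have U: "0 \<le> U t (2 * n)" "U t (2 * n) \<le> K * cf_den ?w powr (- 2 * s)" using mass[OF w(3)] by auto
      have "\<bar>t - t'\<bar> = U t (2 * n) * \<bar>T t (2 * n) - T t' (2 * n)\<bar>"
        using same[of "2 * n"] U by (simp add: abs_mult)
      also have "\<dots> \<le> U t (2 * n) * 1" using U T by (intro mult_left_mono)
      also have "\<dots> \<le> K * cf_den ?w powr (- 2 * s)" using U by simp
      also have "\<dots> \<le> K * (2 ^ n) powr (- 2 * s)"
      proof (intro mult_left_mono powr_mono2')
        have "(2::real) ^ n \<le> 2 ^ (length ?w div 2)" using w(1) by (intro power_increasing) auto
        also have "\<dots> \<le> cf_den ?w" using w by (intro two_power_le_cf_den)
        finally show "2 ^ n \<le> cf_den ?w" .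
      qed (use s K in auto)
      also have "(2 ^ n) powr (- 2 * s) = (2 powr (- 2 * s)) ^ n"
        by (simp add: powr_power powr_realpow[symmetric] powr_powr mult_ac)
      finally show ?thesis .
    qed
    have "(\<lambda>n. K * (2 powr (- 2 * s)) ^ n) \<longlonglongrightarrow> K * 0"
      using s by (intro tendsto_mult tendsto_const LIMSEQ_realpow_zero) (auto simp: powr_less_one)
    then have "\<bar>t - t'\<bar> \<le> K * 0" using bound by (intro LIMSEQ_le_const) auto
    then show False using neg K' by simp
  qed
  show ?thesis
    by (rule hausdorff_dim_ge_of_expanding[of s K' g]) (use s K' gA exp in \<open>auto simp: dist_real_def\<close>)
qed

text \<open>Here \<open>R\<close> bounds the mass normalised by \<open>q powr (- 2 * s)\<close>.
  Appending \<open>u\<close> enlarges the denominator by a factor at most \<open>2 * c\<close>,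
  hence the normalised bound by \<open>(2 * c) powr (2 * s)\<close>. The mass estimates along the
  trees below all have this form.\<close>

lemma cf_den_powr_append_ge:
  assumes "pos_word w" "pos_word u" "0 \<le> s" "cf_den u \<le> c" "0 \<le> R" "\<mu> \<le> R * cf_den w powr (- 2 * s)"
  shows "\<mu> \<le> R * (2 * c) powr (2 * s) * cf_den (w @ u) powr (- 2 * s)"
proof -
  have u1: "1 \<le> cf_den u" and w1: "1 \<le> cf_den w" using assms cf_denom_ge_1 by auto
  have c: "0 < c" using assms u1 by linarith
  have "cf_den (w @ u) \<le> 2 * (cf_den w * cf_den u)" using assms by (intro cf_den_append_le)
  also have "\<dots> \<le> 2 * (cf_den w * c)" using assms w1 by (intro mult_left_mono) auto
  finally have le: "cf_den (w @ u) \<le> 2 * c * cf_den w" by (simp add: mult_ac)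
  have "0 < cf_den (w @ u)" using assms cf_denom_pos[of "w @ u" 0] by auto
  then have "(2 * c * cf_den w) powr (- 2 * s) \<le> cf_den (w @ u) powr (- 2 * s)"
    using le assms by (intro powr_mono2') auto
  then have "(2 * c) powr (2 * s) * ((2 * c) powr (- 2 * s) * cf_den w powr (- 2 * s)) \<le>
      (2 * c) powr (2 * s) * cf_den (w @ u) powr (- 2 * s)"
    using c w1 by (intro mult_left_mono) (auto simp: powr_mult)
  then have "cf_den w powr (- 2 * s) \<le> (2 * c) powr (2 * s) * cf_den (w @ u) powr (- 2 * s)"
    using c by (simp add: mult.assoc[symmetric] powr_add[symmetric])
  then have "R * cf_den w powr (- 2 * s) \<le> R * ((2 * c) powr (2 * s) * cf_den (w @ u) powr (- 2 * s))"
    using assms by (intro mult_left_mono)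
  then show ?thesis using assms by (simp add: mult.assoc)
qed

lemma inverse_square_powr:
  fixes q s :: real
  assumes "0 < q"
  shows "(1 / q\<^sup>2) powr s = q powr (- 2 * s)"
proof -
  have "1 / q\<^sup>2 = q powr (- 2)"
    using assms by (simp add: powr_minus_divide powr_numeral)
  then show ?thesis by (simp only: powr_powr)
qed

text \<open>Digits \<open>D\<close> apart in the range from \<open>A\<close> to \<open>2 * A\<close>
  give points at distance of order \<open>D / A\<^sup>2\<close>, while carrying weight of order
  \<open>D / A\<close>. As \<open>s \<le> 1\<close>, the ratio \<open>D / A\<close> is at most its
  power \<open>s\<close>, so the worst case is the whole range, and that is where the factor
  \<open>A powr (- s)\<close> in the mass bound comes from.\<close>

lemma big_digit_gap:
  assumes s: "0 < s" "s \<le> 1" and A: "1 \<le> A" and ij: "i < j" "j < A"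
    and d: "buffered_seq M d" "buffered_seq M d'" "d 0 = A + i" "d' 0 = A + j"
    and \<mu>: "0 \<le> \<mu>" "\<mu> \<le> K * q powr (- 2 * s) * real A powr (- s)" and q: "0 < q" and K: "0 \<le> K"
  shows "\<mu> * (\<Sum>k=i..j. 1 / real A) \<le> 2 * (4 * (real M + 2)) powr s * K * (\<bar>cf_inf d - cf_inf d'\<bar> / q\<^sup>2) powr s"
proof -
  define D where "D = real j - real i"
  have D: "1 \<le> D" "D \<le> real A" using ij by (auto simp: D_def)
  have A0: "0 < real A" using A by simp
  have "D / ((real M + 2) * (2 * real A)\<^sup>2) \<le> \<bar>cf_inf d - cf_inf d'\<bar>"
  proof -
    have "real (2 * A - 1) + 1 = 2 * real A" using A by (simp add: of_nat_diff)
    then show ?thesis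
      using cf_inf_gap_digit[OF d(1,2), of "2 * A - 1"] d(3,4) ij by (simp add: D_def)
  qed
  then have "D / ((real M + 2) * (2 * real A)\<^sup>2) / q\<^sup>2 \<le> \<bar>cf_inf d - cf_inf d'\<bar> / q\<^sup>2"
    by (intro divide_right_mono) auto
  then have "(D / ((real M + 2) * (2 * real A)\<^sup>2) / q\<^sup>2) powr s \<le> (\<bar>cf_inf d - cf_inf d'\<bar> / q\<^sup>2) powr s"
    using s D by (intro powr_mono2) auto
  moreover have "(4 * (real M + 2)) powr s * (D / ((real M + 2) * (2 * real A)\<^sup>2) / q\<^sup>2) powr s =
      (D / real A) powr s * (real A powr (- s) * q powr (- 2 * s))"
  proof -
    have "(4 * (real M + 2)) * (D / ((real M + 2) * (2 * real A)\<^sup>2) / q\<^sup>2) = (D / real A) * ((1 / real A) * (1 / q\<^sup>2))"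
    proof -
      have "(4 * G) * (D / (G * (2 * a)\<^sup>2) / q\<^sup>2) = (D / a) * ((1 / a) * (1 / q\<^sup>2))"
        if "G \<noteq> 0" "a \<noteq> 0" for G a :: real
        using that by (simp add: field_simps power2_eq_square)
      then show ?thesis by this (use A0 in auto)
    qed
    moreover have "(1 / q\<^sup>2) powr s = q powr (- 2 * s)"
      using q by (rule inverse_square_powr)
    moreover have "(1 / real A) powr s = real A powr (- s)"
      by (simp add: powr_divide powr_minus inverse_eq_divide)
    ultimately show ?thesis by (metis powr_mult)
  qed
  ultimately have 1: "(D / real A) powr s * (real A powr (- s) * q powr (- 2 * s)) \<le>
      (4 * (real M + 2)) powr s * (\<bar>cf_inf d - cf_inf d'\<bar> / q\<^sup>2) powr s"
    by (metis mult_left_mono powr_ge_zero)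
  have "D / real A \<le> (D / real A) powr s"
    using powr_mono'[of s 1 "D / real A"] D A0 s by simp
  have "\<mu> * (\<Sum>k=i..j. 1 / real A) = \<mu> * ((D + 1) / real A)"
    using ij by (simp add: D_def of_nat_diff)
  also have "\<dots> \<le> \<mu> * (2 * (D / real A))"
    using \<mu> D A0 by (intro mult_left_mono) (auto simp: field_simps)
  also have "\<dots> \<le> (K * q powr (- 2 * s) * real A powr (- s)) * (2 * (D / real A) powr s)"
    using \<mu> D A0 \<open>D / real A \<le> _\<close> K by (intro mult_mono) auto
  also have "\<dots> = 2 * K * ((D / real A) powr s * (real A powr (- s) * q powr (- 2 * s)))" by simp
  also have "\<dots> \<le> 2 * K * ((4 * (real M + 2)) powr s * (\<bar>cf_inf d - cf_inf d'\<bar> / q\<^sup>2) powr s)"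
    using 1 K by (intro mult_left_mono) auto
  finally show ?thesis by (simp add: mult_ac)
qed

section \<open>Trees whose digits grow doubly exponentially\<close>

lemma bounded_above_linear_minus_exponential:
  fixes c \<kappa> a :: real
  assumes c: "1 < c" and \<kappa>: "0 < \<kappa>"
  shows "\<forall>\<^sub>F n in sequentially. a * real n - \<kappa> * c ^ n < 0"
proof -
  have "(\<lambda>n. a * (real n * (1 / c) ^ n)) \<longlonglongrightarrow> a * 0"
    using c by (intro tendsto_mult tendsto_const powser_times_n_limit_0) auto
  then have "\<forall>\<^sub>F n in sequentially. a * (real n * (1 / c) ^ n) < \<kappa>"
    using \<kappa> by (intro order_tendstoD(2)) auto
  then show ?thesis
  proof eventually_elim
    case (elim n)
    then have "a * (real n * (1 / c) ^ n) * c ^ n < \<kappa> * c ^ n"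
      using c by (intro mult_strict_right_mono) auto
    then show ?case using c by (simp add: power_divide)
  qed
qed

lemma eventually_le_imp_bounded:
  fixes f :: "nat \<Rightarrow> real"
  assumes "\<forall>\<^sub>F n in sequentially. f n \<le> C"
  shows "\<exists>K. \<forall>n. f n \<le> K"
proof -
  obtain N where N: "\<And>n. n \<ge> N \<Longrightarrow> f n \<le> C" using assms by (auto simp: eventually_sequentially)
  show ?thesis
  proof (intro exI allI)
    fix n
    show "f n \<le> max C (Max (f ` {..N}))"
    proof (cases "n \<ge> N")
      case True
      then show ?thesis using N by (simp add: le_max_iff_disj)
    next
      case False
      then have "f n \<le> Max (f ` {..N})" by (intro Max_ge) auto
      then show ?thesis by simp
    qed
  qed
qed

lemma nat_ceiling_bounds:
  assumes "1 \<le> (x::real)"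
  shows "x \<le> real (nat \<lceil>x\<rceil>)" "real (nat \<lceil>x\<rceil>) \<le> 2 * x" "1 < x \<Longrightarrow> 2 \<le> nat \<lceil>x\<rceil>"
proof -
  have "0 \<le> \<lceil>x\<rceil>" using assms by linarith
  then have "real (nat \<lceil>x\<rceil>) = of_int \<lceil>x\<rceil>" by simp
  then show "x \<le> real (nat \<lceil>x\<rceil>)" "real (nat \<lceil>x\<rceil>) \<le> 2 * x" using assms by linarith+
  show "2 \<le> nat \<lceil>x\<rceil>" if "1 < x" using that by linarith
qed

text \<open>The normalised mass \<open>R n\<close> is a product of powers with the negative exponent
  \<open>2 * s - 1\<close>, so it decays like \<open>exp (- (1 - 2 * s) * c ^ n / (c - 1))\<close>
  up to geometric factors. It has to beat \<open>exp (- s * c ^ n)\<close>, and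
  \<open>(1 - 2 * s) / (c - 1) > s\<close> is a rearrangement of
  \<open>s * (1 + c) < 1\<close>.\<close>

lemma hausdorff_dim_ge_of_growing_digits:
  fixes c s :: real
  assumes c: "1 < c" and s: "0 < s" "s * (1 + c) < 1"
    and E: "\<And>d. (\<And>n. exp (c ^ n) \<le> real (d n)) \<Longrightarrow> (\<And>n. 1 \<le> d n) \<Longrightarrow> cf_inf d \<in> E"
  shows "ennreal s \<le> hausdorff_dim E"
proof -
  define A where "A n = nat \<lceil>exp (c ^ n)\<rceil>" for n
  have A: "exp (c ^ n) \<le> real (A n)" "real (A n) \<le> 2 * exp (c ^ n)" "2 \<le> A n" for n
    using nat_ceiling_bounds[of "exp (c ^ n)"] c by (auto simp: A_def)
  have A0: "0 < real (A n)" for n using A(3)[of n] by linarith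
  have "s * 1 < s * c" using s c by (intro mult_strict_left_mono) auto
  moreover have "s * (1 + c) = s + s * c" by (simp add: algebra_simps)
  ultimately have s2: "2 * s < 1" using s by linarith
  then have s1: "s \<le> 1" by simp
  \<comment> \<open>One uniform digit below \<open>2 * A\<close> changes the normalised mass by
    \<open>(4 * A) powr (2 * s) / A\<close>, which is the factor here.\<close>
  define R where "R n = (\<Prod>k<n. 16 powr s * real (A k) powr (2 * s - 1))" for n
  have R0: "0 < R n" for n unfolding R_def using A0 by (intro prod_pos) auto
  have RS: "R (Suc n) = R n * (16 powr s * real (A n) powr (2 * s - 1))" for n by (simp add: R_def)
  define \<kappa> where "\<kappa> = (1 - 2 * s) / (c - 1) - s"
  have \<kappa>: "0 < \<kappa>"
  proof -
    have "s * (c - 1) < 1 - 2 * s" using s by (simp add: algebra_simps)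
    then show ?thesis using c by (simp add: \<kappa>_def field_simps)
  qed
  have Rle: "R n \<le> exp (s * ln 16 * real n - (1 - 2 * s) * ((c ^ n - 1) / (c - 1)))" for n
  proof (induction n)
    case (Suc n)
    have "real (A n) powr (2 * s - 1) \<le> exp (c ^ n) powr (2 * s - 1)"
      using A(1)[of n] s2 by (intro powr_mono2') auto
    then have "R (Suc n) \<le> exp (s * ln 16 * real n - (1 - 2 * s) * ((c ^ n - 1) / (c - 1))) *
        (16 powr s * exp (c ^ n) powr (2 * s - 1))"
      unfolding RS using Suc R0[of n] by (intro mult_mono) auto
    also have "\<dots> = exp (s * ln 16 * real n - (1 - 2 * s) * ((c ^ n - 1) / (c - 1)) + (s * ln 16 + (2 * s - 1) * c ^ n))"
      by (simp add: powr_def exp_add mult_ac)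
    also have "s * ln 16 * real n - (1 - 2 * s) * ((c ^ n - 1) / (c - 1)) + (s * ln 16 + (2 * s - 1) * c ^ n) =
        s * ln 16 * real (Suc n) - (1 - 2 * s) * ((c ^ n - 1) / (c - 1) + c ^ n)"
      by (simp add: algebra_simps)
    also have "(c ^ n - 1) / (c - 1) + c ^ n = (c ^ Suc n - 1) / (c - 1)"
      using c by (simp add: field_simps)
    finally show ?case .
  qed (simp add: R_def)
  have "\<exists>K. \<forall>n. R n * real (A n) powr s \<le> K"
  proof (rule eventually_le_imp_bounded)
    show "\<forall>\<^sub>F n in sequentially. R n * real (A n) powr s \<le> exp ((1 - 2 * s) / (c - 1) + s * ln 2)"
      using bounded_above_linear_minus_exponential[OF c \<kappa>, of "s * ln 16"]
    proof eventually_elim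
      case (elim n)
      have "real (A n) powr s \<le> (2 * exp (c ^ n)) powr s" using A(2)[of n] s by (intro powr_mono2) auto
      then have "R n * real (A n) powr s \<le>
          exp (s * ln 16 * real n - (1 - 2 * s) * ((c ^ n - 1) / (c - 1))) * (2 * exp (c ^ n)) powr s"
        using R0[of n] Rle[of n] by (intro mult_mono) auto
      also have "\<dots> = exp (s * ln 16 * real n - (1 - 2 * s) * ((c ^ n - 1) / (c - 1)) + (s * ln 2 + s * c ^ n))"
        by (simp add: powr_def exp_add ln_mult ring_distribs)
      also have "s * ln 16 * real n - (1 - 2 * s) * ((c ^ n - 1) / (c - 1)) + (s * ln 2 + s * c ^ n) =
          (s * ln 16 * real n - \<kappa> * c ^ n) + ((1 - 2 * s) / (c - 1) + s * ln 2)"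
      proof -
        define e where "e = (1 - 2 * s) / (c - 1)"
        have "(1 - 2 * s) * ((c ^ n - 1) / (c - 1)) = e * (c ^ n - 1)" by (simp add: e_def)
        then show ?thesis unfolding \<kappa>_def e_def[symmetric] by (simp add: algebra_simps)
      qed
      also have "exp \<dots> \<le> exp ((1 - 2 * s) / (c - 1) + s * ln 2)" using elim by simp
      finally show ?case .
    qed
  qed
  then obtain K where K: "\<And>n. R n * real (A n) powr s \<le> K" by blast
  have RK: "R n \<le> K" for n
  proof -
    have "1 \<le> real (A n) powr s" using A(3)[of n] s by (intro ge_one_powr_ge_zero) auto
    then have "R n * 1 \<le> R n * real (A n) powr s" using R0[of n] by (intro mult_left_mono) auto
    then show ?thesis using K[of n] by simp
  qed
  have K0: "0 < K" using RK[of 0] R0[of 0] by linarith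
  define K' where "K' = 2 * (4 * (real 0 + 2)) powr s * K"
  have K': "K \<le> K'" "0 < K'"
  proof -
    have "1 * K \<le> (2 * 8 powr s) * K"
      using K0 s ge_one_powr_ge_zero[of 8 s] by (intro mult_right_mono) auto
    then show "K \<le> K'" by (simp add: K'_def)
    then show "0 < K'" using K0 by simp
  qed
  define opts where "opts w = map (\<lambda>a. [a]) [A (length w)..<2 * A (length w)]" for w :: "nat list"
  define Inv where "Inv w \<mu> \<longleftrightarrow> 0 \<le> \<mu> \<and> pos_word w \<and> (\<forall>k<length w. A k \<le> w ! k) \<and>
      \<mu> \<le> R (length w) * cf_den w powr (- 2 * s)" for w \<mu>
  have len: "length (opts w) = A (length w)" for w by (simp add: opts_def)
  have nth: "opts w ! i = [A (length w) + i]" if "i < A (length w)" for w i using that by (simp add: opts_def)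
  show ?thesis
  \<comment> \<open>With \<open>M = 0\<close> the buffering condition just excludes the digit 1; all
    digits in this tree are at least 2.\<close>
  proof (rule hausdorff_dim_ge_of_tree[where K = K' and Inv = Inv and opts = opts and M = 0
      and p = "\<lambda>w i. 1 / real (A (length w))"])
    show "0 < s" "0 < K'" by (fact s(1), fact K'(2))
    show "Inv [] 1" by (simp add: Inv_def R_def)
    show "(\<Sum>i<length (opts w). 1 / real (A (length w))) = 1" for w using A0[of "length w"] by (simp add: len)
    show "0 \<le> \<mu> \<and> \<mu> \<le> K' * cf_den w powr (- 2 * s)" if "Inv w \<mu>" for w \<mu>
    proof -
      have "R (length w) * cf_den w powr (- 2 * s) \<le> K' * cf_den w powr (- 2 * s)"
        using RK[of "length w"] K' by (intro mult_right_mono) auto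
      then show ?thesis using that by (simp add: Inv_def)
    qed
    show "0 < 1 / real (A (length w)) \<and> opts w ! i \<noteq> [] \<and> buffered 0 (opts w ! i) \<and>
        Inv (w @ opts w ! i) (\<mu> * (1 / real (A (length w))))"
      if I: "Inv w \<mu>" and i: "i < length (opts w)" for w \<mu> i
    proof -
      let ?n = "length w" and ?a = "A (length w) + i"
      have o: "opts w ! i = [?a]" and ia: "i < A ?n" using i nth by (auto simp: len)
      have "\<mu> * (1 / real (A ?n)) \<le> R ?n / real (A ?n) * cf_den w powr (- 2 * s)"
        using I A0[of ?n] by (auto simp: Inv_def divide_right_mono)
      then have "\<mu> * (1 / real (A ?n)) \<le> R ?n / real (A ?n) * (2 * (2 * real (A ?n))) powr (2 * s) * cf_den (w @ [?a]) powr (- 2 * s)"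
        using I R0[of ?n] s ia A(3)[of ?n] by (intro cf_den_powr_append_ge) (auto simp: Inv_def)
      also have "R ?n / real (A ?n) * (2 * (2 * real (A ?n))) powr (2 * s) = R (Suc ?n)"
      proof -
        have "(2 * (2 * real (A ?n))) powr (2 * s) = 4 powr (2 * s) * real (A ?n) powr (2 * s)"
          by (simp add: powr_mult[symmetric])
        moreover have "4 powr (2 * s) = 16 powr s" using powr_powr[of 4 2 s] by simp
        moreover have "real (A ?n) powr (2 * s - 1) = real (A ?n) powr (2 * s) / real (A ?n)"
          using A0[of ?n] by (simp add: powr_diff)
        ultimately show ?thesis by (simp add: RS)
      qed
      finally have "Inv (w @ [?a]) (\<mu> * (1 / real (A ?n)))"
        using I A(3)[of ?n] by (auto simp: Inv_def nth_append less_Suc_eq)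
      then show ?thesis using A0[of ?n] A(3)[of ?n] unfolding o by (auto simp: buffered_def)
    qed
    show "\<mu> * (\<Sum>k=i..j. 1 / real (A (length w))) \<le> K' * (\<bar>cf_inf d - cf_inf d'\<bar> / (cf_den w)\<^sup>2) powr s"
      if I: "Inv w \<mu>" and ij: "i < j" "j < length (opts w)" and d: "buffered_seq 0 d" "buffered_seq 0 d'"
        "seq_word d (length (opts w ! i)) = opts w ! i" "seq_word d' (length (opts w ! j)) = opts w ! j"
      for w \<mu> i j d d'
      unfolding K'_def
    proof (rule big_digit_gap)
      let ?n = "length w"
      have jA: "j < A ?n" using ij by (simp add: len)
      show "d 0 = A ?n + i" "d' 0 = A ?n + j"
        using d(3,4) ij jA nth[of i w] nth[of j w] by auto
      show "0 < cf_den w" using I cf_denom_pos[of w 0] by (auto simp: Inv_def)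
      have "R ?n \<le> K * real (A ?n) powr (- s)"
        using K[of ?n] A0[of ?n] by (simp add: powr_minus field_simps)
      then have "R ?n * cf_den w powr (- 2 * s) \<le> (K * real (A ?n) powr (- s)) * cf_den w powr (- 2 * s)"
        by (intro mult_right_mono) auto
      then show "\<mu> \<le> K * cf_den w powr (- 2 * s) * real (A ?n) powr (- s)"
        using I by (simp add: Inv_def mult_ac)
      show "j < A ?n" by (fact jA)
      show "1 \<le> A ?n" using A(3)[of ?n] by linarith
    qed (use I ij d s s1 K0 in \<open>auto simp: Inv_def\<close>)
    show "cf_inf d \<in> E" if d: "buffered_seq 0 d" and I: "\<forall>N. \<exists>n\<ge>N. \<exists>\<mu>. Inv (seq_word d n) \<mu>" for d
    proof (rule E)
      fix n
      obtain m \<mu> where "m \<ge> Suc n" "Inv (seq_word d m) \<mu>" using I by blast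
      then have "A n \<le> d n" by (auto simp: Inv_def)
      then show "exp (c ^ n) \<le> real (d n)" using A(1)[of n] by linarith
      show "1 \<le> d n" using d by (rule buffered_seq_ge_1)
    qed
  qed
qed

text \<open>The large digits are the last \<open>r\<close> before position \<open>n\<close>, that
  is, the partial quotients of indices \<open>n - r + 1\<close> to \<open>n\<close>. The index
  counted in \<open>F_set\<close> is not \<open>n\<close> but a place \<open>m \<ge> n\<close> where
  the tail minimum is attained, since only there is \<open>\<psi>\<close> known to be as small as
  \<open>tail_min \<psi> n\<close>.\<close>

lemma cf_inf_in_F_set:
  assumes d: "\<And>n. 1 \<le> d n" and r: "1 \<le> r" and min: "has_tail_minima \<psi>"
    and big: "\<And>N. \<exists>n\<ge>N. r \<le> n \<and> (\<forall>j. n \<le> j + r \<longrightarrow> j < n \<longrightarrow> tail_min \<psi> n \<le> real (d j))"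
  shows "cf_inf d \<in> F_set r \<psi>"
proof -
  let ?S = "{n. 1 \<le> n \<and> (\<exists>k :: nat \<Rightarrow> nat. strict_mono_on {1..r} k \<and>
          (\<forall>i\<in>{1..r}. 1 \<le> k i \<and> k i \<le> n \<and>
             pq_defined (k i) (cf_inf d) \<and> \<psi> n \<le> of_int (partial_quotient (k i) (cf_inf d))))}"
  have "\<exists>m\<ge>N. m \<in> ?S" for N
  proof -
    obtain n where n: "n \<ge> N" "r \<le> n" "\<And>j. n \<le> j + r \<Longrightarrow> j < n \<Longrightarrow> tail_min \<psi> n \<le> real (d j)"
      using big by blast
    obtain m where m: "m \<ge> n" "\<And>k. k \<ge> n \<Longrightarrow> \<psi> m \<le> \<psi> k"
      using min n(2) r unfolding has_tail_minima_def by (meson order_trans)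
    have tm: "tail_min \<psi> n = \<psi> m" using m by (rule tail_min_eq)
    have "m \<in> ?S"
    proof (intro CollectI conjI exI[of _ "\<lambda>i. n - r + i"] ballI)
      show "1 \<le> m" using m n r by linarith
      show "strict_mono_on {1..r} (\<lambda>i. n - r + i)" by (auto simp: strict_mono_on_def)
      fix i assume i: "i \<in> {1..r}"
      define j where "j = n - r + i - 1"
      have j: "n - r + i = Suc j" "j < n" "n \<le> j + r" using i n r by (auto simp: j_def)
      show "1 \<le> n - r + i" "n - r + i \<le> m" using i n m by auto
      show "pq_defined (n - r + i) (cf_inf d)" unfolding j(1) using d by (rule partial_quotient_cf_inf)
      show "\<psi> m \<le> of_int (partial_quotient (n - r + i) (cf_inf d))"
        unfolding j(1) partial_quotient_cf_inf(2)[OF d] using n(3)[OF j(3,2)] tm by simp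
    qed
    then show ?thesis using m n by (meson order_trans)
  qed
  then have "infinite ?S" by (simp add: infinite_nat_iff_unbounded_le)
  then show ?thesis using cf_inf_bounds01(1)[OF d] cf_inf_less_1[OF d] unfolding F_set_def by simp
qed

section \<open>Large digits of exponential size\<close>

text \<open>A finite part of the partition function already grows faster than
  \<open>exp (\<tau> * L)\<close>. The spare factor \<open>4 powr s\<close> pays for concatenating
  one block, and the closing digit 2 makes the blocks buffered.\<close>

lemma finite_words_of_pressure:
  assumes s: "1 / 2 < s" and \<tau>: "\<tau> < cf_pressure s"
  shows "\<exists>xs L. 1 \<le> L \<and> distinct xs \<and> (\<forall>u\<in>set xs. length u = L \<and> pos_word u \<and> last u = 2) \<and>
    exp (\<tau> * real L) * 4 powr s < (\<Sum>u\<in>set xs. cf_den u powr (- 2 * s))"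
proof -
  define \<tau>' where "\<tau>' = (\<tau> + cf_pressure s) / 2"
  have \<tau>': "\<tau> < \<tau>'" "\<tau>' < cf_pressure s" using \<tau> by (auto simp: \<tau>'_def)
  have "\<forall>\<^sub>F n in sequentially. \<tau>' < log_cf_sum s n / real n"
    by (rule order_tendstoD(1)[OF cf_pressure_tendsto[OF s] \<tau>'(2)])
  then obtain N where N: "\<And>n. n \<ge> N \<Longrightarrow> \<tau>' < log_cf_sum s n / real n"
    by (auto simp: eventually_sequentially)
  \<comment> \<open>The surplus \<open>(\<tau>' - \<tau>) * m\<close> must cover the extra digit and
    \<open>s * ln 64\<close>, where 64 is the product of 16, the cost of appending 2, and of the
    spare 4.\<close>
  obtain m0 :: nat where m0: "(\<tau> + s * ln 64) / (\<tau>' - \<tau>) < real m0" using reals_Archimedean2 by blast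
  define m where "m = max (max 1 N) m0"
  have m: "1 \<le> m" "N \<le> m" "m0 \<le> m" by (auto simp: m_def)
  have "\<tau> + s * ln 64 < (\<tau>' - \<tau>) * real m0" using m0 \<tau>' by (simp add: field_simps)
  also have "\<dots> \<le> (\<tau>' - \<tau>) * real m" using m \<tau>' by (intro mult_left_mono) auto
  finally have "\<tau> * real (Suc m) + s * ln 64 < \<tau>' * real m" by (simp add: algebra_simps)
  also have "\<dots> < log_cf_sum s m" using N[OF m(2)] m by (simp add: field_simps)
  finally have "ennreal (exp (\<tau> * real (Suc m) + s * ln 64)) < cf_sum s m"
    unfolding exp_log_cf_sum[OF s] by (simp add: ennreal_less_iff)
  then obtain F where F: "finite F" "F \<subseteq> cf_words m"
    "ennreal (exp (\<tau> * real (Suc m) + s * ln 64)) < (\<Sum>w\<in>F. ennreal (cf_den w powr (- 2 * s)))"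
    unfolding cf_sum_def infsum_ennreal_eq_SUP less_SUP_iff by blast
  then have sumF: "exp (\<tau> * real (Suc m) + s * ln 64) < (\<Sum>w\<in>F. cf_den w powr (- 2 * s))"
    by (simp add: sum_ennreal ennreal_less_iff)
  have "finite ((\<lambda>w. w @ [2]) ` F)" using F by simp
  then obtain xs where xs: "set xs = (\<lambda>w. w @ [2]) ` F" "distinct xs" using finite_distinct_list by blast
  have "exp (\<tau> * real (Suc m)) * 4 powr s < (\<Sum>u\<in>set xs. cf_den u powr (- 2 * s))"
  proof -
    have "(\<Sum>u\<in>set xs. cf_den u powr (- 2 * s)) = (\<Sum>w\<in>F. cf_den (w @ [2]) powr (- 2 * s))"
      unfolding xs by (subst sum.reindex) (auto simp: inj_on_def)
    also have "\<dots> \<ge> (\<Sum>w\<in>F. cf_den w powr (- 2 * s) / 16 powr s)"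
    proof (rule sum_mono)
      fix w assume "w \<in> F"
      then have w: "pos_word w" using F by auto
      have "cf_den w powr (- 2 * s) \<le> 1 * (2 * 2) powr (2 * s) * cf_den (w @ [2]) powr (- 2 * s)"
        using w s by (intro cf_den_powr_append_ge) auto
      also have "(2 * 2) powr (2 * s) = 16 powr s" using powr_powr[of 4 2 s] by simp
      finally show "cf_den w powr (- 2 * s) / 16 powr s \<le> cf_den (w @ [2]) powr (- 2 * s)"
        by (simp add: field_simps)
    qed
    finally have "(\<Sum>w\<in>F. cf_den w powr (- 2 * s)) / 16 powr s \<le> (\<Sum>u\<in>set xs. cf_den u powr (- 2 * s))"
      by (simp add: sum_divide_distrib)
    moreover have "exp (\<tau> * real (Suc m) + s * ln 64) / 16 powr s = exp (\<tau> * real (Suc m)) * 4 powr s"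
    proof -
      have "exp (s * ln 64) = (4 * 16) powr s" by (simp add: powr_def)
      also have "\<dots> = 4 powr s * 16 powr s" by (rule powr_mult)
      finally have "exp (s * ln 64) = 4 powr s * 16 powr s" .
      then show ?thesis unfolding exp_add by simp
    qed
    moreover have "exp (\<tau> * real (Suc m) + s * ln 64) / 16 powr s < (\<Sum>w\<in>F. cf_den w powr (- 2 * s)) / 16 powr s"
      using sumF by (intro divide_strict_right_mono) auto
    ultimately show ?thesis by linarith
  qed
  moreover have "\<forall>u\<in>set xs. length u = Suc m \<and> pos_word u \<and> last u = 2"
    unfolding xs using F by force
  ultimately show ?thesis using xs(2) by (intro exI[of _ xs] exI[of _ "Suc m"]) simp
qed

lemma sparse_sequence:
  assumes "infinite (S :: nat set)" and "\<And>a. \<forall>\<^sub>F b in sequentially. C a b"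
  shows "\<exists>\<nu>. \<nu> 0 = 0 \<and> (\<forall>k. \<nu> (Suc k) \<in> S \<and> \<nu> k < \<nu> (Suc k) \<and> C (\<nu> k) (\<nu> (Suc k)))"
proof -
  have ex: "\<exists>b. b \<in> S \<and> a < b \<and> C a b" for a
  proof -
    obtain N where N: "\<And>b. b \<ge> N \<Longrightarrow> C a b" using assms(2)[of a] by (auto simp: eventually_sequentially)
    obtain b where "b \<in> S" "b > max N a" using assms(1) unfolding infinite_nat_iff_unbounded by blast
    then show ?thesis using N[of b] by (intro exI[of _ b]) auto
  qed
  define f where "f a = (SOME b. b \<in> S \<and> a < b \<and> C a b)" for a
  have f: "f a \<in> S \<and> a < f a \<and> C a (f a)" for a unfolding f_def by (rule someI_ex[OF ex])
  show ?thesis using f by (intro exI[of _ "\<lambda>k. (f ^^ k) 0"]) auto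
qed

text \<open>The target times are so sparse that everything before the preceding target is
  negligible. Between targets the free blocks reduce the normalised mass at rate
  \<open>\<tau>\<close>, and since \<open>\<tau> > g * ln \<beta>\<close> the reduction exceeds
  \<open>A powr g\<close>, the demand of \<open>r\<close> large digits.\<close>

lemma hausdorff_dim_F_set_ge_of_pressure:
  fixes s \<beta> :: real
  assumes s: "1 / 2 < s" "s < 1" and r: "1 \<le> r" and \<beta>: "1 < \<beta>"
    and P: "(s + (2 * s - 1) * (real r - 1)) * ln \<beta> < cf_pressure s"
    and min: "has_tail_minima \<psi>"
    and inf: "infinite {n. tail_min \<psi> n \<le> \<beta> ^ n}"
  shows "ennreal s \<le> hausdorff_dim (F_set r \<psi>)"
proof -
  define g where "g = s + (2 * s - 1) * (real r - 1)"
  have g0: "0 < g" unfolding g_def using s r by (intro add_pos_nonneg mult_nonneg_nonneg) auto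
  define \<tau> where "\<tau> = (g * ln \<beta> + cf_pressure s) / 2"
  have \<tau>: "g * ln \<beta> < \<tau>" "\<tau> < cf_pressure s" using P unfolding g_def[symmetric] by (auto simp: \<tau>_def)
  have "0 < g * ln \<beta>" using g0 \<beta> by simp
  then have \<tau>0: "0 < \<tau>" using \<tau> by linarith
  obtain xs L where L: "1 \<le> L" and xs: "distinct xs" "\<And>u. u \<in> set xs \<Longrightarrow> length u = L \<and> pos_word u \<and> last u = 2"
    and Z: "exp (\<tau> * real L) * 4 powr s < (\<Sum>u\<in>set xs. cf_den u powr (- 2 * s))"
    using finite_words_of_pressure[OF s(1) \<tau>(2)] by blast
  define Z where "Z = (\<Sum>u\<in>set xs. cf_den u powr (- 2 * s))"
  have Z0: "0 < Z" "exp (\<tau> * real L) * 4 powr s < Z"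
    using Z less_trans[of 0 "exp (\<tau> * real L) * 4 powr s" Z] by (auto simp: Z_def)
  define N where "N = Max (insert 2 (\<Union>u\<in>set xs. set u))"
  have N: "2 \<le> N" "\<And>u a. u \<in> set xs \<Longrightarrow> a \<in> set u \<Longrightarrow> a \<le> N" unfolding N_def by (auto intro!: Max_ge)
  define A where "A b = nat \<lceil>\<beta> ^ b\<rceil>" for b
  have A: "\<beta> ^ b \<le> real (A b)" "real (A b) \<le> 2 * \<beta> ^ b" "1 \<le> b \<Longrightarrow> 2 \<le> A b" for b
  proof -
    have "1 \<le> \<beta> ^ b" using \<beta> by (simp add: one_le_power)
    then show "\<beta> ^ b \<le> real (A b)" "real (A b) \<le> 2 * \<beta> ^ b" unfolding A_def by (rule nat_ceiling_bounds)+
    show "2 \<le> A b" if "1 \<le> b" unfolding A_def using that \<beta> by (intro nat_ceiling_bounds) (auto simp: one_less_power)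
  qed
  \<comment> \<open>\<open>R a b n\<close> bounds the mass times \<open>q powr (2 * s)\<close> at position \<open>n\<close> between consecutive targets \<open>a < b\<close>: free
    blocks lower it by \<open>exp (- \<tau>)\<close> per digit, while \<open>E\<close> pays for a single digit filling up the space too short for
    another block. Its natural subtractions count fillers and large digits.\<close>
  define E where "E = exp \<tau> * 16 powr s"
  have E: "1 \<le> E"
  proof -
    have "1 * 1 \<le> E" unfolding E_def using \<tau>0 s by (intro mult_mono ge_one_powr_ge_zero) auto
    then show ?thesis by simp
  qed
  \<comment> \<open>The value of the bound \<open>R\<close> at position \<open>b - r\<close>, just
    before the first large digit.\<close>
  define X where "X a b = exp (- \<tau> * (real b - real r - real a)) * E ^ L" for a b
  define C where "C a b \<longleftrightarrow> a + r < b \<and> X a b * (16 powr s) ^ r * real (A b) powr g \<le> 1" for a b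
  have evC: "\<forall>\<^sub>F b in sequentially. C a b" for a
  proof -
    define c where "c = \<tau> * (real r + real a) + real L * ln E + real r * (s * ln 16) + g * ln 2"
    obtain n0 :: nat where n0: "c / (\<tau> - g * ln \<beta>) < real n0" using reals_Archimedean2 by blast
    show ?thesis
    proof (rule eventually_sequentiallyI)
      fix b assume b: "max n0 (a + r + 1) \<le> b"
      have "c < (\<tau> - g * ln \<beta>) * real n0" using n0 \<tau> by (simp add: field_simps)
      also have "\<dots> \<le> (\<tau> - g * ln \<beta>) * real b" using b \<tau> by (intro mult_left_mono) auto
      finally have c: "c \<le> (\<tau> - g * ln \<beta>) * real b" by simp
      have "X a b * (16 powr s) ^ r * real (A b) powr g \<le> X a b * (16 powr s) ^ r * (2 * \<beta> ^ b) powr g"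
        using A(2)[of b] g0 E by (intro mult_left_mono powr_mono2) (auto simp: X_def)
      also have "\<dots> = exp (c - (\<tau> - g * ln \<beta>) * real b)"
      proof -
        have "(2 * \<beta> ^ b) powr g = exp (g * ln 2 + g * (real b * ln \<beta>))"
          using \<beta> by (simp add: powr_def ln_mult ln_realpow ring_distribs)
        moreover have "E ^ L = exp (real L * ln E)" using E by (simp add: exp_of_nat_mult)
        moreover have "(16 powr s) ^ r = exp (real r * (s * ln 16))" by (simp add: exp_of_nat_mult powr_def)
        moreover have "c - (\<tau> - g * ln \<beta>) * real b = - \<tau> * (real b - real r - real a) + real L * ln E +
            real r * (s * ln 16) + (g * ln 2 + g * (real b * ln \<beta>))"
          by (simp add: c_def algebra_simps)
        ultimately show ?thesis by (simp only: X_def exp_add)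
      qed
      also have "\<dots> \<le> 1" using c by simp
      finally show "C a b" using b by (simp add: C_def)
    qed
  qed
  from sparse_sequence[of _ C, OF inf evC] obtain \<nu> where \<nu>0: "\<nu> 0 = 0"
    and \<nu>: "\<And>k. tail_min \<psi> (\<nu> (Suc k)) \<le> \<beta> ^ \<nu> (Suc k)" "\<And>k. \<nu> k < \<nu> (Suc k)" "\<And>k. C (\<nu> k) (\<nu> (Suc k))"
    by auto
  have mono: "strict_mono \<nu>" using \<nu>(2) by (simp add: strict_mono_Suc_iff)
  define stage where "stage n = (LEAST k. n < \<nu> (Suc k))" for n
  have stage_eq: "stage n = k" if "\<nu> k \<le> n" "n < \<nu> (Suc k)" for n k
    unfolding stage_def
  proof (rule Least_equality)
    fix j assume "n < \<nu> (Suc j)"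
    then have "\<nu> k < \<nu> (Suc j)" using that by linarith
    then show "k \<le> j" using mono by (simp add: strict_mono_less)
  qed (use that in auto)
  define tgt where "tgt n = \<nu> (Suc (stage n))" for n
  define R where "R a b n = (if n + r \<le> b then exp (- \<tau> * (real n - real a)) * E ^ (n + L + r - b)
      else X a b * (16 powr s * real (A b) powr (2 * s - 1)) ^ (n + r - b))" for a b n
  have R0: "0 \<le> R a b n" for a b n using E by (simp add: R_def X_def)
  have XA: "X a b * (16 powr s * real (A b) powr (2 * s - 1)) ^ i * real (A b) powr s \<le> 1"
    if Cab: "C a b" and i: "i < r" for a b i
  proof -
    have b: "1 \<le> b" using Cab by (auto simp: C_def)
    have A1: "1 \<le> real (A b)" using A(3)[OF b] by linarith
    have "(16 powr s * real (A b) powr (2 * s - 1)) ^ i * real (A b) powr s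
        = (16 powr s) ^ i * real (A b) powr ((2 * s - 1) * real i + s)"
      using A1 by (simp add: power_mult_distrib powr_add powr_powr[symmetric] powr_realpow)
    also have "\<dots> \<le> (16 powr s) ^ r * real (A b) powr g"
    proof (intro mult_mono power_increasing powr_mono)
      \<comment> \<open>Since \<open>s > 1 / 2\<close>, the demand is greatest at the last large
        digit, \<open>i = r - 1\<close>, where the exponent equals \<open>g\<close>.\<close>
      have "(2 * s - 1) * real i \<le> (2 * s - 1) * (real r - 1)" using s i by (intro mult_left_mono) auto
      then show "(2 * s - 1) * real i + s \<le> g" by (simp add: g_def)
    qed (use A1 s i in \<open>auto intro: ge_one_powr_ge_zero\<close>)
    finally have "X a b * ((16 powr s * real (A b) powr (2 * s - 1)) ^ i * real (A b) powr s) \<le>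
        X a b * ((16 powr s) ^ r * real (A b) powr g)"
      using E by (intro mult_left_mono) (auto simp: X_def)
    then show ?thesis using Cab by (simp add: C_def mult.assoc)
  qed
  have R_big: "R a b n * real (A b) powr s \<le> 1" "R a b n = X a b * (16 powr s * real (A b) powr (2 * s - 1)) ^ (n + r - b)"
    if "C a b" "n < b" "b \<le> n + r" for a b n
  proof -
    show eq: "R a b n = X a b * (16 powr s * real (A b) powr (2 * s - 1)) ^ (n + r - b)"
    proof (cases "n + r = b")
      case True
      then have "real n = real b - real r" by auto
      then show ?thesis using True by (auto simp: R_def X_def)
    qed (use that in \<open>simp add: R_def\<close>)
    show "R a b n * real (A b) powr s \<le> 1" unfolding eq using that r by (intro XA) auto
  qed
  have R_le: "R a b n \<le> E ^ L" if "C a b" "a \<le> n" "n < b" for a b n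
  proof (cases "n + r \<le> b")
    case True
    have "exp (- \<tau> * (real n - real a)) * E ^ (n + L + r - b) \<le> 1 * E ^ L"
      using True E \<tau>0 that by (intro mult_mono power_increasing) auto
    then show ?thesis using True by (simp add: R_def)
  next
    case False
    have b: "1 \<le> b" using that by auto
    have "1 \<le> real (A b) powr s" using A(3)[OF b] s by (intro ge_one_powr_ge_zero) auto
    then have "R a b n * 1 \<le> R a b n * real (A b) powr s" using R0 by (intro mult_left_mono) auto
    also have "\<dots> \<le> 1" using that False by (intro R_big) auto
    also have "1 \<le> E ^ L" using E by (rule one_le_power)
    finally show ?thesis by simp
  qed
  have stepB: "R a b n * exp (- \<tau> * real L) \<le> R a b (n + L)" if "n + L + r \<le> b" "a \<le> n" for a b n
  proof -
    have "R a b n * exp (- \<tau> * real L) = exp (- \<tau> * (real (n + L) - real a)) * 1"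
      using that by (simp add: R_def exp_add[symmetric] algebra_simps)
    also have "\<dots> \<le> exp (- \<tau> * (real (n + L) - real a)) * E ^ (n + L + L + r - b)"
      using E by (intro mult_left_mono one_le_power) auto
    finally show ?thesis using that by (simp add: R_def)
  qed
  have stepF: "R a b n * 16 powr s = R a b (Suc n)" if "n + r < b" "b < n + L + r" for a b n
  proof -
    have "Suc n + L + r - b = Suc (n + L + r - b)" using that by linarith
    moreover have "exp (- \<tau> * (real (Suc n) - real a)) * exp \<tau> = exp (- \<tau> * (real n - real a))"
      by (simp add: exp_add[symmetric] algebra_simps)
    ultimately show ?thesis using that by (simp add: R_def E_def mult_ac)
  qed
  \<comment> \<open>The filler digit is 2 because every option must be buffered and therefore end in
    a digit at least 2.\<close>
  define opts where "opts w = (let n = length w; b = tgt n in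
      if b \<le> n + r then map (\<lambda>a. [a]) [A b..<2 * A b] else if n + L + r \<le> b then xs else [[2]])" for w :: "nat list"
  define p where "p w i = (let n = length w; b = tgt n in
      if b \<le> n + r then 1 / real (A b) else if n + L + r \<le> b then cf_den (xs ! i) powr (- 2 * s) / Z else 1)" for w :: "nat list" and i
  \<comment> \<open>The clause on digits records the large digits in the window of length
    \<open>r\<close> before each target; it is what places the limit points in
    \<open>F_set\<close>.\<close>
  define Inv where "Inv w \<mu> \<longleftrightarrow> 0 \<le> \<mu> \<and> pos_word w \<and>
      (\<forall>j<length w. tgt j \<le> j + r \<longrightarrow> A (tgt j) \<le> w ! j) \<and>
      (\<exists>k. \<nu> k \<le> length w \<and> length w < \<nu> (Suc k) \<and>
        \<mu> \<le> R (\<nu> k) (\<nu> (Suc k)) (length w) * cf_den w powr (- 2 * s))" for w \<mu>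
  \<comment> \<open>The three summands serve the separation of large digits, the separation of
    blocks, and the bound on the mass.\<close>
  define K where "K = 2 * (4 * (real N + 2)) powr s * 1 + E ^ L * ((real N + 2) * ((real N + 1)\<^sup>2) ^ L) powr s + E ^ L"
  have K0: "0 < K" "E ^ L \<le> K" "2 * (4 * (real N + 2)) powr s * 1 \<le> K"
    "E ^ L * ((real N + 2) * ((real N + 1)\<^sup>2) ^ L) powr s \<le> K"
    using E by (auto simp: K_def add_nonneg_pos add_pos_nonneg intro!: add_nonneg_pos)
  show ?thesis
  proof (rule hausdorff_dim_ge_of_tree[where K = K and Inv = Inv and opts = opts and p = p and M = N])
    show "0 < s" "0 < K" using s K0 by auto
    show "Inv [] 1" unfolding Inv_def
    proof (intro conjI exI[of _ 0])
      have "\<nu> 0 + r < \<nu> (Suc 0)" using \<nu>(3)[of 0] by (simp add: C_def)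
      then show "1 \<le> R (\<nu> 0) (\<nu> (Suc 0)) (length ([] :: nat list)) * cf_den [] powr (- 2 * s)"
        using \<nu>0 E by (simp add: R_def one_le_power)
    qed (use \<nu>0 \<nu>(2)[of 0] in auto)
  next
    fix w \<mu> assume I: "Inv w \<mu>"
    let ?n = "length w"
    obtain k where k: "\<nu> k \<le> ?n" "?n < \<nu> (Suc k)" "\<mu> \<le> R (\<nu> k) (\<nu> (Suc k)) ?n * cf_den w powr (- 2 * s)"
      using I unfolding Inv_def by blast
    let ?b = "\<nu> (Suc k)"
    have tgt: "tgt ?n = ?b" unfolding tgt_def using stage_eq[OF k(1,2)] by simp
    have b: "1 \<le> ?b" using k by linarith
    have Ab: "2 \<le> A ?b" by (rule A(3)[OF b])
    have \<mu>0: "0 \<le> \<mu>" and pw: "pos_word w"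
      and dig: "\<And>j. j < ?n \<Longrightarrow> tgt j \<le> j + r \<Longrightarrow> A (tgt j) \<le> w ! j" using I by (auto simp: Inv_def)
    have Ck: "C (\<nu> k) ?b" by (rule \<nu>(3))
    have qw: "0 < cf_den w" using pw by (intro cf_denom_pos) auto
    consider (big) "?b \<le> ?n + r" | (block) "?n + L + r \<le> ?b" "\<not> ?b \<le> ?n + r" | (fill) "\<not> ?b \<le> ?n + r" "\<not> ?n + L + r \<le> ?b"
      by blast
    note cases3 = this
    show "(\<Sum>i<length (opts w). p w i) = 1"
    proof (cases rule: cases3)
      case big
      then show ?thesis using Ab by (simp add: opts_def p_def Let_def tgt)
    next
      case block
      have "(\<Sum>i<length xs. cf_den (xs ! i) powr (- 2 * s)) = Z"
        unfolding Z_def using xs(1) by (simp add: sum.distinct_set_conv_list sum_list_sum_nth atLeast0LessThan)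
      then show ?thesis using block Z0 by (simp add: opts_def p_def Let_def tgt sum_divide_distrib[symmetric])
    next
      case fill
      then show ?thesis by (simp add: opts_def p_def Let_def tgt)
    qed
    show "0 \<le> \<mu> \<and> \<mu> \<le> K * cf_den w powr (- 2 * s)"
    proof -
      have "R (\<nu> k) ?b ?n * cf_den w powr (- 2 * s) \<le> K * cf_den w powr (- 2 * s)"
        using R_le[OF Ck k(1,2)] K0 by (intro mult_right_mono) auto
      then show ?thesis using k \<mu>0 by simp
    qed
    { fix i assume i: "i < length (opts w)"
      show "0 < p w i \<and> opts w ! i \<noteq> [] \<and> buffered N (opts w ! i) \<and> Inv (w @ opts w ! i) (\<mu> * p w i)"
      proof (cases rule: cases3)
        case big
        let ?A = "A ?b"
        have iA: "i < ?A" using i big by (simp add: opts_def Let_def tgt)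
        have o: "opts w ! i = [?A + i]" and p: "p w i = 1 / real ?A"
          using big iA by (simp_all add: opts_def p_def Let_def tgt)
        have A0: "0 < real ?A" using Ab by linarith
        let ?R = "R (\<nu> k) ?b ?n"
        have "\<mu> * (1 / real ?A) \<le> ?R / real ?A * cf_den w powr (- 2 * s)"
          using k(3) A0 by (simp add: divide_right_mono)
        then have "\<mu> * (1 / real ?A) \<le> ?R / real ?A * (2 * (2 * real ?A)) powr (2 * s) * cf_den (w @ [?A + i]) powr (- 2 * s)"
          using R0 s iA Ab pw A0 by (intro cf_den_powr_append_ge) auto
        also have "?R / real ?A * (2 * (2 * real ?A)) powr (2 * s) = ?R * (16 powr s * real ?A powr (2 * s - 1))"
        proof -
          have "(2 * (2 * real ?A)) powr (2 * s) = 4 powr (2 * s) * real ?A powr (2 * s)"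
            by (simp add: powr_mult[symmetric])
          moreover have "4 powr (2 * s) = 16 powr s" using powr_powr[of 4 2 s] by simp
          moreover have "real ?A powr (2 * s - 1) = real ?A powr (2 * s) / real ?A"
            using A0 by (simp add: powr_diff)
          ultimately show ?thesis by simp
        qed
        finally have le: "\<mu> * (1 / real ?A) \<le> ?R * (16 powr s * real ?A powr (2 * s - 1)) * cf_den (w @ [?A + i]) powr (- 2 * s)" .
        have "\<exists>k'. \<nu> k' \<le> Suc ?n \<and> Suc ?n < \<nu> (Suc k') \<and> ?R * (16 powr s * real ?A powr (2 * s - 1)) \<le> R (\<nu> k') (\<nu> (Suc k')) (Suc ?n)"
        proof (cases "Suc ?n < ?b")
          case True
          have "Suc (?n + r - ?b) = Suc ?n + r - ?b" using big by linarith
          then have "?R * (16 powr s * real ?A powr (2 * s - 1)) = R (\<nu> k) ?b (Suc ?n)"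
            using R_big(2)[OF Ck k(2) big] R_big(2)[OF Ck True] big by (simp flip: power_Suc2)
          then show ?thesis using True k by (intro exI[of _ k]) auto
        next
          \<comment> \<open>After the last large digit the stage advances and the bound restarts at
            a value at least 1. The old bound has come down to at most 1, because
            \<open>g - (2 * s - 1) * r = 1 - s\<close> is positive.\<close>
          case False
          then have n: "Suc ?n = ?b" using k by linarith
          have cab: "?b + r < \<nu> (Suc (Suc k))" using \<nu>(3)[of "Suc k"] by (simp add: C_def)
          have "1 \<le> R ?b (\<nu> (Suc (Suc k))) ?b" using cab E by (simp add: R_def one_le_power)
          moreover have "?R * (16 powr s * real ?A powr (2 * s - 1)) \<le> 1"
          proof -
            have "Suc (?n + r - ?b) = r" using n r by linarith
            moreover have "X (\<nu> k) ?b * (16 powr s * real ?A powr (2 * s - 1)) ^ r \<le> 1"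
            proof -
              have "(16 powr s * real ?A powr (2 * s - 1)) ^ r = (16 powr s) ^ r * real ?A powr ((2 * s - 1) * real r)"
                using A0 by (simp add: power_mult_distrib powr_powr[symmetric] powr_realpow)
              also have "\<dots> \<le> (16 powr s) ^ r * real ?A powr g"
                using Ab s by (intro mult_left_mono powr_mono) (auto simp: g_def algebra_simps)
              finally have "X (\<nu> k) ?b * (16 powr s * real ?A powr (2 * s - 1)) ^ r \<le> X (\<nu> k) ?b * ((16 powr s) ^ r * real ?A powr g)"
                using E by (intro mult_left_mono) (auto simp: X_def)
              then show ?thesis using Ck by (simp add: C_def mult.assoc)
            qed
            ultimately show ?thesis unfolding R_big(2)[OF Ck k(2) big] by (simp only: mult.assoc power_Suc2[symmetric])
          qed
          ultimately show ?thesis using n cab by (intro exI[of _ "Suc k"]) auto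
        qed
        then obtain k' where k': "\<nu> k' \<le> Suc ?n" "Suc ?n < \<nu> (Suc k')"
          "?R * (16 powr s * real ?A powr (2 * s - 1)) \<le> R (\<nu> k') (\<nu> (Suc k')) (Suc ?n)" by blast
        have "\<mu> * (1 / real ?A) \<le> R (\<nu> k') (\<nu> (Suc k')) (Suc ?n) * cf_den (w @ [?A + i]) powr (- 2 * s)"
          using le k'(3) by (meson mult_right_mono order_trans powr_ge_zero)
        then have "Inv (w @ [?A + i]) (\<mu> * (1 / real ?A))"
          unfolding Inv_def using \<mu>0 pw Ab k' dig tgt
          by (auto simp: nth_append less_Suc_eq intro!: exI[of _ k'])
        then show ?thesis using A0 Ab unfolding o p by (auto simp: buffered_def)
      next
        case block
        have ix: "i < length xs" using i block by (simp add: opts_def Let_def tgt)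
        let ?u = "xs ! i"
        have o: "opts w ! i = ?u" and p: "p w i = cf_den ?u powr (- 2 * s) / Z"
          using block by (simp_all add: opts_def p_def Let_def tgt)
        have u: "?u \<in> set xs" "length ?u = L" "pos_word ?u" "last ?u = 2" using xs(2)[of ?u] ix by auto
        have une: "?u \<noteq> []" using u L by auto
        have q: "0 < cf_den ?u" using u by (intro cf_denom_pos) auto
        have "successively (\<lambda>a b. a = 1 \<longrightarrow> b \<le> N) ?u"
          using N(2)[OF u(1)] by (auto simp: successively_conv_nth)
        then have buf: "buffered N ?u" using u by (simp add: buffered_def)
        let ?R = "R (\<nu> k) ?b ?n" and ?c = "cf_den ?u powr (- 2 * s) / Z"
        have c0: "0 \<le> ?c" using Z0 by simp
        have "\<mu> * ?c \<le> (?R * ?c) * cf_den w powr (- 2 * s)"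
          using mult_right_mono[OF k(3) c0] by (simp add: mult_ac)
        then have "\<mu> * ?c \<le> ?R * ?c * (2 * cf_den ?u) powr (2 * s) * cf_den (w @ ?u) powr (- 2 * s)"
          using s pw u by (intro cf_den_powr_append_ge mult_nonneg_nonneg R0 c0) auto
        also have "\<dots> \<le> R (\<nu> k) ?b (?n + L) * cf_den (w @ ?u) powr (- 2 * s)"
        proof (intro mult_right_mono)
          have "?c * (2 * cf_den ?u) powr (2 * s) = 4 powr s / Z"
          proof -
            have "(2 * cf_den ?u) powr (2 * s) = 4 powr s * cf_den ?u powr (2 * s)"
              using powr_powr[of 2 2 s] by (simp add: powr_mult)
            moreover have "cf_den ?u powr (- 2 * s) * cf_den ?u powr (2 * s) = 1"
              using q by (simp add: powr_add[symmetric])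
            ultimately show ?thesis by (simp add: field_simps)
          qed
          also have "\<dots> \<le> exp (- \<tau> * real L)"
            using Z0 by (simp add: exp_minus field_simps)
          finally have "?R * (?c * (2 * cf_den ?u) powr (2 * s)) \<le> ?R * exp (- \<tau> * real L)"
            using R0 by (intro mult_left_mono)
          also have "\<dots> \<le> R (\<nu> k) ?b (?n + L)" using block k by (intro stepB) auto
          finally show "?R * ?c * (2 * cf_den ?u) powr (2 * s) \<le> R (\<nu> k) ?b (?n + L)" by (simp add: mult.assoc)
        qed auto
        finally have le: "\<mu> * ?c \<le> R (\<nu> k) ?b (?n + L) * cf_den (w @ ?u) powr (- 2 * s)" .
        \<comment> \<open>A block ends before the window of large digits begins, so its own
          positions never meet the premise \<open>tgt j \<le> j + r\<close>.\<close>
        have new: "A (tgt j) \<le> (w @ ?u) ! j" if "j < ?n + L" "tgt j \<le> j + r" for j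
        proof (cases "j < ?n")
          case True
          then show ?thesis using dig that by (simp add: nth_append)
        next
          case False
          then have "stage j = k" using that block k r by (intro stage_eq) auto
          then have "tgt j = ?b" by (simp add: tgt_def)
          then show ?thesis using that block by linarith
        qed
        have "Inv (w @ ?u) (\<mu> * ?c)"
          unfolding Inv_def using mult_nonneg_nonneg[OF \<mu>0 c0] pw u new le k block r by (auto intro!: exI[of _ k])
        then show ?thesis unfolding o p using une buf q Z0 by simp
      next
        case fill
        have o: "opts w ! i = [2]" and p: "p w i = 1"
          using fill i by (simp_all add: opts_def p_def Let_def tgt)
        let ?R = "R (\<nu> k) ?b ?n"
        have "\<mu> \<le> ?R * (2 * 2) powr (2 * s) * cf_den (w @ [2]) powr (- 2 * s)"
          using s pw R0 k(3) by (intro cf_den_powr_append_ge) auto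
        also have "(2 * 2) powr (2 * s) = 16 powr s" using powr_powr[of 4 2 s] by simp
        also have "?R * 16 powr s = R (\<nu> k) ?b (Suc ?n)" using fill by (intro stepF) auto
        finally have le: "\<mu> \<le> R (\<nu> k) ?b (Suc ?n) * cf_den (w @ [2]) powr (- 2 * s)" .
        have "Suc ?n < ?b" using fill r by linarith
        then have "Inv (w @ [2]) \<mu>"
          unfolding Inv_def using \<mu>0 pw le k fill dig tgt by (auto simp: nth_append less_Suc_eq intro!: exI[of _ k])
        then show ?thesis unfolding o p by (simp add: buffered_def)
      qed }
    { fix i j d d' assume ij: "i < j" "j < length (opts w)" and d: "buffered_seq N d" "buffered_seq N d'"
        and wd: "seq_word d (length (opts w ! i)) = opts w ! i" "seq_word d' (length (opts w ! j)) = opts w ! j"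
      show "\<mu> * (\<Sum>k=i..j. p w k) \<le> K * (\<bar>cf_inf d - cf_inf d'\<bar> / (cf_den w)\<^sup>2) powr s"
      proof (cases rule: cases3)
        case big
        let ?A = "A ?b"
        have jA: "j < ?A" using ij big by (simp add: opts_def Let_def tgt)
        have o: "opts w ! i = [?A + i]" "opts w ! j = [?A + j]" and p: "p w = (\<lambda>k. 1 / real ?A)"
          using big jA ij by (auto simp add: opts_def p_def Let_def tgt)
        have A0: "0 < real ?A" using Ab by linarith
        have "\<mu> * (\<Sum>k=i..j. 1 / real ?A) \<le> 2 * (4 * (real N + 2)) powr s * 1 * (\<bar>cf_inf d - cf_inf d'\<bar> / (cf_den w)\<^sup>2) powr s"
        proof (rule big_digit_gap)
          show "d 0 = ?A + i" "d' 0 = ?A + j" using wd o by auto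
          have "R (\<nu> k) ?b ?n \<le> 1 * real ?A powr (- s)"
            using R_big(1)[OF Ck k(2) big] A0 by (simp add: powr_minus field_simps)
          then have "R (\<nu> k) ?b ?n * cf_den w powr (- 2 * s) \<le> 1 * real ?A powr (- s) * cf_den w powr (- 2 * s)"
            by (intro mult_right_mono) auto
          then show "\<mu> \<le> 1 * cf_den w powr (- 2 * s) * real ?A powr (- s)" using k(3) by (simp add: mult_ac)
          show "1 \<le> ?A" using Ab by linarith
        qed (use s ij jA d \<mu>0 qw in auto)
        also have "\<dots> \<le> K * (\<bar>cf_inf d - cf_inf d'\<bar> / (cf_den w)\<^sup>2) powr s"
          using K0 by (intro mult_right_mono) auto
        finally show ?thesis unfolding p .
      next
        case block
        have jx: "j < length xs" using ij block by (simp add: opts_def Let_def tgt)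
        have o: "opts w ! i = xs ! i" "opts w ! j = xs ! j"
          and p: "p w = (\<lambda>k. cf_den (xs ! k) powr (- 2 * s) / Z)"
          using block by (auto simp add: opts_def p_def Let_def tgt)
        have u: "xs ! i \<in> set xs" "xs ! j \<in> set xs" "length (xs ! i) = L" "length (xs ! j) = L"
          using xs(2)[of "xs ! i"] xs(2)[of "xs ! j"] jx ij by auto
        have wd': "seq_word d L = xs ! i" "seq_word d' L = xs ! j" using wd u unfolding o by auto
        have ne: "xs ! i \<noteq> xs ! j" using xs(1) ij jx by (simp add: nth_eq_iff_index_eq)
        let ?G = "(real N + 2) * ((real N + 1)\<^sup>2) ^ L"
        have G0: "0 < ?G" by (intro mult_pos_pos zero_less_power) auto
        \<comment> \<open>There are finitely many blocks and their digits are bounded, so different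
          blocks are separated by a constant, and the crude bound 1 for the total weight
          suffices.\<close>
        have gap: "1 / ?G \<le> \<bar>cf_inf d - cf_inf d'\<bar>"
        proof (rule cf_inf_gap_word[OF d])
          show "seq_word d L \<noteq> seq_word d' L" unfolding wd' by (rule ne)
          fix l assume l: "l < L"
          then have "d l \<in> set (seq_word d L)" "d' l \<in> set (seq_word d' L)" by auto
          then show "d l \<le> N \<and> d' l \<le> N" unfolding wd' using N(2) u by blast
        qed
        have "(1 / (cf_den w)\<^sup>2) powr s = cf_den w powr (- 2 * s)"
          using qw by (rule inverse_square_powr)
        then have "cf_den w powr (- 2 * s) = ?G powr s * ((1 / ?G) / (cf_den w)\<^sup>2) powr s"
          using G0 by (simp add: powr_mult[symmetric])
        also have "\<dots> \<le> ?G powr s * (\<bar>cf_inf d - cf_inf d'\<bar> / (cf_den w)\<^sup>2) powr s"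
          using gap G0 s by (intro mult_left_mono powr_mono2 divide_right_mono) (auto simp: less_imp_le)
        finally have 1: "cf_den w powr (- 2 * s) \<le> ?G powr s * (\<bar>cf_inf d - cf_inf d'\<bar> / (cf_den w)\<^sup>2) powr s" .
        have "(\<Sum>k=i..j. p w k) \<le> (\<Sum>k<length xs. p w k)"
          using jx Z0 by (intro sum_mono2) (auto simp: p)
        also have "\<dots> = 1"
        proof -
          have "(\<Sum>i<length xs. cf_den (xs ! i) powr (- 2 * s)) = Z"
            unfolding Z_def using xs(1) by (simp add: sum.distinct_set_conv_list sum_list_sum_nth atLeast0LessThan)
          then show ?thesis using Z0 by (simp add: p sum_divide_distrib[symmetric])
        qed
        finally have "\<mu> * (\<Sum>k=i..j. p w k) \<le> \<mu> * 1" using \<mu>0 by (intro mult_left_mono)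
        also have "\<dots> \<le> E ^ L * cf_den w powr (- 2 * s)"
        proof -
          have "R (\<nu> k) ?b ?n * cf_den w powr (- 2 * s) \<le> E ^ L * cf_den w powr (- 2 * s)"
            using R_le[OF Ck k(1,2)] by (intro mult_right_mono) auto
          then show ?thesis using k(3) by simp
        qed
        also have "\<dots> \<le> E ^ L * (?G powr s * (\<bar>cf_inf d - cf_inf d'\<bar> / (cf_den w)\<^sup>2) powr s)"
          using 1 E by (intro mult_left_mono) auto
        also have "\<dots> = (E ^ L * ?G powr s) * (\<bar>cf_inf d - cf_inf d'\<bar> / (cf_den w)\<^sup>2) powr s" by simp
        also have "\<dots> \<le> K * (\<bar>cf_inf d - cf_inf d'\<bar> / (cf_den w)\<^sup>2) powr s"
          using K0 by (intro mult_right_mono) auto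
        finally show ?thesis .
      next
        case fill
        then show ?thesis using ij by (simp add: opts_def Let_def tgt)
      qed }
  next
    fix d assume d: "buffered_seq N d" and I: "\<forall>M. \<exists>n\<ge>M. \<exists>\<mu>. Inv (seq_word d n) \<mu>"
    have pos: "1 \<le> d n" for n using d by (rule buffered_seq_ge_1)
    have dig: "A (tgt j) \<le> d j" if "tgt j \<le> j + r" for j
    proof -
      obtain m \<mu> where "m \<ge> Suc j" "Inv (seq_word d m) \<mu>" using I by blast
      then show ?thesis using that by (auto simp: Inv_def)
    qed
    show "cf_inf d \<in> F_set r \<psi>"
    proof (rule cf_inf_in_F_set[OF pos r min])
      fix M
      let ?b = "\<nu> (Suc M)"
      have "Suc M \<le> ?b" using mono by (rule strict_mono_imp_increasing)
      moreover have ab: "\<nu> M + r < ?b" using \<nu>(3)[of M] by (simp add: C_def)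
      moreover have "tail_min \<psi> ?b \<le> real (d j)" if j: "?b \<le> j + r" "j < ?b" for j
      proof -
        have "stage j = M" using j ab by (intro stage_eq) auto
        then have t: "tgt j = ?b" by (simp add: tgt_def)
        have "tail_min \<psi> ?b \<le> real (A ?b)" using \<nu>(1)[of M] A(1)[of ?b] by linarith
        also have "\<dots> \<le> real (d j)" using dig[of j] j unfolding t by simp
        finally show ?thesis .
      qed
      ultimately show "\<exists>n\<ge>M. r \<le> n \<and> (\<forall>j. n \<le> j + r \<longrightarrow> j < n \<longrightarrow> tail_min \<psi> n \<le> real (d j))"
        by (intro exI[of _ ?b]) auto
    qed
  qed
qed

section \<open>Upper bounds\<close>

lemma cf_eval_image_bounded_diameter:
  assumes "pos_word w" "0 \<le> \<delta>"
  shows "bounded (cf_eval w ` {0..\<delta>})" "diameter (cf_eval w ` {0..\<delta>}) \<le> \<delta> / (cf_den w)\<^sup>2"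
proof -
  have d: "dist (cf_eval w y) (cf_eval w y') \<le> \<delta> / (cf_den w)\<^sup>2" if "y \<in> {0..\<delta>}" "y' \<in> {0..\<delta>}" for y y'
  proof -
    have "dist (cf_eval w y) (cf_eval w y') \<le> \<bar>y - y'\<bar> / (cf_den w)\<^sup>2"
      using assms that by (auto simp: dist_real_def intro!: abs_cf_eval_diff_le)
    also have "\<dots> \<le> \<delta> / (cf_den w)\<^sup>2" using that by (intro divide_right_mono) auto
    finally show ?thesis .
  qed
  show "bounded (cf_eval w ` {0..\<delta>})"
    unfolding bounded_def using d[of 0] assms by (intro exI[of _ "cf_eval w 0"] exI[of _ "\<delta> / (cf_den w)\<^sup>2"]) auto
  show "diameter (cf_eval w ` {0..\<delta>}) \<le> \<delta> / (cf_den w)\<^sup>2"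
    using d assms by (intro diameter_le) (auto simp: dist_norm)
qed

lemma gauss_map_funpow_le:
  assumes x: "0 \<le> x" "x < 1" and pq: "pq_defined (Suc m) x" "\<Theta> \<le> real_of_int (partial_quotient (Suc m) x)" "0 < \<Theta>"
  shows "(gauss_map ^^ m) x \<le> 1 / \<Theta>"
proof -
  let ?y = "(gauss_map ^^ m) x"
  have y: "0 < ?y" using pq(1) gauss_map_funpow_range[OF x, of m] by (simp add: pq_defined_def less_le)
  have "\<Theta> \<le> 1 / ?y" using pq(2) by (simp add: partial_quotient_def) linarith
  then show ?thesis using y pq(3) by (simp add: field_simps)
qed

lemma cf_word_nth: "i < n \<Longrightarrow> cf_word n x ! i = nat (partial_quotient (Suc i) x)"
  by (simp add: cf_word_def)

definition big_words :: "real \<Rightarrow> nat \<Rightarrow> nat \<Rightarrow> nat list set" where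
  "big_words \<Theta> j n = {w \<in> cf_words n. j \<le> length (filter (\<lambda>a. \<Theta> \<le> real a) w)}"

text \<open>Deleting a large digit \<open>a\<close> divides the denominator by at least \<open>a / 2\<close>; summing over the position
  and over \<open>a\<close> removes the large digits one at a time.\<close>

lemma big_words_sum_step:
  assumes s: "0 \<le> \<sigma>" "\<sigma> \<le> s" and \<Theta>: "0 < \<Theta>"
  shows "infsum (\<lambda>w. ennreal (cf_den w powr (- 2 * s))) (big_words \<Theta> (Suc j) n) \<le>
    ennreal (real n * (4 powr s * \<Theta> powr (- 2 * (s - \<sigma>)))) * cf_sum \<sigma> (Suc 0) *
      infsum (\<lambda>w. ennreal (cf_den w powr (- 2 * s))) (big_words \<Theta> j (n - 1))"
proof -
  let ?f = "\<lambda>w. ennreal (cf_den w powr (- 2 * s))"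
  let ?G = "infsum ?f (big_words \<Theta> j (n - 1))"
  define D where "D = {[a] |a. 1 \<le> a \<and> \<Theta> \<le> real a}"
  \<comment> \<open>Reinserting a large digit at each possible place produces every word, some
    repeatedly; the overcount costs only the factor \<open>n\<close>.\<close>
  have cover: "big_words \<Theta> (Suc j) n \<subseteq> (\<Union>k<n. (\<lambda>(v, u). take k v @ u @ drop k v) ` (big_words \<Theta> j (n - 1) \<times> D))"
  proof
    fix w assume w: "w \<in> big_words \<Theta> (Suc j) n"
    then have "filter (\<lambda>a. \<Theta> \<le> real a) w \<noteq> []" by (auto simp: big_words_def)
    then obtain a where a: "a \<in> set w" "\<Theta> \<le> real a" by (auto simp: filter_empty_conv)
    obtain u v where uv: "w = u @ a # v" using split_list[OF a(1)] by blast
    have "w = (\<lambda>(v, u'). take (length u) v @ u' @ drop (length u) v) (u @ v, [a])" by (simp add: uv)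
    moreover have "(u @ v, [a]) \<in> big_words \<Theta> j (n - 1) \<times> D" "length u < n"
      using w a uv by (auto simp: big_words_def D_def)
    ultimately show "w \<in> (\<Union>k<n. (\<lambda>(v, u). take k v @ u @ drop k v) ` (big_words \<Theta> j (n - 1) \<times> D))" by blast
  qed
  have summand: "?f (take k v @ u @ drop k v) \<le>
      ennreal (4 powr s * \<Theta> powr (- 2 * (s - \<sigma>))) * ennreal (cf_den u powr (- 2 * \<sigma>)) * ?f v"
    if v: "v \<in> big_words \<Theta> j (n - 1)" and u: "u \<in> D" for k v u
  proof -
    obtain a where a: "u = [a]" "1 \<le> a" "\<Theta> \<le> real a" using u by (auto simp: D_def)
    have pv: "pos_word v" "pos_word (take k v)" "pos_word (drop k v)"
      using v by (auto simp: big_words_def dest: in_set_takeD in_set_dropD)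
    have pos: "0 < cf_den (take k v)" "0 < cf_den (drop k v)" "0 < cf_den v" "0 < real a"
      using pv a by (auto intro!: cf_denom_pos)
    have "cf_den v \<le> 2 * (cf_den (take k v) * cf_den (drop k v))"
      using cf_den_append_le[of "take k v" "drop k v"] pv by simp
    then have "real a / 2 * cf_den v \<le> cf_den (take k v) * (real a * cf_den (drop k v))"
      using mult_left_mono[of "cf_den v" "2 * (cf_den (take k v) * cf_den (drop k v))" "real a"] by (simp add: mult_ac)
    also have "\<dots> \<le> cf_den (take k v) * cf_den ([a] @ drop k v)"
      using cf_den_append_ge[of "[a]" "drop k v"] pv a pos by (intro mult_left_mono) auto
    also have "\<dots> \<le> cf_den (take k v @ u @ drop k v)"
      unfolding a using pv a by (intro cf_den_append_ge) auto
    finally have "cf_den (take k v @ u @ drop k v) powr (- 2 * s) \<le> (real a / 2 * cf_den v) powr (- 2 * s)"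
      using s pos by (intro powr_mono2') auto
    also have "\<dots> = 4 powr s * real a powr (- 2 * s) * cf_den v powr (- 2 * s)"
    proof -
      have "2 powr (- 2 * s) = 1 / 4 powr s"
        using powr_powr[of 2 2 s] by (simp add: powr_minus_divide)
      then show ?thesis by (simp only: powr_mult powr_divide) simp
    qed
    \<comment> \<open>The first factor is bounded through \<open>a \<ge> \<Theta>\<close>, the
      second is left for the sum over digits. With \<open>\<sigma>\<close> close to 1/2 this loses
      only a small power of \<open>\<Theta>\<close> against the sharp order
      \<open>\<Theta> powr (1 - 2 * s)\<close>.\<close>
    also have "real a powr (- 2 * s) = real a powr (- 2 * (s - \<sigma>)) * real a powr (- 2 * \<sigma>)"
      by (simp add: powr_add[symmetric] algebra_simps)
    also have "4 powr s * (real a powr (- 2 * (s - \<sigma>)) * real a powr (- 2 * \<sigma>)) * cf_den v powr (- 2 * s) \<le>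
        4 powr s * (\<Theta> powr (- 2 * (s - \<sigma>)) * real a powr (- 2 * \<sigma>)) * cf_den v powr (- 2 * s)"
      using s \<Theta> a by (intro mult_left_mono mult_right_mono powr_mono2') auto
    also have "\<dots> = (4 powr s * \<Theta> powr (- 2 * (s - \<sigma>))) * cf_den u powr (- 2 * \<sigma>) * cf_den v powr (- 2 * s)"
      by (simp add: a)
    finally show ?thesis by (simp add: ennreal_mult[symmetric] ennreal_leI)
  qed
  have "infsum ?f (big_words \<Theta> (Suc j) n) \<le>
      infsum ?f (\<Union>k<n. (\<lambda>(v, u). take k v @ u @ drop k v) ` (big_words \<Theta> j (n - 1) \<times> D))"
    by (rule infsum_ennreal_mono_set[OF cover])
  also have "\<dots> \<le> (\<Sum>k<n. infsum ?f ((\<lambda>(v, u). take k v @ u @ drop k v) ` (big_words \<Theta> j (n - 1) \<times> D)))"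
    by (intro infsum_ennreal_finite_UN_le) simp
  also have "\<dots> \<le> (\<Sum>k<n. ennreal (4 powr s * \<Theta> powr (- 2 * (s - \<sigma>))) * cf_sum \<sigma> (Suc 0) * ?G)"
  proof (rule sum_mono)
    fix k
    let ?c = "ennreal (4 powr s * \<Theta> powr (- 2 * (s - \<sigma>)))"
    have "infsum ?f ((\<lambda>(v, u). take k v @ u @ drop k v) ` (big_words \<Theta> j (n - 1) \<times> D)) \<le>
        infsum (\<lambda>x. ?f ((\<lambda>(v, u). take k v @ u @ drop k v) x)) (big_words \<Theta> j (n - 1) \<times> D)"
      by (rule infsum_ennreal_image_le)
    also have "\<dots> \<le> infsum (\<lambda>(v, u). ?c * ennreal (cf_den u powr (- 2 * \<sigma>)) * ?f v) (big_words \<Theta> j (n - 1) \<times> D)"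
      using summand by (intro infsum_ennreal_mono) auto
    also have "\<dots> = infsum (\<lambda>v. infsum (\<lambda>u. (?c * ?f v) * ennreal (cf_den u powr (- 2 * \<sigma>))) D) (big_words \<Theta> j (n - 1))"
      by (simp add: infsum_ennreal_Sigma mult_ac)
    also have "\<dots> = infsum (\<lambda>v. (?c * infsum (\<lambda>u. ennreal (cf_den u powr (- 2 * \<sigma>))) D) * ?f v) (big_words \<Theta> j (n - 1))"
    proof (rule infsum_cong)
      fix v
      show "infsum (\<lambda>u. (?c * ?f v) * ennreal (cf_den u powr (- 2 * \<sigma>))) D =
          (?c * infsum (\<lambda>u. ennreal (cf_den u powr (- 2 * \<sigma>))) D) * ?f v"
        by (subst infsum_ennreal_cmult) (simp only: mult_ac)
    qed
    also have "\<dots> = ?c * infsum (\<lambda>u. ennreal (cf_den u powr (- 2 * \<sigma>))) D * ?G"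
      by (rule infsum_ennreal_cmult)
    also have "\<dots> \<le> ?c * cf_sum \<sigma> (Suc 0) * ?G"
      unfolding cf_sum_def
      by (intro mult_right_mono mult_left_mono infsum_ennreal_mono_set) (auto simp: D_def)
    finally show "infsum ?f ((\<lambda>(v, u). take k v @ u @ drop k v) ` (big_words \<Theta> j (n - 1) \<times> D)) \<le>
        ?c * cf_sum \<sigma> (Suc 0) * ?G" .
  qed
  also have "\<dots> = ennreal (real n * (4 powr s * \<Theta> powr (- 2 * (s - \<sigma>)))) * cf_sum \<sigma> (Suc 0) * ?G"
    by (simp add: ennreal_mult ennreal_of_nat_eq_real_of_nat mult.assoc)
  finally show ?thesis .
qed

lemma big_words_sum:
  assumes s: "1 / 2 < \<sigma>" "\<sigma> \<le> s" and \<Theta>: "0 < \<Theta>"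
  shows "infsum (\<lambda>w. ennreal (cf_den w powr (- 2 * s))) (big_words \<Theta> j n) \<le>
    ennreal ((real n * (4 powr s * exp (log_cf_sum \<sigma> 1)) * \<Theta> powr (- 2 * (s - \<sigma>))) ^ j) * cf_sum s (n - j)"
proof (induction j arbitrary: n)
  case 0
  then show ?case unfolding cf_sum_def by (simp add: big_words_def)
next
  case (Suc j)
  let ?f = "\<lambda>w. ennreal (cf_den w powr (- 2 * s))"
  let ?c = "\<lambda>n. real n * (4 powr s * exp (log_cf_sum \<sigma> 1)) * \<Theta> powr (- 2 * (s - \<sigma>))"
  have "infsum ?f (big_words \<Theta> (Suc j) n) \<le>
      ennreal (real n * (4 powr s * \<Theta> powr (- 2 * (s - \<sigma>)))) * cf_sum \<sigma> (Suc 0) * infsum ?f (big_words \<Theta> j (n - 1))"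
    using s \<Theta> by (intro big_words_sum_step) auto
  also have "ennreal (real n * (4 powr s * \<Theta> powr (- 2 * (s - \<sigma>)))) * cf_sum \<sigma> (Suc 0) = ennreal (?c n)"
    using exp_log_cf_sum[OF s(1), of 1] by (simp add: ennreal_mult[symmetric] mult_ac)
  also have "ennreal (?c n) * infsum ?f (big_words \<Theta> j (n - 1)) \<le>
      ennreal (?c n) * (ennreal (?c (n - 1) ^ j) * cf_sum s (n - 1 - j))"
    by (intro mult_left_mono Suc.IH) simp
  also have "\<dots> \<le> ennreal (?c n) * (ennreal (?c n ^ j) * cf_sum s (n - 1 - j))"
    by (intro mult_left_mono mult_right_mono ennreal_leI power_mono) auto
  also have "\<dots> = ennreal (?c n ^ Suc j) * cf_sum s (n - Suc j)"
    by (simp add: mult.assoc[symmetric] ennreal_mult[symmetric])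
  finally show ?case .
qed

lemma tail_min_le:
  assumes "has_tail_minima \<psi>" "1 \<le> n"
  shows "tail_min \<psi> n \<le> \<psi> n"
proof -
  obtain m where "m \<ge> n" "\<And>k. k \<ge> n \<Longrightarrow> \<psi> m \<le> \<psi> k"
    using assms unfolding has_tail_minima_def by blast
  then show ?thesis using tail_min_eq[of n m \<psi>] by simp
qed

text \<open>Passing from \<open>n\<close> to the position \<open>k\<^sub>r \<le> n\<close> of the last large digit only lowers the increasing threshold.\<close>

lemma F_set_large_digit_positions:
  assumes r: "1 \<le> r" and min: "has_tail_minima \<psi>" and x: "x \<in> F_set r \<psi>"
    and f: "mono f" "filterlim f at_top sequentially" "\<forall>\<^sub>F n in sequentially. f n \<le> tail_min \<psi> n"
  shows "\<exists>\<^sub>F m in sequentially. pq_defined (Suc m) x \<and> f (Suc m) \<le> of_int (partial_quotient (Suc m) x) \<and>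
    cf_word m x \<in> big_words (f (Suc m)) (r - 1) m"
  unfolding frequently_sequentially
proof
  fix N
  have x01: "0 \<le> x" "x < 1" using x by (auto simp: F_set_def)
  \<comment> \<open>A threshold above all quotients of index at most \<open>N\<close> forces the
    last large digit beyond \<open>N\<close>, which gives infinitely many positions.\<close>
  define D where "D = Max ((\<lambda>k. real_of_int (partial_quotient k x)) ` {..N})"
  have "\<forall>\<^sub>F n in sequentially. D < f n" using f(2) by (simp add: filterlim_at_top_dense)
  with f(3) have "\<forall>\<^sub>F n in sequentially. f n \<le> tail_min \<psi> n \<and> D < f n" by eventually_elim auto
  then obtain M where M: "\<And>n. n \<ge> M \<Longrightarrow> f n \<le> tail_min \<psi> n \<and> D < f n" by (auto simp: eventually_sequentially)
  obtain n where n: "n \<ge> M" "1 \<le> n" and "\<exists>k :: nat \<Rightarrow> nat. strict_mono_on {1..r} k \<and>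
          (\<forall>i\<in>{1..r}. 1 \<le> k i \<and> k i \<le> n \<and>
             pq_defined (k i) x \<and> \<psi> n \<le> of_int (partial_quotient (k i) x))"
    using x unfolding F_set_def infinite_nat_iff_unbounded_le by blast
  then obtain k where k: "strict_mono_on {1..r} k" "\<And>i. i \<in> {1..r} \<Longrightarrow> 1 \<le> k i \<and> k i \<le> n \<and>
             pq_defined (k i) x \<and> \<psi> n \<le> of_int (partial_quotient (k i) x)" by blast
  have fn: "f n \<le> of_int (partial_quotient (k i) x)" if "i \<in> {1..r}" for i
    using M[OF n(1)] tail_min_le[OF min n(2)] k(2)[OF that] by linarith
  have rr: "r \<in> {1..r}" using r by simp
  have kN: "N < k r"
  proof (rule ccontr)
    assume "\<not> ?thesis"
    then have "real_of_int (partial_quotient (k r) x) \<le> D" unfolding D_def by (intro Max_ge) auto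
    then show False using fn[OF rr] M[OF n(1)] by linarith
  qed
  define m where "m = k r - 1"
  have m: "k r = Suc m" using k(2)[OF rr] by (simp add: m_def)
  have fm: "f (Suc m) \<le> f n" using f(1) k(2)[OF rr] m by (auto dest: monoD)
  have def: "pq_defined (Suc m) x" using k(2)[OF rr] m by simp
  have w: "pos_word (cf_word m x)" "length (cf_word m x) = m"
  proof -
    have "m = 0 \<or> pq_defined m x" using pq_defined_mono[OF def, of m] by (cases m) auto
    then show "pos_word (cf_word m x)" "length (cf_word m x) = m" using cf_word_props[OF x01] by auto
  qed
  have "r - 1 \<le> length (filter (\<lambda>a. f (Suc m) \<le> real a) (cf_word m x))"
  proof -
    have "inj_on (\<lambda>i. k i - 1) {1..r - 1}"
    proof (rule inj_onI)
      fix i j assume ij: "i \<in> {1..r - 1}" "j \<in> {1..r - 1}" "k i - 1 = k j - 1"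
      then have ir: "i \<in> {1..r}" "j \<in> {1..r}" by auto
      then have "1 \<le> k i" "1 \<le> k j" using k(2) by blast+
      then have "k i = k j" using ij(3) by linarith
      moreover have "inj_on k {1..r}" by (rule strict_mono_on_imp_inj_on[OF k(1)])
      ultimately show "i = j" using ir by (simp add: inj_on_eq_iff)
    qed
    then have "card ((\<lambda>i. k i - 1) ` {1..r - 1}) = r - 1" by (simp add: card_image)
    moreover have "(\<lambda>i. k i - 1) ` {1..r - 1} \<subseteq> {i. i < length (cf_word m x) \<and> f (Suc m) \<le> real (cf_word m x ! i)}"
    proof
      fix l assume "l \<in> (\<lambda>i. k i - 1) ` {1..r - 1}"
      then obtain i where i: "i \<in> {1..r - 1}" "l = k i - 1" by blast
      have ir: "i \<in> {1..r}" using i by auto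
      have "k i < k r" using strict_mono_onD[OF k(1) ir rr] i by auto
      then have l: "l < m" "Suc l = k i" using i m k(2)[OF ir] by auto
      have "1 \<le> partial_quotient (Suc l) x"
        using partial_quotient_ge_1[OF x01] k(2)[OF ir] l by simp
      then have "real (cf_word m x ! l) = of_int (partial_quotient (k i) x)"
        using l by (simp add: cf_word_nth)
      then show "l \<in> {i. i < length (cf_word m x) \<and> f (Suc m) \<le> real (cf_word m x ! i)}"
        using l w fn[OF ir] fm by simp
    qed
    then have "card ((\<lambda>i. k i - 1) ` {1..r - 1}) \<le>
        card {i. i < length (cf_word m x) \<and> f (Suc m) \<le> real (cf_word m x ! i)}"
      by (rule card_mono[rotated]) simp
    ultimately show ?thesis by (simp only: length_filter_conv_card)
  qed
  then have "cf_word m x \<in> big_words (f (Suc m)) (r - 1) m" using w by (simp add: big_words_def)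
  then show "\<exists>m\<ge>N. pq_defined (Suc m) x \<and> f (Suc m) \<le> of_int (partial_quotient (Suc m) x) \<and>
    cf_word m x \<in> big_words (f (Suc m)) (r - 1) m"
    using def kN m fn[OF rr] fm by (intro exI[of _ m]) auto
qed

lemma filterlim_realpow_at_top:
  assumes "1 < (c::real)"
  shows "filterlim (\<lambda>n. c ^ n) at_top sequentially"
  using filterlim_at_infinity_imp_norm_at_top[OF filterlim_realpow_sequentially_gt1[of c]] assms
  by (simp add: norm_power)

text \<open>The part of the cylinder of \<open>w\<close> whose next digit is at least
  \<open>\<beta> ^ Suc n\<close> has diameter at most \<open>q powr (- 2) / \<beta> ^ Suc n\<close>.
  Its power \<open>s\<close> contributes \<open>s * ln \<beta>\<close> to the decay rate, the
  \<open>r - 1\<close> deletions contribute nearly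
  \<open>(2 * s - 1) * (r - 1) * ln \<beta>\<close>, and the remaining word costs the
  pressure.\<close>

lemma F_set_null_of_pressure:
  fixes s \<beta> :: real
  assumes s: "1 / 2 < s" and r: "1 \<le> r" and \<beta>: "1 < \<beta>"
    and P: "cf_pressure s < (s + (2 * s - 1) * (real r - 1)) * ln \<beta>"
    and min: "has_tail_minima \<psi>" and ev\<beta>: "\<forall>\<^sub>F n in sequentially. \<beta> ^ n \<le> tail_min \<psi> n"
  shows "hausdorff_outer_measure s (F_set r \<psi>) = 0"
proof -
  have ln\<beta>: "0 < ln \<beta>" using \<beta> by simp
  \<comment> \<open>The decay rate for a given \<open>\<sigma>\<close>. At 1/2 it is the bound of
    the hypothesis, but the sum over a deleted digit diverges there; continuity provides a
    \<open>\<sigma>\<close> slightly larger.\<close>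
  define H where "H \<sigma> = (s + (2 * s - 2 * \<sigma>) * (real r - 1)) * ln \<beta>" for \<sigma>
  \<comment> \<open>The maximum with 0 makes \<open>\<kappa>\<close> positive, so replacing the
    shortened length \<open>n - (r - 1)\<close> by \<open>n\<close> only enlarges the bound.\<close>
  define P0 where "P0 = max 0 (cf_pressure s)"
  have "P0 < H (1 / 2)"
  proof -
    have "0 < H (1 / 2)" unfolding H_def using s r ln\<beta> by (intro mult_pos_pos add_pos_nonneg mult_nonneg_nonneg) auto
    then show ?thesis using P by (simp add: P0_def H_def)
  qed
  moreover have "(H \<longlongrightarrow> H (1 / 2)) (at_right (1 / 2))" unfolding H_def by (intro tendsto_intros)
  ultimately have "\<forall>\<^sub>F \<sigma> in at_right (1 / 2). P0 < H \<sigma>" by (rule order_tendstoD(1)[rotated])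
  moreover have "\<forall>\<^sub>F \<sigma> in at_right (1 / 2 :: real). \<sigma> \<in> {1 / 2<..<s}" using s by (rule eventually_at_right_real)
  ultimately have ev: "\<forall>\<^sub>F \<sigma> in at_right (1 / 2). P0 < H \<sigma> \<and> 1 / 2 < \<sigma> \<and> \<sigma> < s"
    by eventually_elim auto
  obtain \<sigma> where \<sigma>: "P0 < H \<sigma>" "1 / 2 < \<sigma>" "\<sigma> < s"
    using eventually_happens'[OF _ ev] trivial_limit_at_right_real by blast
  define \<kappa> where "\<kappa> = (P0 + H \<sigma>) / 2"
  have \<kappa>: "0 < \<kappa>" "cf_pressure s < \<kappa>" "\<kappa> < H \<sigma>" using \<sigma> by (auto simp: \<kappa>_def P0_def)
  have "\<forall>\<^sub>F n in sequentially. log_cf_sum s n / real n < \<kappa>"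
    by (rule order_tendstoD(2)[OF cf_pressure_tendsto[OF s] \<kappa>(2)])
  then have "\<forall>\<^sub>F n in sequentially. log_cf_sum s n - \<kappa> * real n \<le> 0"
    using eventually_gt_at_top[of 0] by eventually_elim (simp add: field_simps)
  from eventually_le_imp_bounded[OF this] obtain C where C: "\<And>n. log_cf_sum s n \<le> \<kappa> * real n + C"
    by (auto simp: algebra_simps)
  \<comment> \<open>Half of the gap between \<open>\<kappa>\<close> and \<open>H \<sigma>\<close>,
    shared among the factors \<open>n\<close> that count the places of deleted digits.\<close>
  define \<epsilon> where "\<epsilon> = (H \<sigma> - \<kappa>) / (2 * real r)"
  have \<epsilon>: "0 < \<epsilon>" using \<kappa> r by (simp add: \<epsilon>_def)
  have n_le: "real n \<le> exp (\<epsilon> * real n) / \<epsilon>" for n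
  proof -
    have "\<epsilon> * real n \<le> exp (\<epsilon> * real n)" using exp_ge_add_one_self[of "\<epsilon> * real n"] by linarith
    then show ?thesis using \<epsilon> by (simp add: field_simps)
  qed
  define c where "c = 4 powr s * exp (log_cf_sum \<sigma> 1)"
  have c0: "0 < c" by (simp add: c_def)
  define \<rho> where "\<rho> = \<epsilon> * (real r - 1) + \<kappa> - H \<sigma>"
  have \<rho>: "\<rho> < 0"
  proof -
    have "\<epsilon> * (real r - 1) \<le> \<epsilon> * real r" using \<epsilon> by simp
    also have "\<dots> = (H \<sigma> - \<kappa>) / 2" using r by (simp add: \<epsilon>_def)
    finally show ?thesis using \<kappa> by (simp add: \<rho>_def)
  qed
  define J where "J n = big_words (\<beta> ^ Suc n) (r - 1) n" for n
  define U where "U n w = cf_eval w ` {0..1 / \<beta> ^ Suc n}" for n w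
  define e where "e n w = (1 / \<beta> ^ Suc n) / (cf_den w)\<^sup>2" for n w
  show ?thesis
  proof (rule hausdorff_outer_measure_eq_0I)
    show "0 < s" using s by simp
    show "\<exists>\<^sub>F n in sequentially. \<exists>w\<in>J n. x \<in> U n w" if x: "x \<in> F_set r \<psi>" for x
    proof -
      have x01: "0 \<le> x" "x < 1" using x by (auto simp: F_set_def)
      have "\<exists>\<^sub>F m in sequentially. pq_defined (Suc m) x \<and> \<beta> ^ Suc m \<le> of_int (partial_quotient (Suc m) x) \<and>
          cf_word m x \<in> J m"
        unfolding J_def
      proof (rule F_set_large_digit_positions[OF r min x _ _ ev\<beta>])
        show "mono (\<lambda>n. \<beta> ^ n)" using \<beta> by (intro monoI power_increasing) auto
        show "filterlim (\<lambda>n. \<beta> ^ n) at_top sequentially" using \<beta> by (rule filterlim_realpow_at_top)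
      qed
      then show ?thesis
      proof (rule frequently_elim1)
        fix m assume m: "pq_defined (Suc m) x \<and> \<beta> ^ Suc m \<le> of_int (partial_quotient (Suc m) x) \<and> cf_word m x \<in> J m"
        have "m = 0 \<or> pq_defined m x" using pq_defined_mono[of "Suc m" x m] m by (cases m) auto
        then have "x = cf_eval (cf_word m x) ((gauss_map ^^ m) x)" by (intro cf_word_props(1)[OF x01])
        moreover have "(gauss_map ^^ m) x \<le> 1 / \<beta> ^ Suc m"
          using m \<beta> by (intro gauss_map_funpow_le[OF x01]) auto
        ultimately have "x \<in> U m (cf_word m x)"
          unfolding U_def using gauss_map_funpow_range(1)[OF x01, of m] by (intro image_eqI[of _ _ "(gauss_map ^^ m) x"]) auto
        then show "\<exists>w\<in>J m. x \<in> U m w" using m by blast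
      qed
    qed
    show "bounded (U n w) \<and> diameter (U n w) \<le> e n w \<and> 0 \<le> e n w" if "w \<in> J n" for n w
      using that cf_eval_image_bounded_diameter[of w "1 / \<beta> ^ Suc n"] \<beta>
      by (auto simp: J_def big_words_def U_def e_def)
    show "infsum (\<lambda>w. ennreal (e n w powr s)) (J n) \<le> ennreal ((c / \<epsilon>) ^ (r - 1) * exp C * exp \<rho> ^ n)" for n
    proof -
      let ?\<Theta> = "\<beta> ^ Suc n"
      have \<Theta>: "0 < ?\<Theta>" using \<beta> by simp
      have \<Theta>p: "?\<Theta> powr (- a) \<le> exp (- a * ln \<beta> * real n)" if "0 \<le> a" for a
      proof -
        have "?\<Theta> powr (- a) \<le> (\<beta> ^ n) powr (- a)"
          using \<beta> that by (intro powr_mono2') (auto intro!: power_increasing)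
        also have "\<dots> = exp (- a * ln \<beta> * real n)" using \<beta> by (simp add: powr_def ln_realpow mult_ac)
        finally show ?thesis .
      qed
      have "infsum (\<lambda>w. ennreal (e n w powr s)) (J n) =
          infsum (\<lambda>w. ennreal (?\<Theta> powr (- s)) * ennreal (cf_den w powr (- 2 * s))) (J n)"
      proof (rule infsum_cong)
        fix w assume "w \<in> J n"
        then have q: "0 < cf_den w" by (auto simp: J_def big_words_def intro!: cf_denom_pos)
        have "e n w powr s = (1 / ?\<Theta>) powr s * (1 / (cf_den w)\<^sup>2) powr s"
          unfolding e_def by (subst powr_mult[symmetric]) simp
        also have "\<dots> = ?\<Theta> powr (- s) * cf_den w powr (- 2 * s)"
          unfolding inverse_square_powr[OF q] by (simp only: powr_divide powr_minus_divide powr_one_eq_one)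
        finally show "ennreal (e n w powr s) = ennreal (?\<Theta> powr (- s)) * ennreal (cf_den w powr (- 2 * s))"
          by (simp add: ennreal_mult[symmetric])
      qed
      also have "\<dots> \<le> ennreal (?\<Theta> powr (- s)) *
          (ennreal ((real n * c * ?\<Theta> powr (- 2 * (s - \<sigma>))) ^ (r - 1)) * cf_sum s (n - (r - 1)))"
        unfolding infsum_ennreal_cmult J_def c_def using \<sigma> \<Theta> by (intro mult_left_mono big_words_sum) auto
      also have "\<dots> = ennreal (?\<Theta> powr (- s) * ((real n * c * ?\<Theta> powr (- 2 * (s - \<sigma>))) ^ (r - 1) *
          exp (log_cf_sum s (n - (r - 1)))))"
        unfolding exp_log_cf_sum[OF s] using c0 by (simp add: ennreal_mult[symmetric] zero_le_mult_iff)
      also have "\<dots> \<le> ennreal (exp (- s * ln \<beta> * real n) * ((exp (\<epsilon> * real n) / \<epsilon> * c * exp (- (2 * (s - \<sigma>)) * ln \<beta> * real n)) ^ (r - 1) *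
          exp (\<kappa> * real n + C)))"
      proof (intro ennreal_leI mult_mono power_mono)
        show "?\<Theta> powr (- s) \<le> exp (- s * ln \<beta> * real n)" using \<Theta>p[of s] s by simp
        show "?\<Theta> powr (- 2 * (s - \<sigma>)) \<le> exp (- (2 * (s - \<sigma>)) * ln \<beta> * real n)"
          using \<Theta>p[of "2 * (s - \<sigma>)"] \<sigma> by (simp add: algebra_simps)
        show "real n \<le> exp (\<epsilon> * real n) / \<epsilon>" by (rule n_le)
        have "log_cf_sum s (n - (r - 1)) \<le> \<kappa> * real (n - (r - 1)) + C" by (rule C)
        also have "\<dots> \<le> \<kappa> * real n + C" using \<kappa> by simp
        finally show "exp (log_cf_sum s (n - (r - 1))) \<le> exp (\<kappa> * real n + C)" by simp
      qed (use c0 \<epsilon> in auto)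
      also have "exp (- s * ln \<beta> * real n) * ((exp (\<epsilon> * real n) / \<epsilon> * c * exp (- (2 * (s - \<sigma>)) * ln \<beta> * real n)) ^ (r - 1) *
          exp (\<kappa> * real n + C)) = (c / \<epsilon>) ^ (r - 1) * exp C * exp \<rho> ^ n"
      proof -
        define Y where "Y = \<epsilon> * real n + - (2 * (s - \<sigma>)) * ln \<beta> * real n"
        have "exp (\<epsilon> * real n) / \<epsilon> * c * exp (- (2 * (s - \<sigma>)) * ln \<beta> * real n) = c / \<epsilon> * exp Y"
          unfolding Y_def exp_add by simp
        then have "(exp (\<epsilon> * real n) / \<epsilon> * c * exp (- (2 * (s - \<sigma>)) * ln \<beta> * real n)) ^ (r - 1) =
            (c / \<epsilon>) ^ (r - 1) * exp (real (r - 1) * Y)"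
          by (simp only: power_mult_distrib exp_of_nat_mult)
        moreover have "- s * ln \<beta> * real n + real (r - 1) * Y + (\<kappa> * real n + C) = C + real n * \<rho>"
          using r by (simp add: Y_def \<rho>_def H_def of_nat_diff algebra_simps)
        then have "exp (- s * ln \<beta> * real n) * exp (real (r - 1) * Y) * exp (\<kappa> * real n + C) = exp C * exp \<rho> ^ n"
          unfolding exp_add[symmetric] exp_of_nat_mult[symmetric] by simp
        ultimately show ?thesis by (simp add: mult_ac)
      qed
      finally show ?thesis .
    qed
    show "summable (\<lambda>n. (c / \<epsilon>) ^ (r - 1) * exp C * exp \<rho> ^ n)"
      using \<rho> by (intro summable_mult summable_geometric) auto
    show "0 \<le> (c / \<epsilon>) ^ (r - 1) * exp C * exp \<rho> ^ n" for n using c0 \<epsilon> by simp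
  qed
qed

section \<open>Covering by cylinders with doubly exponential digits\<close>

definition word_size :: "nat list \<Rightarrow> real" where
  "word_size w = (\<Prod>a\<leftarrow>w. real a + 1)"

lemma word_size_ge_1: "1 \<le> word_size w"
proof (induction w)
  case (Cons a w)
  then have "1 * 1 \<le> (real a + 1) * word_size w" by (intro mult_mono) auto
  then show ?case by (simp add: word_size_def)
qed (simp add: word_size_def)

lemma word_size_pos: "0 < word_size w"
  using word_size_ge_1[of w] by linarith

lemma word_size_append: "word_size (u @ v) = word_size u * word_size v"
  by (simp add: word_size_def)

text \<open>Each digit satisfies \<open>a \<ge> (a + 1) / 2\<close>. Unlike the denominator,
  \<open>word_size\<close> is exactly multiplicative, so sums over words factor and its logarithm is
  additive; the lost \<open>2 ^ n\<close> is harmless next to \<open>exp (c ^ n)\<close>.\<close>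

lemma word_size_le_cf_den: "pos_word w \<Longrightarrow> word_size w / 2 ^ length w \<le> cf_den w"
proof -
  assume w: "pos_word w"
  then have "word_size w / 2 ^ length w \<le> (\<Prod>a\<leftarrow>w. real a)"
  proof (induction w)
    case (Cons a w)
    have "(real a + 1) / 2 * (word_size w / 2 ^ length w) \<le> real a * (\<Prod>a\<leftarrow>w. real a)"
      using Cons word_size_pos[of w] by (intro mult_mono) (auto intro: less_imp_le)
    then show ?case by (simp add: word_size_def)
  qed (simp add: word_size_def)
  also have "\<dots> \<le> cf_den w" using w by (rule prod_list_le_cf_den)
  finally show ?thesis .
qed

lemma infsum_word_size_powr_le:
  assumes "1 < \<rho>"
  shows "\<exists>z>0. \<forall>n. infsum (\<lambda>w. ennreal (word_size w powr (- \<rho>))) (cf_words n) \<le> ennreal (z ^ n)"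
proof -
  let ?g = "\<lambda>k. (real (Suc k) + 1) powr (- \<rho>)"
  have "summable (\<lambda>k. real k powr (- \<rho>))" using assms by (simp add: summable_real_powr_iff)
  then have "summable (\<lambda>k. real (k + 2) powr (- \<rho>))" by (rule summable_ignore_initial_segment)
  then have sum: "summable ?g" by (simp add: add_ac)
  define z where "z = suminf ?g"
  have "0 < sum ?g {0}" by simp
  also have "\<dots> \<le> z" unfolding z_def by (intro sum_le_suminf sum) auto
  finally have z: "0 < z" .
  have one: "infsum (\<lambda>w. ennreal (word_size w powr (- \<rho>))) (cf_words (Suc 0)) = ennreal z"
    unfolding infsum_cf_words_1 z_def word_size_def using sum by (simp add: suminf_ennreal2)
  have "infsum (\<lambda>w. ennreal (word_size w powr (- \<rho>))) (cf_words n) \<le> ennreal (z ^ n)" for n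
  proof (induction n)
    case 0
    then show ?case unfolding cf_words_0 by (simp add: word_size_def)
  next
    case (Suc n)
    let ?f = "\<lambda>w. ennreal (word_size w powr (- \<rho>))"
    have "infsum ?f (cf_words (Suc n)) = infsum (\<lambda>u. infsum (\<lambda>v. ?f (u @ v)) (cf_words (Suc 0))) (cf_words n)"
      using infsum_cf_words_add[of ?f n "Suc 0"] by (simp only: add_Suc_right add_0_right)
    also have "\<dots> = infsum (\<lambda>u. ennreal z * ?f u) (cf_words n)"
    proof (rule infsum_cong)
      fix u
      have "infsum (\<lambda>v. ?f (u @ v)) (cf_words (Suc 0)) = infsum (\<lambda>v. ?f u * ?f v) (cf_words (Suc 0))"
        using word_size_pos by (intro infsum_cong) (simp add: word_size_append powr_mult ennreal_mult)
      also have "\<dots> = ?f u * ennreal z" unfolding infsum_ennreal_cmult one ..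
      finally show "infsum (\<lambda>v. ?f (u @ v)) (cf_words (Suc 0)) = ennreal z * ?f u"
        by (simp only: mult.commute)
    qed
    also have "\<dots> \<le> ennreal z * ennreal (z ^ n)"
      unfolding infsum_ennreal_cmult by (intro mult_left_mono Suc.IH) simp
    also have "\<dots> = ennreal (z ^ Suc n)" using z by (simp add: ennreal_mult[symmetric])
    finally show ?case .
  qed
  then show ?thesis using z by blast
qed

text \<open>If the next digit were always smaller than allowed here, the logarithms of the word sizes would grow at
  most like \<open>c ^ n\<close>, contradicting the doubly exponential digits.\<close>

lemma frequently_digit_exceeds_word_size:
  fixes c b' :: real
  assumes c: "1 < c" "c < b'" and x: "0 \<le> x" "x < 1"
    and big: "\<exists>\<^sub>F m in sequentially. pq_defined (Suc m) x \<and> exp (b' ^ Suc m) \<le> of_int (partial_quotient (Suc m) x)"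
  shows "\<exists>\<^sub>F n in sequentially. pq_defined (Suc n) x \<and>
    word_size (cf_word n x) powr (c - 1) \<le> of_int (partial_quotient (Suc n) x) + 1 \<and>
    exp (c ^ n) \<le> of_int (partial_quotient (Suc n) x) + 1"
proof (rule ccontr)
  assume "\<not> ?thesis"
  then have ev: "\<forall>\<^sub>F n in sequentially. \<not> (pq_defined (Suc n) x \<and>
    word_size (cf_word n x) powr (c - 1) \<le> of_int (partial_quotient (Suc n) x) + 1 \<and>
    exp (c ^ n) \<le> of_int (partial_quotient (Suc n) x) + 1)"
    by (simp add: not_frequently)
  have def: "pq_defined (Suc n) x" for n
  proof -
    obtain m where "m \<ge> n" "pq_defined (Suc m) x" using big unfolding frequently_sequentially by blast
    then show ?thesis by (auto intro: pq_defined_mono[of "Suc m" x])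
  qed
  define a where "a n = real_of_int (partial_quotient (Suc n) x)" for n
  have a1: "1 \<le> a n" for n using partial_quotient_ge_1[OF x def[of n]] by (simp add: a_def)
  define l where "l n = ln (word_size (cf_word n x))" for n
  have lS: "l (Suc n) = l n + ln (a n + 1)" for n
  proof -
    have "real (nat (partial_quotient (Suc n) x)) = a n"
      using a1[of n] by (simp add: a_def)
    then have "word_size (cf_word (Suc n) x) = word_size (cf_word n x) * (a n + 1)"
      by (simp add: cf_word_def word_size_append) (simp add: word_size_def)
    then show ?thesis unfolding l_def using word_size_pos[of "cf_word n x"] a1[of n] by (simp add: ln_mult)
  qed
  obtain N where N: "\<And>n. n \<ge> N \<Longrightarrow> a n + 1 < word_size (cf_word n x) powr (c - 1) \<or> a n + 1 < exp (c ^ n)"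
    using ev def unfolding eventually_sequentially a_def[symmetric] by (auto simp: not_le)
  \<comment> \<open>The first entry makes \<open>K * c ^ n\<close> absorb an increment of
    \<open>c ^ n\<close> when \<open>n\<close> advances by one; the second starts the induction at
    \<open>N\<close>.\<close>
  define K where "K = max (1 / (c - 1)) (l N / c ^ N)"
  have K: "1 \<le> K * (c - 1)" "l N \<le> K * c ^ N"
  proof -
    have "1 / (c - 1) \<le> K" "l N / c ^ N \<le> K" by (auto simp: K_def)
    then show "1 \<le> K * (c - 1)" "l N \<le> K * c ^ N" using c by (simp_all add: field_simps)
  qed
  have l_le: "l n \<le> K * c ^ n" if "n \<ge> N" for n
    using that
  proof (induction n rule: dec_induct)
    case base
    show ?case by (rule K(2))
  next
    case (step n)
    have "l n + ln (a n + 1) \<le> K * c ^ Suc n"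
      using N[OF step.hyps(1)]
    proof
      assume "a n + 1 < word_size (cf_word n x) powr (c - 1)"
      then have "ln (a n + 1) < ln (word_size (cf_word n x) powr (c - 1))" using a1[of n] by (subst ln_less_cancel_iff) auto
      then have "ln (a n + 1) \<le> (c - 1) * l n" using word_size_pos[of "cf_word n x"] by (simp add: l_def ln_powr)
      then have "l n + ln (a n + 1) \<le> c * l n" by (simp add: algebra_simps)
      also have "\<dots> \<le> c * (K * c ^ n)" using step.IH c by (intro mult_left_mono) auto
      finally show ?thesis by (simp add: mult_ac)
    next
      assume "a n + 1 < exp (c ^ n)"
      then have "ln (a n + 1) < ln (exp (c ^ n))" using a1[of n] by (subst ln_less_cancel_iff) auto
      then have "ln (a n + 1) \<le> 1 * c ^ n" by simp
      also have "\<dots> \<le> (K * (c - 1)) * c ^ n" using K c by (intro mult_right_mono) auto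
      finally have "l n + ln (a n + 1) \<le> K * c ^ n + (K * (c - 1)) * c ^ n" using step.IH by linarith
      then show ?thesis by (simp add: algebra_simps)
    qed
    then show ?case by (simp add: lS)
  qed
  have "filterlim (\<lambda>n. (b' / c) ^ n) at_top sequentially" using c by (intro filterlim_realpow_at_top) simp
  then have "\<forall>\<^sub>F n in sequentially. K < (b' / c) ^ n" by (simp add: filterlim_at_top_dense)
  then obtain N' where N': "\<And>n. n \<ge> N' \<Longrightarrow> K < (b' / c) ^ n" by (auto simp: eventually_sequentially)
  obtain m where m: "m \<ge> max N N'" "exp (b' ^ Suc m) \<le> a m"
    using big unfolding frequently_sequentially a_def by blast
  have l0: "0 \<le> l m"
    unfolding l_def by (intro ln_ge_zero word_size_ge_1)
  have "b' ^ Suc m = ln (exp (b' ^ Suc m))" by simp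
  also have "\<dots> \<le> ln (a m + 1)" using m a1[of m] by (subst ln_le_cancel_iff) auto
  also have "\<dots> \<le> l (Suc m)" using lS[of m] l0 by simp
  also have "\<dots> \<le> K * c ^ Suc m" using m by (intro l_le) auto
  also have "\<dots> < (b' / c) ^ Suc m * c ^ Suc m" using N'[of "Suc m"] m c by (intro mult_strict_right_mono) auto
  also have "\<dots> = b' ^ Suc m" using c by (simp add: power_divide)
  finally show False by simp
qed

text \<open>Infinitely often the next digit exceeds both a power of the word size and
  \<open>exp (c ^ n)\<close>. The first bound raises the exponent of the word size from
  \<open>2 * s\<close> towards \<open>s * (1 + c) > 1\<close>, where the sum over words of length
  \<open>n\<close> is geometric in \<open>n\<close>; a small share of the second bound suppresses
  that geometric growth.\<close>

lemma F_set_null_of_double_exponential: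
  fixes s c b' :: real
  assumes r: "1 \<le> r" and c: "1 < c" "c < b'" and s: "1 < s * (1 + c)" "s \<le> 1 / 2"
    and min: "has_tail_minima \<psi>" and ev: "\<forall>\<^sub>F n in sequentially. exp (b' ^ n) \<le> tail_min \<psi> n"
  shows "hausdorff_outer_measure s (F_set r \<psi>) = 0"
proof -
  have s0: "0 < s"
  proof (rule ccontr)
    assume "\<not> ?thesis"
    then have "s * (1 + c) \<le> 0" using c by (intro mult_nonpos_nonneg) auto
    then show False using s by linarith
  qed
  \<comment> \<open>The share given to \<open>exp (- (c ^ n))\<close>, chosen to spend half of the
    excess of \<open>s * (1 + c)\<close> over 1. Then \<open>\<rho>\<close> is the midpoint of 1 and
    \<open>s * (1 + c)\<close>; the hypothesis \<open>s \<le> 1 / 2\<close> ensures that the share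
    is at most 1.\<close>
  define \<eta> where "\<eta> = (s * (1 + c) - 1) / (2 * (c - 1) * s)"
  have \<eta>0: "0 < \<eta>" using s c s0 by (auto simp: \<eta>_def intro!: divide_pos_pos mult_pos_pos)
  have "C * s * (X / (2 * C * s)) = X / 2" if "C \<noteq> 0" for C X :: real using that s0 by simp
  from this[of "c - 1" "s * (1 + c) - 1"] have \<eta>eq: "(c - 1) * s * \<eta> = (s * (1 + c) - 1) / 2"
    using c unfolding \<eta>_def by linarith
  have \<eta>1: "\<eta> \<le> 1"
  proof -
    have "s * (3 - c) \<le> 1"
    proof (cases "c \<le> 3")
      case True
      then have "s * (3 - c) \<le> 1 / 2 * (3 - c)" using s by (intro mult_right_mono) auto
      also have "\<dots> \<le> 1" using c by simp
      finally show ?thesis .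
    next
      case False
      then have "s * (3 - c) \<le> 0" using s0 by (intro mult_nonneg_nonpos) auto
      also have "(0 :: real) \<le> 1" by simp
      finally show ?thesis .
    qed
    then have "s * (1 + c) - 1 \<le> 2 * (c - 1) * s" by (simp add: algebra_simps)
    then show ?thesis using c s0 by (simp add: \<eta>_def)
  qed
  define \<rho> where "\<rho> = 2 * s + (c - 1) * s * (1 - \<eta>)"
  have "\<rho> = s * (1 + c) - (c - 1) * s * \<eta>" by (simp add: \<rho>_def algebra_simps)
  also have "\<dots> = s * (1 + c) - (s * (1 + c) - 1) / 2" by (simp only: \<eta>eq)
  also have "\<dots> = (s * (1 + c) + 1) / 2" by (simp add: field_simps)
  finally have \<rho>: "1 < \<rho>" using s(1) by simp
  obtain z where z: "0 < z" "\<And>n. infsum (\<lambda>w. ennreal (word_size w powr (- \<rho>))) (cf_words n) \<le> ennreal (z ^ n)"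
    using infsum_word_size_powr_le[OF \<rho>] by blast
  \<comment> \<open>The factor 2 comes from passing from \<open>1 / a\<close> to
    \<open>1 / (a + 1)\<close>.\<close>
  define \<delta> where "\<delta> n w = 2 * min (word_size w powr (- (c - 1))) (exp (- (c ^ n)))" for n w
  have \<delta>0: "0 < \<delta> n w" for n w using word_size_pos[of w] by (simp add: \<delta>_def)
  define U where "U n w = cf_eval w ` {0..\<delta> n w}" for n w
  define e where "e n w = \<delta> n w / (cf_den w)\<^sup>2" for n w
  define f where "f n = 2 powr s * (4 powr s * z) ^ n * exp (- (s * \<eta>) * c ^ n)" for n
  show ?thesis
  proof (rule hausdorff_outer_measure_eq_0I[OF s0])
    show "\<exists>\<^sub>F n in sequentially. \<exists>w\<in>cf_words n. x \<in> U n w" if x: "x \<in> F_set r \<psi>" for x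
    proof -
      have x01: "0 \<le> x" "x < 1" using x by (auto simp: F_set_def)
      have "\<exists>\<^sub>F m in sequentially. pq_defined (Suc m) x \<and> exp (b' ^ Suc m) \<le> of_int (partial_quotient (Suc m) x) \<and>
          cf_word m x \<in> big_words (exp (b' ^ Suc m)) (r - 1) m"
      proof (rule F_set_large_digit_positions[OF r min x _ _ ev])
        show "mono (\<lambda>n. exp (b' ^ n))" using c by (intro monoI) (auto intro: power_increasing)
        show "filterlim (\<lambda>n. exp (b' ^ n)) at_top sequentially"
          using c by (intro filterlim_compose[OF exp_at_top] filterlim_realpow_at_top) simp
      qed
      then have "\<exists>\<^sub>F m in sequentially. pq_defined (Suc m) x \<and> exp (b' ^ Suc m) \<le> of_int (partial_quotient (Suc m) x)"
        by (rule frequently_elim1) blast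
      from frequently_digit_exceeds_word_size[OF c x01 this] show ?thesis
      proof (rule frequently_elim1)
        fix n assume n: "pq_defined (Suc n) x \<and>
          word_size (cf_word n x) powr (c - 1) \<le> of_int (partial_quotient (Suc n) x) + 1 \<and>
          exp (c ^ n) \<le> of_int (partial_quotient (Suc n) x) + 1"
        let ?w = "cf_word n x" and ?y = "(gauss_map ^^ n) x" and ?a = "real_of_int (partial_quotient (Suc n) x)"
        have "n = 0 \<or> pq_defined n x" using pq_defined_mono[of "Suc n" x n] n by (cases n) auto
        note w = cf_word_props[OF x01 this]
        have a1: "1 \<le> ?a" using partial_quotient_ge_1[OF x01, of "Suc n"] n by simp
        have "?y \<le> 1 / ?a" using n a1 by (intro gauss_map_funpow_le[OF x01]) auto
        also have "\<dots> \<le> 2 * (1 / (?a + 1))" using a1 by (simp add: field_simps)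
        also have "\<dots> \<le> \<delta> n ?w"
        proof -
          have "1 / (?a + 1) \<le> 1 / word_size ?w powr (c - 1)" "1 / (?a + 1) \<le> 1 / exp (c ^ n)"
            using n a1 word_size_pos[of ?w] by (intro divide_left_mono; auto)+
          then show ?thesis by (simp add: \<delta>_def powr_minus_divide exp_minus inverse_eq_divide del: minus_diff_eq)
        qed
        finally have "x \<in> U n ?w"
          unfolding U_def using w(1) gauss_map_funpow_range(1)[OF x01, of n] by (intro image_eqI[of _ _ ?y]) auto
        then show "\<exists>w\<in>cf_words n. x \<in> U n w" using w by blast
      qed
    qed
    show "bounded (U n w) \<and> diameter (U n w) \<le> e n w \<and> 0 \<le> e n w" if "w \<in> cf_words n" for n w
      using that cf_eval_image_bounded_diameter[of w "\<delta> n w"] \<delta>0[of n w] by (auto simp: U_def e_def)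
    show "infsum (\<lambda>w. ennreal (e n w powr s)) (cf_words n) \<le> ennreal (f n)" for n
    proof -
      let ?c = "2 powr s * (4 powr s) ^ n * exp (- (s * \<eta>) * c ^ n)"
      have "infsum (\<lambda>w. ennreal (e n w powr s)) (cf_words n) \<le>
          infsum (\<lambda>w. ennreal ?c * ennreal (word_size w powr (- \<rho>))) (cf_words n)"
      proof (rule infsum_ennreal_mono)
        fix w assume w: "w \<in> cf_words n"
        let ?P = "word_size w" and ?m = "min (word_size w powr (- (c - 1))) (exp (- (c ^ n)))"
        have P0: "0 < ?P" by (rule word_size_pos)
        have m0: "0 < ?m" using P0 by simp
        have q0: "0 < cf_den w" using w by (intro cf_denom_pos) auto
        \<comment> \<open>The minimum is bounded by its first entry with weight
          \<open>1 - \<eta>\<close> and by its second with weight \<open>\<eta>\<close>.\<close>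
        have "?m powr s = ?m powr (s * (1 - \<eta>)) * ?m powr (s * \<eta>)"
          using m0 by (simp add: powr_add[symmetric] algebra_simps)
        also have "\<dots> \<le> (?P powr (- (c - 1))) powr (s * (1 - \<eta>)) * (exp (- (c ^ n))) powr (s * \<eta>)"
          using m0 s0 \<eta>0 \<eta>1 by (intro mult_mono powr_mono2) auto
        also have "\<dots> = ?P powr (- (c - 1) * (s * (1 - \<eta>))) * exp (- (s * \<eta>) * c ^ n)"
          by (simp only: powr_powr) (simp add: powr_def)
        finally have m: "?m powr s \<le> ?P powr (- (c - 1) * (s * (1 - \<eta>))) * exp (- (s * \<eta>) * c ^ n)" .
        have "?P / 2 ^ n \<le> cf_den w" using w word_size_le_cf_den[of w] by auto
        then have "cf_den w powr (- 2 * s) \<le> (?P / 2 ^ n) powr (- 2 * s)"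
          using P0 s0 by (intro powr_mono2') auto
        also have "\<dots> = (4 powr s) ^ n * ?P powr (- 2 * s)"
        proof -
          have "(1 / 2 ^ n) powr (- 2 * s) = (4 powr s) ^ n"
          proof -
            have "(1 / 2 ^ n :: real) powr (- 2 * s) = (2 ^ n) powr (2 * s)"
              by (simp add: powr_divide powr_minus_divide)
            also have "\<dots> = exp (real n * (s * ln 4))"
              using ln_realpow[of 2 2] by (simp add: powr_def ln_realpow mult_ac)
            also have "\<dots> = (4 powr s) ^ n" by (simp add: exp_of_nat_mult powr_def)
            finally show ?thesis .
          qed
          then show ?thesis using powr_mult[of "1 / 2 ^ n" ?P "- 2 * s"] by simp
        qed
        finally have q: "cf_den w powr (- 2 * s) \<le> (4 powr s) ^ n * ?P powr (- 2 * s)" .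
        have "e n w powr s = 2 powr s * ?m powr s * cf_den w powr (- 2 * s)"
        proof -
          have "e n w = 2 * ?m * (1 / (cf_den w)\<^sup>2)" by (simp add: e_def \<delta>_def)
          then show ?thesis using q0 by (simp only: powr_mult inverse_square_powr)
        qed
        also have "\<dots> \<le> 2 powr s * (?P powr (- (c - 1) * (s * (1 - \<eta>))) * exp (- (s * \<eta>) * c ^ n)) *
            ((4 powr s) ^ n * ?P powr (- 2 * s))"
          using m q by (intro mult_mono) auto
        also have "\<dots> = ?c * (?P powr (- (c - 1) * (s * (1 - \<eta>))) * ?P powr (- 2 * s))" by (simp only: mult_ac)
        also have "?P powr (- (c - 1) * (s * (1 - \<eta>))) * ?P powr (- 2 * s) = ?P powr (- \<rho>)"
          by (simp only: powr_add[symmetric]) (simp add: \<rho>_def algebra_simps)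
        finally show "ennreal (e n w powr s) \<le> ennreal ?c * ennreal (word_size w powr (- \<rho>))"
          by (simp add: ennreal_mult[symmetric] ennreal_leI)
      qed
      also have "\<dots> \<le> ennreal ?c * ennreal (z ^ n)"
        unfolding infsum_ennreal_cmult by (intro mult_left_mono z) simp
      also have "\<dots> = ennreal (f n)"
        using z by (simp add: ennreal_mult[symmetric] f_def power_mult_distrib mult_ac)
      finally show ?thesis .
    qed
    show f0: "0 \<le> f n" for n using z by (simp add: f_def)
    show "summable f"
    proof (rule summable_comparison_test_ev)
      have "0 < s * \<eta>" using s0 \<eta>0 by simp
      from bounded_above_linear_minus_exponential[OF c(1) this, of "ln (4 powr s * z) + 1"]
      show "\<forall>\<^sub>F n in sequentially. norm (f n) \<le> 2 powr s * exp (- 1) ^ n"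
      proof eventually_elim
        case (elim n)
        have "(4 powr s * z) ^ n = exp (real n * ln (4 powr s * z))"
          using z by (simp add: exp_of_nat_mult)
        then have "f n = 2 powr s * exp (real n * ln (4 powr s * z) + - (s * \<eta>) * c ^ n)"
          unfolding exp_add f_def by simp
        also have "\<dots> \<le> 2 powr s * exp (real n * - 1)"
          using elim by (intro mult_left_mono) (auto simp: algebra_simps)
        also have "\<dots> = 2 powr s * exp (- 1) ^ n" by (simp only: exp_of_nat_mult)
        finally show ?case using f0[of n] by simp
      qed
      show "summable (\<lambda>n. 2 powr s * exp (- 1 :: real) ^ n)"
        by (intro summable_mult summable_geometric) auto
    qed
  qed
qed

text \<open>The \<open>r\<close> digits ending at position \<open>n\<close> have indices from
  \<open>n - r\<close> on, where only \<open>exp (c ^ (n - r))\<close> is guaranteed; this explains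
  the divisor \<open>c ^ r\<close>.\<close>

lemma hausdorff_dim_F_set_ge_of_double_exponential:
  fixes c s :: real
  assumes c: "1 < c" and s: "0 < s" "s * (1 + c) < 1" and r: "1 \<le> r" and min: "has_tail_minima \<psi>"
    and fr: "\<exists>\<^sub>F n in sequentially. tail_min \<psi> n \<le> exp (c ^ n / c ^ r)"
  shows "ennreal s \<le> hausdorff_dim (F_set r \<psi>)"
proof (rule hausdorff_dim_ge_of_growing_digits[OF c s])
  fix d :: "nat \<Rightarrow> nat" assume d: "\<And>n. exp (c ^ n) \<le> real (d n)" "\<And>n. 1 \<le> d n"
  show "cf_inf d \<in> F_set r \<psi>"
  proof (rule cf_inf_in_F_set[OF d(2) r min])
    fix N
    obtain n where n: "n \<ge> max N r" "tail_min \<psi> n \<le> exp (c ^ n / c ^ r)"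
      using fr unfolding frequently_sequentially by blast
    have "tail_min \<psi> n \<le> real (d j)" if j: "n \<le> j + r" "j < n" for j
    proof -
      have "c ^ n \<le> c ^ (j + r)" using j c by (intro power_increasing) auto
      then have "c ^ n / c ^ r \<le> c ^ j" using c by (simp add: power_add field_simps)
      then have "exp (c ^ n / c ^ r) \<le> exp (c ^ j)" by simp
      then show ?thesis using n d(1)[of j] by linarith
    qed
    then show "\<exists>n\<ge>N. r \<le> n \<and> (\<forall>j. n \<le> j + r \<longrightarrow> j < n \<longrightarrow> tail_min \<psi> n \<le> real (d j))"
      using n by (intro exI[of _ n]) auto
  qed
qed

section \<open>The dimension formula\<close>

lemma ennreal_le_of_dense_real:
  assumes "0 \<le> a" "a < c" and "\<And>t. a < t \<Longrightarrow> t < c \<Longrightarrow> D \<le> ennreal t"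
  shows "D \<le> ennreal a"
proof (rule ennreal_le_epsilon)
  fix e :: real assume e: "0 < e"
  define t where "t = min (a + e) ((a + c) / 2)"
  have "D \<le> ennreal t" using assms e by (intro assms(3)) (auto simp: t_def min_def)
  also have "\<dots> \<le> ennreal (a + e)" by (intro ennreal_leI) (simp add: t_def)
  finally show "D \<le> ennreal a + ennreal e" using assms e by (simp add: ennreal_plus)
qed

lemma ennreal_ge_of_dense_real:
  assumes "0 \<le> a" "a < c" and "\<And>t. a < t \<Longrightarrow> t < c \<Longrightarrow> ennreal t \<le> D"
  shows "ennreal c \<le> D"
proof (rule ccontr)
  assume "\<not> ?thesis"
  then obtain x where x: "D = ennreal x" "0 \<le> x" by (cases D) (auto simp: not_le)
  with \<open>\<not> ?thesis\<close> have "x < c" by (simp add: not_le ennreal_less_iff)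
  define t where "t = (max a x + c) / 2"
  have "a < t" "t < c" "x < t" using assms \<open>x < c\<close> by (auto simp: t_def)
  then have "ennreal t \<le> ennreal x" using assms(3) x by simp
  then show False using \<open>x < t\<close> x \<open>a < t\<close> assms by (simp add: ennreal_le_iff)
qed

lemma tail_min_pos:
  assumes "\<And>n. 1 \<le> n \<Longrightarrow> 0 < \<psi> n" "has_tail_minima \<psi>" "1 \<le> n"
  shows "0 < tail_min \<psi> n"
proof -
  obtain m where "m \<ge> n" "\<And>k. k \<ge> n \<Longrightarrow> \<psi> m \<le> \<psi> k"
    using assms unfolding has_tail_minima_def by blast
  then show ?thesis using tail_min_eq[of n m \<psi>] assms by simp
qed

lemma frequently_less_of_liminf_less:
  fixes f :: "nat \<Rightarrow> real"
  assumes "liminf (\<lambda>n. ereal (f n)) < ereal x"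
  shows "\<exists>\<^sub>F n in sequentially. f n < x"
proof (rule ccontr)
  assume "\<not> ?thesis"
  then have "\<forall>\<^sub>F n in sequentially. ereal x \<le> ereal (f n)" by (simp add: not_frequently not_less)
  then have "ereal x \<le> liminf (\<lambda>n. ereal (f n))" by (rule Liminf_bounded)
  then show False using assms by simp
qed

lemma eventually_greater_of_less_liminf:
  fixes f :: "nat \<Rightarrow> real"
  assumes "ereal x < liminf (\<lambda>n. ereal (f n))"
  shows "\<forall>\<^sub>F n in sequentially. x < f n"
  using less_LiminfD[OF assms] by simp

context
  fixes r :: nat and \<psi> :: "nat \<Rightarrow> real"
  assumes r: "1 \<le> r" and pos: "\<And>n. 1 \<le> n \<Longrightarrow> 0 < \<psi> n" and min: "has_tail_minima \<psi>"
begin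

lemma frequently_tail_min_le_power:
  assumes "liminf (\<lambda>n. ereal (ln (tail_min \<psi> n) / real n)) < ereal (ln \<beta>)" "0 < \<beta>"
  shows "\<exists>\<^sub>F n in sequentially. tail_min \<psi> n \<le> \<beta> ^ n"
proof -
  have "\<exists>\<^sub>F n in sequentially. 0 < n \<and> ln (tail_min \<psi> n) / real n < ln \<beta>"
    using frequently_less_of_liminf_less[OF assms(1)] eventually_gt_at_top[of 0] by (rule frequently_eventually_conj)
  then show ?thesis
  proof (rule frequently_elim1)
    fix n :: nat assume n: "0 < n \<and> ln (tail_min \<psi> n) / real n < ln \<beta>"
    have t: "0 < tail_min \<psi> n" using n by (intro tail_min_pos pos min) auto
    have "0 < real n" using n by simp
    then have "ln (tail_min \<psi> n) < ln \<beta> * real n" using n by (simp only: pos_divide_less_eq)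
    also have "\<dots> = ln (\<beta> ^ n)" using assms(2) by (simp add: ln_realpow)
    finally have "ln (tail_min \<psi> n) < ln (\<beta> ^ n)" .
    then show "tail_min \<psi> n \<le> \<beta> ^ n" using t assms(2) by simp
  qed
qed

lemma eventually_power_le_tail_min:
  assumes "ereal (ln \<beta>) < liminf (\<lambda>n. ereal (ln (tail_min \<psi> n) / real n))" "0 < \<beta>"
  shows "\<forall>\<^sub>F n in sequentially. \<beta> ^ n \<le> tail_min \<psi> n"
  using eventually_greater_of_less_liminf[OF assms(1)] eventually_gt_at_top[of 0]
proof eventually_elim
  case (elim n)
  have t: "0 < tail_min \<psi> n" using elim by (intro tail_min_pos pos min) auto
  have "ln (\<beta> ^ n) < ln (tail_min \<psi> n)" using elim assms(2) by (simp add: ln_realpow field_simps)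
  then show "\<beta> ^ n \<le> tail_min \<psi> n" using t assms(2) by simp
qed

text \<open>Exponential thresholds lie below doubly exponential ones for every rate
  \<open>c > 1\<close>, so digits growing arbitrarily slowly in that scale are admissible. The
  choice \<open>c = 1 / (2 * t)\<close> makes \<open>t * (1 + c) = t + 1 / 2\<close>, below 1 for
  \<open>t < 1 / 2\<close>.\<close>

lemma hausdorff_dim_F_set_ge_half:
  assumes "liminf (\<lambda>n. ereal (ln (tail_min \<psi> n) / real n)) < ereal (ln \<beta>)" "1 < \<beta>"
  shows "ennreal (1 / 2) \<le> hausdorff_dim (F_set r \<psi>)"
proof (rule ennreal_ge_of_dense_real[of 0])
  fix t :: real assume t: "0 < t" "t < 1 / 2"
  define c where "c = 1 / (2 * t)"
  have c: "1 < c" "t * (1 + c) < 1" using t by (auto simp: c_def field_simps)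
  have "\<forall>\<^sub>F n in sequentially. ln \<beta> * real n - (1 / c ^ r) * c ^ n < 0"
    using c by (intro bounded_above_linear_minus_exponential) auto
  then have "\<forall>\<^sub>F n in sequentially. tail_min \<psi> n \<le> \<beta> ^ n \<longrightarrow> tail_min \<psi> n \<le> exp (c ^ n / c ^ r)"
  proof eventually_elim
    case (elim n)
    have "\<beta> ^ n = exp (real n * ln \<beta>)" using assms(2) by (simp add: exp_of_nat_mult)
    also have "\<dots> \<le> exp (c ^ n / c ^ r)" using elim by (simp add: mult.commute)
    finally show ?case by linarith
  qed
  moreover have "\<exists>\<^sub>F n in sequentially. tail_min \<psi> n \<le> \<beta> ^ n"
    using assms by (intro frequently_tail_min_le_power) auto
  ultimately have "\<exists>\<^sub>F n in sequentially. tail_min \<psi> n \<le> exp (c ^ n / c ^ r)"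
    by (rule frequently_rev_mp[rotated])
  then show "ennreal t \<le> hausdorff_dim (F_set r \<psi>)"
    by (rule hausdorff_dim_F_set_ge_of_double_exponential[OF c(1) t(1) c(2) r min])
qed auto

lemma hausdorff_dim_F_set_ge_pressure:
  assumes "liminf (\<lambda>n. ereal (ln (tail_min \<psi> n) / real n)) = ereal L" "0 \<le> L"
    and s: "1 / 2 < s" "s < 1" and P: "(s + (2 * s - 1) * (real r - 1)) * L < cf_pressure s"
  shows "ennreal s \<le> hausdorff_dim (F_set r \<psi>)"
proof -
  define g where "g = s + (2 * s - 1) * (real r - 1)"
  have g: "0 < g" unfolding g_def using s r by (intro add_pos_nonneg mult_nonneg_nonneg) auto
  have "L < cf_pressure s / g" using P g unfolding g_def[symmetric] by (simp add: pos_less_divide_eq mult.commute)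
  \<comment> \<open>The strict inequality leaves room for a base slightly above
    \<open>exp L\<close>, which the tail minima stay below infinitely often.\<close>
  then obtain L' where L': "L < L'" "L' < cf_pressure s / g" using dense by blast
  then have P': "g * L' < cf_pressure s" using g by (simp add: field_simps)
  show ?thesis
  proof (rule hausdorff_dim_F_set_ge_of_pressure[OF s r _ _ min])
    show "1 < exp L'" using L' assms(2) by simp
    show "(s + (2 * s - 1) * (real r - 1)) * ln (exp L') < cf_pressure s" using P' by (simp add: g_def)
    have "\<exists>\<^sub>F n in sequentially. tail_min \<psi> n \<le> exp L' ^ n"
      using assms(1) L' by (intro frequently_tail_min_le_power) auto
    then show "infinite {n. tail_min \<psi> n \<le> exp L' ^ n}"
      by (simp add: frequently_cofinite cofinite_eq_sequentially[symmetric])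
  qed
qed

lemma hausdorff_dim_F_set_eq_1:
  assumes "liminf (\<lambda>n. ereal (ln (tail_min \<psi> n) / real n)) = 0"
  shows "hausdorff_dim (F_set r \<psi>) = 1"
proof (rule antisym)
  show "hausdorff_dim (F_set r \<psi>) \<le> 1" by (rule hausdorff_dim_unit_interval_le) (auto simp: F_set_def)
  have "ennreal 1 \<le> hausdorff_dim (F_set r \<psi>)"
  proof (rule ennreal_ge_of_dense_real[of "1 / 2"])
    fix s :: real assume s: "1 / 2 < s" "s < 1"
    have "0 < (1 - s) * ln 2" using s by simp
    also have "\<dots> \<le> cf_pressure s" using cf_pressure_mono[of s 1] s cf_pressure_1 by simp
    finally have "0 < cf_pressure s" .
    then show "ennreal s \<le> hausdorff_dim (F_set r \<psi>)"
      using assms s by (intro hausdorff_dim_F_set_ge_pressure[of 0]) (auto simp: zero_ereal_def)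
  qed auto
  then show "1 \<le> hausdorff_dim (F_set r \<psi>)" by simp
qed

text \<open>Neither continuity of the pressure nor existence of a zero enters. From above, a
  nonpositive pressure at \<open>s\<close> becomes strictly negative at every \<open>t > s\<close>.
  From below, an exponent strictly between the dimension and the infimum would exceed 1/2 and have
  positive pressure, so the tree construction would contradict it.\<close>

lemma hausdorff_dim_F_set_eq_pressure:
  assumes L: "liminf (\<lambda>n. ereal (ln (tail_min \<psi> n) / real n)) = ereal L" "0 < L"
  shows "hausdorff_dim (F_set r \<psi>) = Inf (ennreal ` {s. 0 \<le> s \<and>
    pressure (\<lambda>x. - s * ln \<bar>gauss_deriv x\<bar> - (s + (2 * s - 1) * (real r - 1)) * L) \<le> 0})"
proof (rule antisym)
  let ?p = "\<lambda>s. pressure (\<lambda>x. - s * ln \<bar>gauss_deriv x\<bar> - (s + (2 * s - 1) * (real r - 1)) * L)"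
  define g where "g s = s + (2 * s - 1) * (real r - 1)" for s
  have g0: "0 < g s" if "1 / 2 < s" for s
    unfolding g_def using that r by (intro add_pos_nonneg mult_nonneg_nonneg) auto
  have p: "?p s = ereal (cf_pressure s - g s * L)" if "1 / 2 < s" for s
    unfolding g_def using that by (rule pressure_eq_cf_pressure)
  show "hausdorff_dim (F_set r \<psi>) \<le> Inf (ennreal ` {s. 0 \<le> s \<and> ?p s \<le> 0})"
  proof (rule Inf_greatest, safe)
    fix s :: real assume s: "0 \<le> s" "?p s \<le> 0"
    have s2: "1 / 2 < s"
    proof (rule ccontr)
      assume "\<not> ?thesis"
      then have "?p s = \<infinity>" using s by (intro pressure_eq_infinity) auto
      then show False using s by simp
    qed
    have ps: "cf_pressure s \<le> g s * L" using s p[OF s2] by simp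
    show "hausdorff_dim (F_set r \<psi>) \<le> ennreal s"
    proof (rule hausdorff_dim_leI[OF s(1)])
      fix t assume t: "s < t"
      then have t2: "1 / 2 < t" using s2 by simp
      have "g s \<le> g t" unfolding g_def using t r by (intro add_mono mult_right_mono) auto
      then have "g s * L \<le> g t * L" using L by (intro mult_right_mono) auto
      moreover have "0 < (t - s) * ln 2" using t by simp
      ultimately have pt: "cf_pressure t < g t * L" using ps cf_pressure_mono[OF s2 less_imp_le[OF t]] by linarith
      have "cf_pressure t / g t < L" using pt g0[OF t2] by (simp add: field_simps)
      then have "max 0 (cf_pressure t / g t) < L" using L by simp
      then obtain L' where "max 0 (cf_pressure t / g t) < L'" "L' < L" using dense by blast
      then have L': "0 < L'" "L' < L" "cf_pressure t / g t < L'" by simp_all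
      then have "cf_pressure t < g t * L'" using g0[OF t2] by (simp add: field_simps)
      then show "hausdorff_outer_measure t (F_set r \<psi>) = 0"
        using L' L t2 r min
        by (intro F_set_null_of_pressure[of t r "exp L'"] eventually_power_le_tail_min) (auto simp: g_def)
    qed
  qed
  show "Inf (ennreal ` {s. 0 \<le> s \<and> ?p s \<le> 0}) \<le> hausdorff_dim (F_set r \<psi>)"
  proof (rule ccontr)
    assume "\<not> ?thesis"
    then have lt: "hausdorff_dim (F_set r \<psi>) < Inf (ennreal ` {s. 0 \<le> s \<and> ?p s \<le> 0})" by (simp add: not_le)
    then obtain y where y: "hausdorff_dim (F_set r \<psi>) < y" "y < Inf (ennreal ` {s. 0 \<le> s \<and> ?p s \<le> 0})"
      using dense by blast
    then have "y \<noteq> top" using top.extremum_strict by blast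
    then obtain s where s: "y = ennreal s" "0 \<le> s" by (cases y) auto
    have "ennreal (1 / 2) \<le> hausdorff_dim (F_set r \<psi>)"
      using L by (intro hausdorff_dim_F_set_ge_half[of "exp (L + 1)"]) auto
    then have "ennreal (1 / 2) < ennreal s" using y s by (meson order_le_less_trans)
    then have s2: "1 / 2 < s" by (subst (asm) ennreal_less_iff) auto
    have "\<not> ?p s \<le> 0"
    proof
      assume "?p s \<le> 0"
      then have "Inf (ennreal ` {s. 0 \<le> s \<and> ?p s \<le> 0}) \<le> ennreal s" using s by (intro Inf_lower) auto
      then show False using y s by simp
    qed
    then have ps: "g s * L < cf_pressure s" using p[OF s2] by simp
    \<comment> \<open>From exponent 1 on \<open>cf_pressure\<close> is at most 0, whereas
      \<open>g s * L\<close> is positive.\<close>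
    have "s < 1"
    proof (rule ccontr)
      assume "\<not> ?thesis"
      then have "cf_pressure s \<le> cf_pressure 1 - (s - 1) * ln 2" "0 \<le> (s - 1) * ln 2"
        using cf_pressure_mono[of 1 s] by simp_all
      moreover have "0 < g s * L" using g0[OF s2] L by simp
      ultimately show False using ps cf_pressure_1 by linarith
    qed
    then have "ennreal s \<le> hausdorff_dim (F_set r \<psi>)"
      using s2 ps L by (intro hausdorff_dim_F_set_ge_pressure) (auto simp: g_def)
    then show False using y s by simp
  qed
qed

text \<open>The critical relation \<open>t * (1 + c) = 1\<close> of both doubly exponential bounds
  turns the rate \<open>b\<close> into \<open>1 / (1 + b)\<close>; each side is approached through
  rates strictly beyond \<open>b\<close> or strictly below it.\<close>

lemma hausdorff_dim_F_set_eq_inverse: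
  fixes b :: ennreal
  assumes inf: "liminf (\<lambda>n. ereal (ln (tail_min \<psi> n) / real n)) = \<infinity>"
    and b: "ln_ennreal b = liminf (\<lambda>n. ereal (ln (ln (tail_min \<psi> n)) / real n))"
  shows "hausdorff_dim (F_set r \<psi>) = 1 / (1 + b)"
proof -
  let ?D = "hausdorff_dim (F_set r \<psi>)"
  have large: "\<forall>\<^sub>F n in sequentially. \<beta> ^ n \<le> tail_min \<psi> n" if "0 < \<beta>" for \<beta>
    using inf that by (intro eventually_power_le_tail_min) auto
  \<comment> \<open>With base \<open>exp 1\<close> the tail minimum has logarithm at least
    \<open>n\<close>, so the iterated logarithm is eventually nonnegative and
    \<open>b \<ge> 1\<close>.\<close>
  have ln_large: "\<forall>\<^sub>F n in sequentially. 1 \<le> n \<and> 0 < tail_min \<psi> n \<and> real n \<le> ln (tail_min \<psi> n)"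
    using large[OF exp_gt_zero[of 1]] eventually_ge_at_top[of 1]
  proof eventually_elim
    case (elim n)
    have t: "0 < tail_min \<psi> n" using elim by (intro tail_min_pos pos min) auto
    have "ln (exp 1 ^ n) \<le> ln (tail_min \<psi> n)" using elim t by (subst ln_le_cancel_iff) auto
    then show ?case using elim t by (simp add: ln_realpow)
  qed
  have "0 \<le> liminf (\<lambda>n. ereal (ln (ln (tail_min \<psi> n)) / real n))"
  proof (rule Liminf_bounded)
    show "\<forall>\<^sub>F n in sequentially. 0 \<le> ereal (ln (ln (tail_min \<psi> n)) / real n)"
      using ln_large by eventually_elim simp
  qed
  then have b1: "1 \<le> b"
    unfolding b[symmetric] by (cases b) (auto simp: ln_ennreal_def ennreal_eq_0_iff split: if_splits)
  have upper: "?D \<le> ennreal t" if t: "0 < t" "t < 1 / 2" "ennreal (1 / t - 1) < b" for t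
  proof -
    have t1: "1 < 1 / t - 1" using t by (simp add: field_simps)
    obtain y where y: "ennreal (1 / t - 1) < y" "y < b" using dense t(3) by blast
    then have "y \<noteq> top" using top.extremum_strict by blast
    then obtain b' where b': "y = ennreal b'" "0 \<le> b'" by (cases y) auto
    have lt: "1 / t - 1 < b'" using y b' t1 by (simp add: ennreal_less_iff)
    define c where "c = (1 / t - 1 + b') / 2"
    have c: "1 < c" "c < b'" "1 / t - 1 < c" using lt t1 by (auto simp: c_def)
    have "1 < t * (1 + c)" using c(3) t by (simp add: field_simps)
    have "ereal (ln b') < ln_ennreal b"
      using y b' c by (cases b) (auto simp: ln_ennreal_def ennreal_less_iff)
    from eventually_greater_of_less_liminf[OF this[unfolded b]] ln_large
    have "\<forall>\<^sub>F n in sequentially. exp (b' ^ n) \<le> tail_min \<psi> n"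
    proof eventually_elim
      case (elim n)
      then have l0: "0 < ln (tail_min \<psi> n)" by linarith
      have "ln (b' ^ n) < ln (ln (tail_min \<psi> n))" using elim c by (simp add: ln_realpow field_simps)
      then have "b' ^ n < ln (tail_min \<psi> n)" using l0 c by (subst (asm) ln_less_cancel_iff) auto
      then have "exp (b' ^ n) < exp (ln (tail_min \<psi> n))" by simp
      then show ?case using elim by simp
    qed
    then have "hausdorff_outer_measure t (F_set r \<psi>) = 0"
      using c t \<open>1 < t * (1 + c)\<close> by (intro F_set_null_of_double_exponential[OF r c(1,2) _ _ min]) auto
    then show ?thesis using t by (intro hausdorff_dim_le) auto
  qed
  show ?thesis
  proof (cases b)
    case (real b0)
    then have br: "b = ennreal b0" "0 \<le> b0" by auto
    have "ennreal 1 \<le> ennreal b0" using b1 unfolding br(1) by (simp only: ennreal_1)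
    then have b0: "1 \<le> b0" using br(2) by (simp only: ennreal_le_iff)
    have "1 + b = ennreal (1 + b0)" unfolding br(1) using b0 by (subst ennreal_plus) auto
    then have "1 / (1 + b) = ennreal 1 / ennreal (1 + b0)" by (simp only: ennreal_1)
    also have "\<dots> = ennreal (1 / (1 + b0))" using b0 by (intro divide_ennreal) auto
    finally have eq: "1 / (1 + b) = ennreal (1 / (1 + b0))" .
    show ?thesis unfolding eq
    proof (rule antisym)
      show "?D \<le> ennreal (1 / (1 + b0))"
      proof (cases "b0 = 1")
        case True
        \<comment> \<open>At \<open>b0 = 1\<close> no rate strictly between 1 and \<open>b0\<close>
          exists for the doubly exponential covering. Instead, every base \<open>exp L\<close> is
          eventually exceeded, and \<open>L\<close> can be taken so large that any exponent above
          1/2 satisfies the pressure inequality.\<close>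
        have "?D \<le> ennreal (1 / 2)"
        proof (rule hausdorff_dim_leI)
          fix t :: real assume t: "1 / 2 < t"
          define g where "g = t + (2 * t - 1) * (real r - 1)"
          have g: "0 < g" unfolding g_def using t r by (intro add_pos_nonneg mult_nonneg_nonneg) auto
          define L where "L = max 1 (cf_pressure t / g + 1)"
          have "cf_pressure t / g < L" by (simp add: L_def)
          then have "cf_pressure t < g * L" using g by (simp add: field_simps)
          then show "hausdorff_outer_measure t (F_set r \<psi>) = 0"
            using t r min by (intro F_set_null_of_pressure[of t r "exp L"] large) (auto simp: g_def L_def)
        qed simp
        then show ?thesis using True by simp
      next
        case False
        show ?thesis
        proof (rule ennreal_le_of_dense_real)
          show "1 / (1 + b0) < 1 / 2" using b0 False by (simp add: field_simps)
          fix t assume t: "1 / (1 + b0) < t" "t < 1 / 2"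
          have t0: "0 < t" using t(1) b0 by (meson less_trans divide_pos_pos add_pos_nonneg zero_less_one order_trans zero_le_one)
          have "1 / t < 1 + b0" using t(1) t0 b0 by (simp add: field_simps)
          moreover have "0 \<le> 1 / t - 1" using t t0 by (simp add: field_simps)
          ultimately have "ennreal (1 / t - 1) < b" unfolding br(1) by (subst ennreal_less_iff) auto
          then show "?D \<le> ennreal t" using upper t t0 by blast
        qed (use b0 in simp)
      qed
      show "ennreal (1 / (1 + b0)) \<le> ?D"
      proof (rule ennreal_ge_of_dense_real[of 0])
        fix t assume t: "0 < t" "t < 1 / (1 + b0)"
        \<comment> \<open>A third of the room between \<open>b0\<close> and \<open>1 / t - 1\<close>
          separates two rates: \<open>c' > b0\<close> is undercut infinitely often, and passing from
          \<open>c'\<close> to the larger \<open>c\<close> absorbs the constant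
          \<open>c ^ r\<close>.\<close>
        define e where "e = (1 / t - 1 - b0) / 3"
        have "b0 + 1 < 1 / t" using t b0 by (simp add: field_simps)
        then have e: "0 < e" by (simp add: e_def)
        define c c' where "c = b0 + 2 * e" and "c' = b0 + e"
        have c: "1 < c" "1 < c'" "c' < c" "b0 < c'" using e b0 by (auto simp: c_def c'_def)
        have "1 + c < 1 / t"
        proof -
          have "3 * e = 1 / t - 1 - b0" unfolding e_def by (simp only: times_divide_eq_right) simp
          then show ?thesis using e unfolding c_def by linarith
        qed
        then have tc: "t * (1 + c) < 1" using t by (simp add: field_simps)
        have "ln_ennreal b < ereal (ln c')"
          unfolding br(1) using b0 c by (simp add: ln_ennreal_def ennreal_eq_0_iff)
        then have fr: "\<exists>\<^sub>F n in sequentially. ln (ln (tail_min \<psi> n)) / real n < ln c'"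
          unfolding b by (rule frequently_less_of_liminf_less)
        have "filterlim (\<lambda>n. (c / c') ^ n) at_top sequentially"
          using c by (intro filterlim_realpow_at_top) simp
        then have "\<forall>\<^sub>F n in sequentially. c ^ r < (c / c') ^ n" by (simp add: filterlim_at_top_dense)
        with ln_large have "\<forall>\<^sub>F n in sequentially. ln (ln (tail_min \<psi> n)) / real n < ln c' \<longrightarrow>
            tail_min \<psi> n \<le> exp (c ^ n / c ^ r)"
        proof eventually_elim
          case (elim n)
          show ?case
          proof
            assume a: "ln (ln (tail_min \<psi> n)) / real n < ln c'"
            have l0: "0 < ln (tail_min \<psi> n)" using elim by linarith
            have "ln (ln (tail_min \<psi> n)) < ln (c' ^ n)" using a elim c by (simp add: ln_realpow field_simps)
            then have "ln (tail_min \<psi> n) < c' ^ n" using l0 c by (subst (asm) ln_less_cancel_iff) auto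
            also have "c' ^ n \<le> c ^ n / c ^ r"
            proof -
              have "c ^ r * c' ^ n < (c / c') ^ n * c' ^ n" using elim c by (intro mult_strict_right_mono) auto
              then show ?thesis using c by (simp add: power_divide field_simps)
            qed
            finally have "exp (ln (tail_min \<psi> n)) \<le> exp (c ^ n / c ^ r)" by simp
            then show "tail_min \<psi> n \<le> exp (c ^ n / c ^ r)" using elim by simp
          qed
        qed
        with fr have "\<exists>\<^sub>F n in sequentially. tail_min \<psi> n \<le> exp (c ^ n / c ^ r)" by (rule frequently_rev_mp)
        then show "ennreal t \<le> ?D"
          by (rule hausdorff_dim_F_set_ge_of_double_exponential[OF c(1) t(1) tc r min])
      qed (use b0 in auto)
    qed
  next
    case top
    have "?D \<le> ennreal 0"
    proof (rule ennreal_le_of_dense_real[of 0 "1 / 2"])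
      fix t :: real assume "0 < t" "t < 1 / 2"
      then show "?D \<le> ennreal t" using top by (intro upper) auto
    qed auto
    then show ?thesis using top by (simp add: ennreal_divide_top)
  qed
qed

end

theorem theorem1p8:
  fixes r :: nat and \<psi> :: "nat \<Rightarrow> real" and B b :: ennreal
  assumes "1 \<le> r"
    and "\<And>n. 1 \<le> n \<Longrightarrow> 0 < \<psi> n"
    and "has_tail_minima \<psi>"
    and "ln_ennreal B = liminf (\<lambda>n. ereal (ln (tail_min \<psi> n) / real n))"
    and "ln_ennreal b = liminf (\<lambda>n. ereal (ln (ln (tail_min \<psi> n)) / real n))"
  shows "(B = 1 \<longrightarrow> hausdorff_dim (F_set r \<psi>) = 1) \<and>
    (1 < B \<and> B < \<infinity> \<longrightarrow>
       hausdorff_dim (F_set r \<psi>) =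
         Inf (ennreal ` {s. 0 \<le> s \<and>
           pressure (\<lambda>x. - s * ln \<bar>gauss_deriv x\<bar>
             - (s + (2 * s - 1) * (real r - 1)) * ln (enn2real B)) \<le> 0})) \<and>
    (B = \<infinity> \<longrightarrow> hausdorff_dim (F_set r \<psi>) = 1 / (1 + b))"
proof (intro conjI impI)
  assume "B = 1"
  then have "liminf (\<lambda>n. ereal (ln (tail_min \<psi> n) / real n)) = 0"
    unfolding assms(4)[symmetric] by (simp add: ln_ennreal_def zero_ereal_def)
  then show "hausdorff_dim (F_set r \<psi>) = 1" by (intro hausdorff_dim_F_set_eq_1 assms)
next
  assume B: "1 < B \<and> B < \<infinity>"
  then obtain B0 where B0: "B = ennreal B0" "0 \<le> B0" by (cases B) auto
  then have "ennreal 1 < ennreal B0" using B by simp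
  then have "1 < B0" by (subst (asm) ennreal_less_iff) auto
  then have "liminf (\<lambda>n. ereal (ln (tail_min \<psi> n) / real n)) = ereal (ln B0)"
    unfolding assms(4)[symmetric] using B0 by (simp add: ln_ennreal_def ennreal_eq_0_iff)
  then show "hausdorff_dim (F_set r \<psi>) =
         Inf (ennreal ` {s. 0 \<le> s \<and>
           pressure (\<lambda>x. - s * ln \<bar>gauss_deriv x\<bar>
             - (s + (2 * s - 1) * (real r - 1)) * ln (enn2real B)) \<le> 0})"
    using hausdorff_dim_F_set_eq_pressure[OF assms(1-3), of "ln B0"] B0 \<open>1 < B0\<close> by simp
next
  assume "B = \<infinity>"
  then have "liminf (\<lambda>n. ereal (ln (tail_min \<psi> n) / real n)) = \<infinity>"
    unfolding assms(4)[symmetric] by (simp add: ln_ennreal_def)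
  then show "hausdorff_dim (F_set r \<psi>) = 1 / (1 + b)"
    using assms by (intro hausdorff_dim_F_set_eq_inverse) auto
qed

end
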